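(* If $U,V\in W^{2,2}(B)$ are radially symmetric and satisfy $\det\nabla^2 U=\det\nabla^2 V$ almost everywhere in $B$, then $|\nabla^2 U|^2=|\nabla^2 V|^2$ almost everywhere in $B$. In particular, $\mathcal{W}_k(U)=\mathcal{W}_k(V)$ for $k=\det\nabla^2 V$ (and indeed for any $k$).
   Context: $B\subset\mathbb{R}^2$ is the open unit disk and $\nabla^2 V$ is the (weak) Hessian matrix of $V$. A function $V$ on $B$ is radially symmetric if $V(x)=v(|x|)$ for some function $v$ on $[0,1)$. For a matrix $A$, $|A|^2=\sum_{i,j}A_{ij}^2$. For $k=\det\nabla^2 U_0$ with some $U_0\in W^{2,2}(B)$, the functional $\mathcal{W}_k: W^{2,2}(B)\to[0,\infty]$ is defined by $\mathcal{W}_k(V)=\int_B|\nabla^2 V(x)|^2\,dx$ if $\det\nabla^2 V=k$ a.e. on $B$, and $\mathcal{W}_k(V)=+\infty$ otherwise. *)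

theory Defs
  imports "HOL-Analysis.Analysis"
begin

definition partial_deriv :: "'n::finite \<Rightarrow> (real ^ 'n \<Rightarrow> real) \<Rightarrow> real ^ 'n \<Rightarrow> real" where
  "partial_deriv i f x = frechet_derivative f (at x) (axis i 1)"

primrec iter_partial :: "'n::finite list \<Rightarrow> (real ^ 'n \<Rightarrow> real) \<Rightarrow> real ^ 'n \<Rightarrow> real" where
  "iter_partial [] f = f"
| "iter_partial (i # js) f = partial_deriv i (iter_partial js f)"

text \<open>Differentiability of all iterated partial derivatives makes each of them
  continuous, so this is the usual class of infinitely differentiable functions.\<close>

definition smooth :: "(real ^ 'n::finite \<Rightarrow> real) \<Rightarrow> bool" where
  "smooth f \<longleftrightarrow> (\<forall>js x. iter_partial js f differentiable (at x))"

definition test_function :: "(real ^ 'n::finite) set \<Rightarrow> (real ^ 'n \<Rightarrow> real) \<Rightarrow> bool" where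
  "test_function \<Omega> \<phi> \<longleftrightarrow>
     smooth \<phi> \<and> compact (closure {x. \<phi> x \<noteq> 0}) \<and> closure {x. \<phi> x \<noteq> 0} \<subseteq> \<Omega>"

definition locally_integrable :: "(real ^ 'n::finite) set \<Rightarrow> (real ^ 'n \<Rightarrow> real) \<Rightarrow> bool" where
  "locally_integrable \<Omega> f \<longleftrightarrow> (\<forall>K. compact K \<and> K \<subseteq> \<Omega> \<longrightarrow> integrable (lebesgue_on K) f)"

definition square_integrable :: "(real ^ 'n::finite) set \<Rightarrow> (real ^ 'n \<Rightarrow> real) \<Rightarrow> bool" where
  "square_integrable \<Omega> f \<longleftrightarrow>
     f \<in> borel_measurable (lebesgue_on \<Omega>) \<and> integrable (lebesgue_on \<Omega>) (\<lambda>x. (f x)\<^sup>2)"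

text \<open>Functions on an open set \<open>\<Omega>\<close> are total functions whose values outside \<open>\<Omega>\<close> are
  irrelevant. Multi-indices are represented by lists of coordinate directions; the order
  in the list does not matter, since partial derivatives of test functions commute.\<close>

definition weak_deriv ::
    "(real ^ 'n::finite) set \<Rightarrow> 'n list \<Rightarrow> (real ^ 'n \<Rightarrow> real) \<Rightarrow> (real ^ 'n \<Rightarrow> real) \<Rightarrow> bool" where
  "weak_deriv \<Omega> js f g \<longleftrightarrow>
     locally_integrable \<Omega> f \<and> locally_integrable \<Omega> g \<and>
     (\<forall>\<phi>. test_function \<Omega> \<phi> \<longrightarrow>
        (LINT x|lebesgue_on \<Omega>. f x * iter_partial js \<phi> x)
          = (- 1) ^ length js * (LINT x|lebesgue_on \<Omega>. g x * \<phi> x))"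

text \<open>The Sobolev space \<open>W\<^sup>k\<^sup>,\<^sup>2(\<Omega>)\<close>, as a set of representatives
  (no quotient by almost everywhere equality is taken).\<close>

definition sobolev2 :: "nat \<Rightarrow> (real ^ 'n::finite) set \<Rightarrow> (real ^ 'n \<Rightarrow> real) set" where
  "sobolev2 k \<Omega> =
     {f. square_integrable \<Omega> f \<and>
         (\<forall>js. length js \<le> k \<longrightarrow> (\<exists>g. weak_deriv \<Omega> js f g \<and> square_integrable \<Omega> g))}"

definition has_weak_hessian ::
    "(real ^ 'n::finite) set \<Rightarrow> (real ^ 'n \<Rightarrow> real) \<Rightarrow> (real ^ 'n \<Rightarrow> real ^ 'n ^ 'n) \<Rightarrow> bool" where
  "has_weak_hessian \<Omega> f H \<longleftrightarrow> (\<forall>i j. weak_deriv \<Omega> [i, j] f (\<lambda>x. H x $ i $ j))"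

text \<open>For open \<open>\<Omega>\<close> a weak Hessian is unique up to a null set, so the choice of
  representative below affects neither almost everywhere statements nor integrals over \<open>\<Omega>\<close>.\<close>

definition weak_hessian ::
    "(real ^ 'n::finite) set \<Rightarrow> (real ^ 'n \<Rightarrow> real) \<Rightarrow> real ^ 'n \<Rightarrow> real ^ 'n ^ 'n" where
  "weak_hessian \<Omega> f = (SOME H. has_weak_hessian \<Omega> f H)"

definition frob_sq :: "real ^ 'n::finite ^ 'm::finite \<Rightarrow> real" where
  "frob_sq A = (\<Sum>i\<in>UNIV. \<Sum>j\<in>UNIV. (A $ i $ j)\<^sup>2)"

abbreviation unit_disk :: "(real ^ 2) set" where
  "unit_disk \<equiv> ball 0 1"

text \<open>Elements of a Sobolev space are determined only up to null sets, so the radial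
  representation is required almost everywhere. It holds in particular when
  \<open>V x = v (norm x)\<close> at every point of the disk.\<close>

definition radially_symmetric :: "(real ^ 2 \<Rightarrow> real) \<Rightarrow> bool" where
  "radially_symmetric V \<longleftrightarrow> (\<exists>v. AE x in lebesgue_on unit_disk. V x = v (norm x))"

definition W_energy :: "(real ^ 2 \<Rightarrow> real) \<Rightarrow> (real ^ 2 \<Rightarrow> real) \<Rightarrow> ennreal" where
  "W_energy k V =
     (if AE x in lebesgue_on unit_disk. det (weak_hessian unit_disk V x) = k x
      then \<integral>\<^sup>+ x. ennreal (frob_sq (weak_hessian unit_disk V x)) \<partial>lebesgue_on unit_disk
      else \<infinity>)"

end

theory Submission
  imports Defs "HOL-Computational_Algebra.Polynomial"
begin

text \<open>
  For radial \<open>U\<close> the weak gradient is \<open>\<lambda> x\<close>, because its angular component vanishes.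
  Differentiating once more, the Hessian has the tangential eigenvalue \<open>\<lambda>\<close> and a radial
  eigenvalue \<open>\<mu>\<close>, and along almost every ray \<open>t \<mapsto> t x\<close> the function \<open>p t = t \<lambda>(t x)\<close> is
  absolutely continuous with derivative \<open>\<mu>(t x)\<close>. Hence \<open>(p\<^sup>2)' = 2 t \<lambda> \<mu> = 2 t det\<close>, so two radial
  functions with the same Hessian determinant have \<open>p\<^sup>2\<close> equal up to a constant \<open>C\<close> on each ray.
  Square integrability of the Hessian gives \<open>\<integral> p\<^sup>2 / t dt < \<infinity>\<close> on almost every ray, which forces
  \<open>C = 0\<close>. So the \<open>\<lambda>\<^sup>2\<close> agree, and with \<open>\<lambda> \<mu>\<close> also the \<open>\<mu>\<^sup>2\<close> where \<open>\<lambda> \<noteq> 0\<close>; where \<open>\<lambda> = 0\<close>, both \<open>\<mu>\<close>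
  vanish almost everywhere, as the derivative of an absolutely continuous function does on its
  zero set. The squared norm of the Hessian is \<open>\<lambda>\<^sup>2 + \<mu>\<^sup>2\<close>.

  Test functions of the form \<open>a(x\<^sub>1) b(x\<^sub>2)\<close> suffice throughout; their mixed derivatives commute
  by inspection.
\<close>

section \<open>Smooth test functions in product form\<close>

text \<open>The obstacle is that everything is known only up to null sets: the radial profile
  carries no regularity, the gradient is weak, and exceptional sets depend on the radius. Both
  symmetries are therefore moved onto smooth test functions. Rotating them turns the invariance of
  \<open>U\<close> into a vanishing weak angular derivative; dilating them and integrating over the
  dilation factor gives, for fixed radii, the increment of the gradient along almost every ray.
  Polar coordinates are replaced by Fubini for pairs (t, x) with x in the disk. Every ray is counted
  many times, but null sets still pass back and forth, because dilations preserve them. Along a ray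
  the first coordinate is a constant times t. So both eigenvalues are read off from first components
  divided by this coordinate, and the relation between them becomes one for functions of t alone.
  The constant C must vanish because a difference C / t^2 of the squared tangential eigenvalues,
  integrated against t dt, diverges logarithmically at 0. This uses square integrability of the
  Hessian up to the origin; the argument would fail on an annulus, where |x| and 0 both have Hessian
  determinant 0.\<close>

primrec differentiable_times :: "nat \<Rightarrow> (real \<Rightarrow> real) \<Rightarrow> bool" where
  "differentiable_times 0 a \<longleftrightarrow> True"
| "differentiable_times (Suc n) a \<longleftrightarrow>
     (\<forall>t. (a has_real_derivative deriv a t) (at t)) \<and> differentiable_times n (deriv a)"

text \<open>The total operator \<open>deriv\<close> is used so that iterated partial derivatives of
  a product a(x1) b(x2) are again such products, namely of iterates of \<open>deriv\<close>.\<close>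

definition smooth_real :: "(real \<Rightarrow> real) \<Rightarrow> bool" where
  "smooth_real a \<longleftrightarrow> (\<forall>n. differentiable_times n a)"

lemma differentiable_times_Suc_imp: "differentiable_times (Suc n) a \<Longrightarrow> differentiable_times n a"
  by (induction n arbitrary: a) auto

lemma differentiable_timesI:
  assumes "\<And>t. (a has_real_derivative a' t) (at t)" "differentiable_times n a'"
  shows "differentiable_times (Suc n) a"
proof -
  have "deriv a = a'"
    using assms(1) DERIV_imp_deriv by blast
  with assms show ?thesis by simp
qed

lemma differentiable_times_add:
  "differentiable_times n a \<Longrightarrow> differentiable_times n b \<Longrightarrow> differentiable_times n (\<lambda>t. a t + b t)"
proof (induction n arbitrary: a b)
  case (Suc n)
  show ?case
    by (rule differentiable_timesI[where a' = "\<lambda>t. deriv a t + deriv b t"])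
       (use Suc in \<open>auto intro!: derivative_intros\<close>)
qed auto

lemma differentiable_times_mult:
  "differentiable_times n a \<Longrightarrow> differentiable_times n b \<Longrightarrow> differentiable_times n (\<lambda>t. a t * b t)"
proof (induction n arbitrary: a b)
  case (Suc n)
  note D = Suc.prems[THEN differentiable_times_Suc_imp]
  show ?case
  proof (rule differentiable_timesI)
    show "((\<lambda>t. a t * b t) has_real_derivative deriv a t * b t + deriv b t * a t) (at t)" for t
      using Suc.prems by (auto intro!: DERIV_mult)
    show "differentiable_times n (\<lambda>t. deriv a t * b t + deriv b t * a t)"
      using Suc.prems D by (auto intro!: differentiable_times_add Suc.IH)
  qed
qed auto

lemma differentiable_times_const: "differentiable_times n (\<lambda>t. c)"
  by (induction n arbitrary: c) (auto intro!: differentiable_timesI[where a' = "\<lambda>_. 0"])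

lemma differentiable_times_affine:
  "differentiable_times n a \<Longrightarrow> differentiable_times n (\<lambda>t. a (c * t + d))"
proof (induction n arbitrary: a)
  case (Suc n)
  show ?case
  proof (rule differentiable_timesI)
    show "((\<lambda>t. a (c * t + d)) has_real_derivative deriv a (c * t + d) * c) (at t)" for t
      using Suc.prems by (auto intro!: DERIV_chain'[where g=a] derivative_eq_intros)
    show "differentiable_times n (\<lambda>t. deriv a (c * t + d) * c)"
      using Suc by (auto intro!: differentiable_times_mult differentiable_times_const)
  qed
qed auto

lemma smooth_real_DERIV: "smooth_real a \<Longrightarrow> (a has_real_derivative deriv a t) (at t)"
  unfolding smooth_real_def by (metis differentiable_times.simps(2))

lemma smooth_real_deriv: "smooth_real a \<Longrightarrow> smooth_real (deriv a)"
  unfolding smooth_real_def by (metis differentiable_times.simps(2))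

lemma smooth_real_deriv_iter: "smooth_real a \<Longrightarrow> smooth_real ((deriv ^^ n) a)"
  by (induction n) (auto intro: smooth_real_deriv)

lemma smooth_real_mult: "smooth_real a \<Longrightarrow> smooth_real b \<Longrightarrow> smooth_real (\<lambda>t. a t * b t)"
  unfolding smooth_real_def by (blast intro: differentiable_times_mult)

lemma smooth_real_affine: "smooth_real a \<Longrightarrow> smooth_real (\<lambda>t. a (c * t + d))"
  unfolding smooth_real_def by (blast intro: differentiable_times_affine)

lemma smooth_real_id: "smooth_real (\<lambda>t. t)"
  unfolding smooth_real_def
proof
  show "differentiable_times n (\<lambda>t. t)" for n
    by (cases n) (auto intro!: differentiable_timesI[where a' = "\<lambda>_. 1"] differentiable_times_const
        simp del: differentiable_times.simps(2))
qed

lemma smooth_real_isCont: "smooth_real a \<Longrightarrow> isCont a t"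
  using smooth_real_DERIV DERIV_isCont by blast

lemma smooth_real_continuous_on: "smooth_real a \<Longrightarrow> continuous_on S a"
  by (simp add: continuous_at_imp_continuous_on smooth_real_isCont)

lemma smooth_real_measurable: "smooth_real a \<Longrightarrow> a \<in> borel_measurable borel"
  by (simp add: borel_measurable_continuous_onI smooth_real_continuous_on)

section \<open>The flat exponential and its derivatives\<close>

text \<open>For P = 1 this is the classical smooth function that is flat at 0. The polynomial factor
  makes the family closed under differentiation, so smoothness follows by an induction over all P at
  once.\<close>

definition exp_tail :: "real poly \<Rightarrow> real \<Rightarrow> real" where
  "exp_tail P t = (if t > 0 then poly P (1 / t) * exp (- (1 / t)) else 0)"

lemma poly_exp_tendsto_0: "((\<lambda>s. poly P s * exp (- s)) \<longlongrightarrow> (0::real)) at_top"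
proof -
  have "((\<lambda>s. \<Sum>i\<le>degree P. coeff P i * (s ^ i / exp s)) \<longlongrightarrow> (\<Sum>i\<le>degree P. coeff P i * 0)) at_top"
    by (intro tendsto_intros tendsto_power_div_exp_0)
  moreover have "(\<lambda>s. \<Sum>i\<le>degree P. coeff P i * (s ^ i / exp s)) = (\<lambda>s. poly P s * exp (- s))"
    by (auto simp: poly_altdef sum_distrib_right exp_minus divide_inverse mult.assoc)
  ultimately show ?thesis by simp
qed

text \<open>With s = 1 / t one has d/dt = - s^2 d/ds, and d/ds (P(s) exp (- s)) = (P' - P)(s) exp (-
  s). This explains the polynomial (P - P') s^2.\<close>

lemma exp_tail_DERIV:
  "(exp_tail P has_real_derivative exp_tail ((P - pderiv P) * [:0, 0, 1:]) t) (at t)"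
proof -
  consider "t > 0" | "t < 0" | "t = 0" by linarith
  then show ?thesis
  proof cases
    case 1
    have "((\<lambda>t. poly P (1 / t) * exp (- (1 / t))) has_real_derivative
        exp_tail ((P - pderiv P) * [:0, 0, 1:]) t) (at t)"
      using 1
      by (auto intro!: derivative_eq_intros DERIV_chain'[where g="poly P"] poly_DERIV
          simp: exp_tail_def field_simps power2_eq_square)
    then show ?thesis
      by (rule has_field_derivative_transform_within_open[where S="{0<..}"])
         (use 1 in \<open>auto simp: exp_tail_def\<close>)
  next
    case 2
    have "((\<lambda>t. 0) has_real_derivative exp_tail ((P - pderiv P) * [:0, 0, 1:]) t) (at t)"
      using 2 by (auto simp: exp_tail_def)
    then show ?thesis
      by (rule has_field_derivative_transform_within_open[where S="{..<0}"])
         (use 2 in \<open>auto simp: exp_tail_def\<close>)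
  next
    case 3
    have "((\<lambda>h. exp_tail P h / h) \<longlongrightarrow> 0) (at_right 0)"
    proof -
      \<comment> \<open>The difference quotient at 0 divides by h, that is, it multiplies the
        polynomial by its own argument 1 / h.\<close>
      have "((\<lambda>h. poly (P * [:0,1:]) (inverse h) * exp (- inverse h)) \<longlongrightarrow> 0) (at_right 0)"
        by (rule filterlim_compose[OF poly_exp_tendsto_0 filterlim_inverse_at_top_right])
      then show ?thesis
        by (rule Lim_transform_eventually)
           (auto simp: exp_tail_def eventually_at_filter field_simps)
    qed
    moreover have "((\<lambda>h. exp_tail P h / h) \<longlongrightarrow> 0) (at_left 0)"
      by (rule Lim_transform_eventually[where f="\<lambda>_. 0"])
         (auto simp: exp_tail_def eventually_at_filter)
    ultimately have "((\<lambda>h. exp_tail P h / h) \<longlongrightarrow> 0) (at 0)"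
      by (simp add: filterlim_at_split)
    then show ?thesis
      using 3 by (simp add: DERIV_def exp_tail_def)
  qed
qed

lemma smooth_real_exp_tail: "smooth_real (exp_tail P)"
  unfolding smooth_real_def
proof
  show "differentiable_times n (exp_tail P)" for n
    by (induction n arbitrary: P) (auto intro!: differentiable_timesI exp_tail_DERIV
        simp del: differentiable_times.simps(2))
qed

section \<open>Product test functions on the disk\<close>

definition tensor :: "(real \<Rightarrow> real) \<Rightarrow> (real \<Rightarrow> real) \<Rightarrow> real ^ 2 \<Rightarrow> real" where
  "tensor a b x = a (x $ 1) * b (x $ 2)"

text \<open>Confining the support to a closed box, rather than to a general compact set, lets it be
  controlled by the two factors separately. The condition then survives differentiation,
  multiplication by a coordinate and contraction.\<close>

definition test_pair :: "(real \<Rightarrow> real) \<Rightarrow> (real \<Rightarrow> real) \<Rightarrow> bool" where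
  "test_pair a b \<longleftrightarrow> smooth_real a \<and> smooth_real b \<and>
     (\<exists>l u. cbox l u \<subseteq> unit_disk \<and> (\<forall>t. a t \<noteq> 0 \<longrightarrow> t \<in> {l $ 1..u $ 1})
        \<and> (\<forall>t. b t \<noteq> 0 \<longrightarrow> t \<in> {l $ 2..u $ 2}))"

lemma deriv_nonzero_in_support:
  fixes l u :: real
  assumes "\<And>t. a t \<noteq> 0 \<Longrightarrow> t \<in> {l..u}" "deriv a t \<noteq> 0"
  shows "t \<in> {l..u}"
proof (rule ccontr)
  assume t: "t \<notin> {l..u}"
  have "((\<lambda>_. 0) has_real_derivative 0) (at t)" by simp
  then have "(a has_real_derivative 0) (at t)"
    by (rule has_field_derivative_transform_within_open[where S="- {l..u}"])
       (use assms(1) t in fastforce)+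
  then show False
    using assms(2) DERIV_imp_deriv by blast
qed

lemma test_pair_smooth: "test_pair a b \<Longrightarrow> smooth_real a" "test_pair a b \<Longrightarrow> smooth_real b"
  by (auto simp: test_pair_def)

lemma test_pairE:
  assumes "test_pair a b"
  obtains l u where "cbox l u \<subseteq> unit_disk" "\<And>t. a t \<noteq> 0 \<Longrightarrow> t \<in> {l $ 1..u $ 1}"
    "\<And>t. b t \<noteq> 0 \<Longrightarrow> t \<in> {l $ 2..u $ 2}"
  using assms unfolding test_pair_def by blast

lemma test_pairI:
  assumes "smooth_real a" "smooth_real b" "cbox l u \<subseteq> unit_disk"
    "\<And>t. a t \<noteq> 0 \<Longrightarrow> t \<in> {l $ 1..u $ 1}" "\<And>t. b t \<noteq> 0 \<Longrightarrow> t \<in> {l $ 2..u $ 2}"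
  shows "test_pair a b"
  using assms unfolding test_pair_def by blast

lemma test_pair_deriv1:
  assumes "test_pair a b"
  shows "test_pair (deriv a) b"
proof -
  obtain l u where lu: "cbox l u \<subseteq> unit_disk" "\<And>t. a t \<noteq> 0 \<Longrightarrow> t \<in> {l $ 1..u $ 1}"
    "\<And>t. b t \<noteq> 0 \<Longrightarrow> t \<in> {l $ 2..u $ 2}"
    using assms by (elim test_pairE) blast
  show ?thesis
    by (rule test_pairI[OF _ _ lu(1) _ lu(3)])
       (use test_pair_smooth[OF assms] deriv_nonzero_in_support[OF lu(2)] in \<open>auto intro: smooth_real_deriv\<close>)
qed

lemma test_pair_deriv2:
  assumes "test_pair a b"
  shows "test_pair a (deriv b)"
proof -
  obtain l u where lu: "cbox l u \<subseteq> unit_disk" "\<And>t. a t \<noteq> 0 \<Longrightarrow> t \<in> {l $ 1..u $ 1}"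
    "\<And>t. b t \<noteq> 0 \<Longrightarrow> t \<in> {l $ 2..u $ 2}"
    using assms by (elim test_pairE) blast
  show ?thesis
    by (rule test_pairI[OF _ _ lu(1) lu(2)])
       (use test_pair_smooth[OF assms] deriv_nonzero_in_support[OF lu(3)] in \<open>auto intro: smooth_real_deriv\<close>)
qed

lemma test_pair_mult_id1:
  assumes "test_pair a b"
  shows "test_pair (\<lambda>t. t * a t) b"
proof -
  obtain l u where lu: "cbox l u \<subseteq> unit_disk" "\<And>t. a t \<noteq> 0 \<Longrightarrow> t \<in> {l $ 1..u $ 1}"
    "\<And>t. b t \<noteq> 0 \<Longrightarrow> t \<in> {l $ 2..u $ 2}"
    using assms by (elim test_pairE) blast
  show ?thesis
    by (rule test_pairI[OF smooth_real_mult[OF smooth_real_id] _ lu(1) lu(2) lu(3)])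
       (use test_pair_smooth[OF assms] in auto)
qed

lemma test_pair_mult_id2:
  assumes "test_pair a b"
  shows "test_pair a (\<lambda>t. t * b t)"
proof -
  obtain l u where lu: "cbox l u \<subseteq> unit_disk" "\<And>t. a t \<noteq> 0 \<Longrightarrow> t \<in> {l $ 1..u $ 1}"
    "\<And>t. b t \<noteq> 0 \<Longrightarrow> t \<in> {l $ 2..u $ 2}"
    using assms by (elim test_pairE) blast
  show ?thesis
    by (rule test_pairI[OF _ smooth_real_mult[OF smooth_real_id] lu(1) lu(2) lu(3)])
       (use test_pair_smooth[OF assms] in auto)
qed

text \<open>The disk is star-shaped about 0, so a contraction keeps the support inside; this is the
  reason for s \<le> 1.\<close>

lemma test_pair_scale:
  assumes "test_pair a b" "0 < s" "s \<le> 1"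
  shows "test_pair (\<lambda>t. a (t / s)) (\<lambda>t. b (t / s))"
proof -
  obtain l u where lu: "cbox l u \<subseteq> unit_disk" "\<forall>t. a t \<noteq> 0 \<longrightarrow> t \<in> {l $ 1..u $ 1}"
    "\<forall>t. b t \<noteq> 0 \<longrightarrow> t \<in> {l $ 2..u $ 2}"
    using assms(1) unfolding test_pair_def by auto
  have sub: "cbox (s *\<^sub>R l) (s *\<^sub>R u) \<subseteq> unit_disk"
  proof
    fix x :: "real^2" assume "x \<in> cbox (s *\<^sub>R l) (s *\<^sub>R u)"
    then have "(1/s) *\<^sub>R x \<in> cbox l u"
      using assms(2) by (auto simp: mem_box_cart field_simps)
    then have "norm ((1/s) *\<^sub>R x) < 1" using lu(1) by auto
    then have "norm x < s" using assms(2) by (simp add: field_simps)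
    then show "x \<in> unit_disk" using assms(3) by auto
  qed
  have "smooth_real (\<lambda>t. a (t / s))" "smooth_real (\<lambda>t. b (t / s))"
    using smooth_real_affine[of a "1/s" 0] smooth_real_affine[of b "1/s" 0] test_pair_smooth[OF assms(1)]
    by auto
  moreover have "t \<in> {(s *\<^sub>R l) $ 1..(s *\<^sub>R u) $ 1}" if "a (t / s) \<noteq> 0" for t
    using lu(2)[rule_format, OF that] assms(2) by (auto simp: field_simps)
  moreover have "t \<in> {(s *\<^sub>R l) $ 2..(s *\<^sub>R u) $ 2}" if "b (t / s) \<noteq> 0" for t
    using lu(3)[rule_format, OF that] assms(2) by (auto simp: field_simps)
  ultimately show ?thesis
    unfolding test_pair_def using sub by blast
qed

lemma tensor_has_derivative:
  assumes "smooth_real a" "smooth_real b"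
  shows "(tensor a b has_derivative
    (\<lambda>h. h $ 1 * tensor (deriv a) b x + h $ 2 * tensor a (deriv b) x)) (at x)"
proof -
  have 1: "((\<lambda>x. a (x $ i)) has_derivative (\<lambda>h. deriv a (x $ i) * (h $ i))) (at x)"
    if "smooth_real a" for a and i :: 2
  proof -
    have "(a has_derivative (*) (deriv a (x $ i))) (at (x $ i))"
      using smooth_real_DERIV[OF that] by (simp add: has_field_derivative_def)
    moreover have "((\<lambda>x. x $ i) has_derivative (\<lambda>h. h $ i)) (at x)"
      by (rule bounded_linear_imp_has_derivative) (rule bounded_linear_vec_nth)
    ultimately show ?thesis
      using has_derivative_compose[of "\<lambda>x. x $ i" "\<lambda>h. h $ i" x UNIV a] by simp
  qed
  show ?thesis
    unfolding tensor_def[abs_def]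
    by (rule has_derivative_eq_rhs[OF has_derivative_mult[OF 1[OF assms(1)] 1[OF assms(2)]]])
       (auto simp: tensor_def algebra_simps)
qed

lemma partial_deriv_tensor:
  assumes "smooth_real a" "smooth_real b"
  shows "partial_deriv 1 (tensor a b) = tensor (deriv a) b"
        "partial_deriv 2 (tensor a b) = tensor a (deriv b)"
  unfolding partial_deriv_def
  by (auto simp: frechet_derivative_at[OF tensor_has_derivative[OF assms], symmetric] axis_def)

lemma iter_partial_tensor:
  assumes "smooth_real a" "smooth_real b"
  shows "\<exists>m n. iter_partial js (tensor a b) = tensor ((deriv ^^ m) a) ((deriv ^^ n) b)"
proof (induction js)
  case Nil
  have "iter_partial [] (tensor a b) = tensor ((deriv ^^ 0) a) ((deriv ^^ 0) b)" by simp
  then show ?case by blast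
next
  case (Cons j js)
  then obtain m n where mn: "iter_partial js (tensor a b) = tensor ((deriv ^^ m) a) ((deriv ^^ n) b)"
    by blast
  note pd = partial_deriv_tensor[OF smooth_real_deriv_iter[OF assms(1)] smooth_real_deriv_iter[OF assms(2)]]
  from exhaust_2[of j] consider "j = 1" | "j = 2" by blast
  then show ?case
  proof cases
    case 1
    then have "iter_partial (j # js) (tensor a b) = tensor ((deriv ^^ Suc m) a) ((deriv ^^ n) b)"
      using mn pd by simp
    then show ?thesis by blast
  next
    case 2
    then have "iter_partial (j # js) (tensor a b) = tensor ((deriv ^^ m) a) ((deriv ^^ Suc n) b)"
      using mn pd by simp
    then show ?thesis by blast
  qed
qed

lemma test_function_tensor:
  assumes "test_pair a b"
  shows "test_function unit_disk (tensor a b)"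
proof -
  note sm = test_pair_smooth[OF assms]
  have "smooth (tensor a b)"
    unfolding smooth_def
  proof (intro allI)
    fix js x
    obtain m n where "iter_partial js (tensor a b) = tensor ((deriv ^^ m) a) ((deriv ^^ n) b)"
      using iter_partial_tensor[OF sm] by blast
    then show "iter_partial js (tensor a b) differentiable at x"
      using tensor_has_derivative[OF smooth_real_deriv_iter[OF sm(1)] smooth_real_deriv_iter[OF sm(2)],
          of m n x, THEN differentiableI]
      by simp
  qed
  moreover obtain l u where lu: "cbox l u \<subseteq> unit_disk" "\<forall>t. a t \<noteq> 0 \<longrightarrow> t \<in> {l $ 1..u $ 1}"
    "\<forall>t. b t \<noteq> 0 \<longrightarrow> t \<in> {l $ 2..u $ 2}"
    using assms(1) unfolding test_pair_def by auto
  have "{x. tensor a b x \<noteq> 0} \<subseteq> cbox l u"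
    using lu(2,3) by (auto simp: tensor_def mem_box_cart forall_2)
  then have "closure {x. tensor a b x \<noteq> 0} \<subseteq> cbox l u"
    by (simp add: closure_minimal closed_cbox)
  ultimately show ?thesis
    using lu(1) bounded_subset[OF bounded_cbox] unfolding test_function_def
    by (auto simp: compact_eq_bounded_closed)
qed

lemma tensor_measurable [measurable]:
  assumes "smooth_real a" "smooth_real b"
  shows "tensor a b \<in> borel_measurable borel"
proof -
  have "a \<in> borel_measurable borel" "b \<in> borel_measurable borel"
    using assms smooth_real_measurable by blast+
  then show ?thesis
    unfolding tensor_def[abs_def] by measurable
qed

lemma compactly_supported_bounded:
  fixes l u :: real
  assumes "smooth_real a" "\<And>t. a t \<noteq> 0 \<Longrightarrow> t \<in> {l..u}"
  shows "\<exists>C\<ge>0. \<forall>t. \<bar>a t\<bar> \<le> C"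
proof -
  have "bounded (a ` {l..u})"
    using assms(1) by (intro compact_imp_bounded compact_continuous_image smooth_real_continuous_on) auto
  then obtain C where C: "\<forall>y\<in>a ` {l..u}. \<bar>y\<bar> \<le> C" by (auto simp: bounded_iff)
  have "\<bar>a t\<bar> \<le> max C 0" for t
    using C assms(2)[of t] by (cases "a t = 0") force+
  then show ?thesis by (intro exI[of _ "max C 0"]) auto
qed

lemma tensor_bounded:
  assumes "test_pair a b"
  shows "\<exists>C. \<forall>x. \<bar>tensor a b x\<bar> \<le> C"
proof -
  obtain A B where "A \<ge> 0" "\<forall>t. \<bar>a t\<bar> \<le> A" "B \<ge> 0" "\<forall>t. \<bar>b t\<bar> \<le> B"
    using assms compactly_supported_bounded[of a] compactly_supported_bounded[of b]
    unfolding test_pair_def by metis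
  then have "\<bar>tensor a b x\<bar> \<le> A * B" for x
    unfolding tensor_def abs_mult by (intro mult_mono) auto
  then show ?thesis by blast
qed

lemma integrable_mult_tensor:
  assumes "integrable lborel f" "test_pair a b"
  shows "integrable lborel (\<lambda>x. f x * tensor a b x)"
proof -
  obtain C where C: "\<forall>x. \<bar>tensor a b x\<bar> \<le> C" using tensor_bounded[OF assms(2)] by blast
  note [measurable] = tensor_measurable[OF test_pair_smooth[OF assms(2)]]
  show ?thesis
  proof (rule Bochner_Integration.integrable_bound)
    show "integrable lborel (\<lambda>x. C * f x)" using assms(1) by simp
    show "(\<lambda>x. f x * tensor a b x) \<in> borel_measurable lborel" using assms(1) by measurable
    show "AE x in lborel. norm (f x * tensor a b x) \<le> norm (C * f x)"
    proof (rule AE_I2)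
      fix x
      have "\<bar>f x\<bar> * \<bar>tensor a b x\<bar> \<le> \<bar>f x\<bar> * \<bar>C\<bar>"
        using C by (intro mult_left_mono) (auto intro: order_trans[OF C[rule_format]])
      then show "norm (f x * tensor a b x) \<le> norm (C * f x)"
        by (simp add: abs_mult mult.commute)
    qed
  qed
qed

section \<open>Uniqueness of weak derivatives on the disk\<close>

text \<open>Since \<open>ennreal\<close> truncates negative values to 0, the two densities in the
  proof are the positive and the negative part of f. The measures they define agree on boxes, hence
  everywhere, so the two parts agree almost everywhere; as one of them is 0 at each point, both
  are.\<close>

lemma AE_zero_if_box_integrals_zero:
  fixes f :: "'a::euclidean_space \<Rightarrow> real"
  assumes f: "integrable lborel f"
    and zero: "\<And>a b. (\<integral>x. f x * indicator (box a b) x \<partial>lborel) = 0"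
  shows "AE x in lborel. f x = 0"
proof -
  note [measurable] = borel_measurable_integrable[OF f]
  have fin: "(\<integral>\<^sup>+x. ennreal (f x * indicator A x) \<partial>lborel) < \<infinity>"
    "(\<integral>\<^sup>+x. ennreal (- (f x * indicator A x)) \<partial>lborel) < \<infinity>" if [measurable]: "A \<in> sets borel" for A
    using integrable_real_mult_indicator[OF _ f, of A] that
    by (auto simp: real_integrable_def less_top)
  have "density lborel (\<lambda>x. ennreal (f x)) = density lborel (\<lambda>x. ennreal (- f x))"
  proof (rule measure_eqI_generator_eq)
    let ?E = "range (\<lambda>(a, b). box a b::'a set)"
    show "Int_stable ?E"
      by (auto simp: Int_stable_def box_Int_box)
    show "?E \<subseteq> Pow UNIV" "sets (density lborel (\<lambda>x. ennreal (f x))) = sigma_sets UNIV ?E"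
      "sets (density lborel (\<lambda>x. ennreal (- f x))) = sigma_sets UNIV ?E"
      by (simp_all add: borel_eq_box)
    let ?A = "\<lambda>n::nat. box (- (real n *\<^sub>R One)) (real n *\<^sub>R One) :: 'a set"
    show "range ?A \<subseteq> ?E" "(\<Union>i. ?A i) = UNIV"
      unfolding UN_box_eq_UNIV by auto
    have em: "emeasure (density lborel (\<lambda>x. ennreal (f x))) (box a b)
          = (\<integral>\<^sup>+x. ennreal (f x * indicator (box a b) x) \<partial>lborel)"
        "emeasure (density lborel (\<lambda>x. ennreal (- f x))) (box a b)
          = (\<integral>\<^sup>+x. ennreal (- (f x * indicator (box a b) x)) \<partial>lborel)" for a b
      by (auto simp: emeasure_density intro!: nn_integral_cong split: split_indicator)
    show "emeasure (density lborel (\<lambda>x. ennreal (f x))) (?A i) \<noteq> \<infinity>" for i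
      using em(1) fin(1)[of "?A i"] by auto
    show "emeasure (density lborel (\<lambda>x. ennreal (f x))) X = emeasure (density lborel (\<lambda>x. ennreal (- f x))) X"
      if "X \<in> ?E" for X
    proof -
      obtain a b where X: "X = box a b" using \<open>X \<in> ?E\<close> by fast
      have "enn2real (\<integral>\<^sup>+x. ennreal (f x * indicator (box a b) x) \<partial>lborel)
        = enn2real (\<integral>\<^sup>+x. ennreal (- (f x * indicator (box a b) x)) \<partial>lborel)"
        using zero[of a b] integrable_real_mult_indicator[OF _ f, of "box a b"]
        by (simp add: real_lebesgue_integral_def)
      then show ?thesis
        unfolding X em using fin[of "box a b"]
        by (simp add: less_top) (metis ennreal_enn2real)
    qed
  qed
  then have "AE x in lborel. ennreal (f x) = ennreal (- f x)"
    by (intro sigma_finite_measure.density_unique[OF sigma_finite_lborel]) auto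
  then show ?thesis
  proof eventually_elim
    case (elim x)
    then show ?case by (cases "f x \<ge> 0") (auto simp: ennreal_neg ennreal_eq_0_iff)
  qed
qed

text \<open>\<open>E (n s)\<close> is exp (- 1 / (n s)) for s > 0 and 0 otherwise, so it increases
  to a step function. A product of two such steps, one rising from p and one falling to q, tends to
  the indicator of the open interval.\<close>

lemma tensor_bump_limit:
  fixes l u :: "real ^ 2"
  assumes "cbox l u \<subseteq> unit_disk"
  obtains a b where "\<And>n. test_pair (a n) (b n)" "\<And>n x. \<bar>tensor (a n) (b n) x\<bar> \<le> 1"
    "\<And>n x. tensor (a n) (b n) x \<noteq> 0 \<Longrightarrow> x \<in> cbox l u"
    "\<And>x. (\<lambda>n. tensor (a n) (b n) x) \<longlonglongrightarrow> indicator (box l u) x"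
proof
  define E where "E = exp_tail [:1:]"
  have E: "smooth_real E" unfolding E_def by (rule smooth_real_exp_tail)
  have E0: "E t = 0" if "t \<le> 0" for t using that by (simp add: E_def exp_tail_def)
  have E1: "0 \<le> E t" "E t \<le> 1" for t by (auto simp: E_def exp_tail_def)
  define B where "B = (\<lambda>(p::real) q n t. E (real (Suc n) * (t - p)) * E (real (Suc n) * (q - t)))"
  have smooth: "smooth_real (B p q n)" for p q n
    using smooth_real_mult[OF smooth_real_affine[OF E, of "real (Suc n)" "- real (Suc n) * p"]
        smooth_real_affine[OF E, of "- real (Suc n)" "real (Suc n) * q"]]
    by (simp add: B_def algebra_simps)
  have B01: "0 \<le> B p q n t" "B p q n t \<le> 1" for p q n t
    using E1 mult_mono[OF E1(2) E1(2)] by (auto simp: B_def)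
  have Bsupp: "B p q n t = 0" if "t \<le> p \<or> q \<le> t" for p q n t
    using that E0 by (auto simp: B_def mult_nonneg_nonpos)
  have Elim: "(\<lambda>n. E (real (Suc n) * s)) \<longlonglongrightarrow> 1" if "s > 0" for s
  proof -
    have "(\<lambda>n. exp (- (inverse s * inverse (real (Suc n))))) \<longlonglongrightarrow> exp (- (inverse s * 0))"
      by (intro tendsto_intros LIMSEQ_inverse_real_of_nat)
    moreover have "E (real (Suc n) * s) = exp (- (inverse s * inverse (real (Suc n))))" for n
      using that by (simp add: E_def exp_tail_def divide_inverse del: of_nat_Suc)
    ultimately show ?thesis by simp
  qed
  have Blim: "(\<lambda>n. B p q n t) \<longlonglongrightarrow> (if p < t \<and> t < q then 1 else 0)" for p q t
  proof (cases "p < t \<and> t < q")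
    case True
    then show ?thesis
      using tendsto_mult[OF Elim[of "t - p"] Elim[of "q - t"]] by (simp add: B_def)
  next
    case False
    then show ?thesis using Bsupp[of t p q] by (auto simp: not_less)
  qed
  have supp: "t \<in> {l $ i..u $ i}" if "B (l $ i) (u $ i) n t \<noteq> 0" for t i n
    using that Bsupp[of t "l $ i" "u $ i" n] by (metis atLeastAtMost_iff linear)
  show "x \<in> cbox l u" if "tensor (B (l $ 1) (u $ 1) n) (B (l $ 2) (u $ 2) n) x \<noteq> 0" for n x
    using that supp[of 1 n] supp[of 2 n] by (simp add: tensor_def mem_box_cart forall_2)
  show "test_pair (B (l $ 1) (u $ 1) n) (B (l $ 2) (u $ 2) n)" for n
    by (rule test_pairI[OF smooth smooth assms supp supp])
  show "\<bar>tensor (B (l $ 1) (u $ 1) n) (B (l $ 2) (u $ 2) n) x\<bar> \<le> 1" for n x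
    unfolding tensor_def abs_mult using B01 by (intro mult_le_one) auto
  show "(\<lambda>n. tensor (B (l $ 1) (u $ 1) n) (B (l $ 2) (u $ 2) n) x) \<longlonglongrightarrow> indicator (box l u) x" for x
    using tendsto_mult[OF Blim[of "l $ 1" "u $ 1" "x $ 1"] Blim[of "l $ 2" "u $ 2" "x $ 2"]]
    by (auto simp: tensor_def mem_box_cart forall_2 indicator_def split: if_splits)
qed

text \<open>The fundamental lemma of the calculus of variations on one box. Only test functions
  supported in that box are used, so that it also applies to functions truncated to the box.\<close>

lemma AE_box_zero_if_tensor_integrals_zero:
  assumes f: "integrable lborel f" and LU: "cbox L U \<subseteq> unit_disk"
    and zero: "\<And>a b. test_pair a b \<Longrightarrow> (\<And>x. tensor a b x \<noteq> 0 \<Longrightarrow> x \<in> cbox L U)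
      \<Longrightarrow> (\<integral>x. f x * tensor a b x \<partial>lborel) = 0"
  shows "AE x in lborel. x \<in> box L U \<longrightarrow> f x = 0"
proof -
  note [measurable] = borel_measurable_integrable[OF f]
  have box0: "(\<integral>x. f x * indicator (box l u) x \<partial>lborel) = 0" if lu: "cbox l u \<subseteq> cbox L U" for l u
  proof -
    have "cbox l u \<subseteq> unit_disk" using lu LU by blast
    then obtain a b where ab: "\<And>n. test_pair (a n) (b n)" "\<And>n x. \<bar>tensor (a n) (b n) x\<bar> \<le> 1"
      "\<And>n x. tensor (a n) (b n) x \<noteq> 0 \<Longrightarrow> x \<in> cbox l u"
      "\<And>x. (\<lambda>n. tensor (a n) (b n) x) \<longlonglongrightarrow> indicator (box l u) x"
      using tensor_bump_limit by blast
    have "(\<lambda>n. \<integral>x. f x * tensor (a n) (b n) x \<partial>lborel) \<longlonglongrightarrow> (\<integral>x. f x * indicator (box l u) x \<partial>lborel)"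
    proof (rule integral_dominated_convergence)
      show "integrable lborel (\<lambda>x. \<bar>f x\<bar>)" using f by simp
      show "(\<lambda>x. f x * tensor (a n) (b n) x) \<in> borel_measurable lborel" for n
        using integrable_mult_tensor[OF f ab(1)] by blast
      show "AE x in lborel. norm (f x * tensor (a n) (b n) x) \<le> \<bar>f x\<bar>" for n
        using ab(2) by (auto simp: abs_mult intro!: mult_left_le)
      show "AE x in lborel. (\<lambda>n. f x * tensor (a n) (b n) x) \<longlonglongrightarrow> f x * indicator (box l u) x"
        using ab(4) by (auto intro!: tendsto_mult_left)
    qed measurable
    moreover have "(\<integral>x. f x * tensor (a n) (b n) x \<partial>lborel) = 0" for n
      using zero[OF ab(1)] ab(3) lu by blast
    ultimately show ?thesis
      by (simp add: LIMSEQ_const_iff)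
  qed
  have "AE x in lborel. f x * indicator (box L U) x = 0"
  proof (rule AE_zero_if_box_integrals_zero)
    show "integrable lborel (\<lambda>x. f x * indicator (box L U) x)"
      using f by (intro integrable_real_mult_indicator) auto
    fix a b :: "real ^ 2"
    obtain c d where cd: "box L U \<inter> box a b = box c d"
      unfolding box_Int_box by blast
    have "(\<integral>x. f x * indicator (box c d) x \<partial>lborel) = 0"
    proof (cases "box c d = {}")
      \<comment> \<open>Only for a nonempty open box is the closed box its closure; the closed box
        of an empty one may stick out of \<open>cbox L U\<close>.\<close>
      case False
      then have "cbox c d = closure (box c d)" by simp
      also have "\<dots> \<subseteq> cbox L U"
        using cd box_subset_cbox[of L U] by (intro closure_minimal) (auto simp: closed_cbox)
      finally show ?thesis using box0 by blast
    qed simp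
    then show "(\<integral>x. f x * indicator (box L U) x * indicator (box a b) x \<partial>lborel) = 0"
      unfolding cd[symmetric] by (simp add: indicator_inter_arith mult.assoc)
  qed
  then show ?thesis by eventually_elim auto
qed

lemma AE_disk_if_AE_balls:
  assumes "\<And>n. AE x in lborel. x \<in> ball 0 (1 - 1 / real (Suc n)) \<longrightarrow> P x"
  shows "AE x in lborel. x \<in> unit_disk \<longrightarrow> P x"
proof -
  have "AE x in lborel. \<forall>n. x \<in> ball 0 (1 - 1 / real (Suc n)) \<longrightarrow> P x"
    using assms by (subst AE_all_countable) blast
  then show ?thesis
  proof eventually_elim
    case (elim x)
    show ?case
    proof
      assume "x \<in> unit_disk"
      then obtain n where "inverse (real (Suc n)) < 1 - norm x"
        using reals_Archimedean[of "1 - norm x"] by auto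
      then have "x \<in> ball 0 (1 - 1 / real (Suc n))" by (simp add: divide_inverse del: of_nat_Suc)
      then show "P x" using elim by blast
    qed
  qed
qed

text \<open>Open boxes covering the disk may touch its boundary circle. Covering smaller balls
  instead keeps the closed boxes inside the disk.\<close>

lemma AE_disk_if_AE_boxes:
  assumes "\<And>l u. cbox l u \<subseteq> unit_disk \<Longrightarrow> AE x in lborel. x \<in> box l u \<longrightarrow> P x"
  shows "AE x in lborel. x \<in> unit_disk \<longrightarrow> P x"
proof (rule AE_disk_if_AE_balls)
  fix n
  obtain D where D: "countable D" "D \<subseteq> Pow (ball 0 (1 - 1 / real (Suc n)) :: (real^2) set)"
    "\<And>X. X \<in> D \<Longrightarrow> \<exists>a b. X = box a b" "\<Union>D = ball 0 (1 - 1 / real (Suc n))"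
    by (rule open_countable_Union_open_box[OF open_ball]) blast
  have "AE x in lborel. x \<in> X \<longrightarrow> P x" if X: "X \<in> D" for X
  proof -
    obtain a b where ab: "X = box a b" using D(3)[OF X] by blast
    show ?thesis
    proof (cases "X = {}")
      case False
      then have "cbox a b = closure X" using ab by simp
      also have "\<dots> \<subseteq> cball 0 (1 - 1 / real (Suc n))"
        using X D(2) ball_subset_cball by (intro closure_minimal) blast+
      also have "\<dots> \<subseteq> unit_disk"
      proof
        fix x :: "real ^ 2"
        assume "x \<in> cball 0 (1 - 1 / real (Suc n))"
        moreover have "0 < 1 / real (Suc n)" by simp
        ultimately show "x \<in> unit_disk" unfolding mem_cball mem_ball by linarith
      qed
      finally show ?thesis using assms ab by blast
    qed simp
  qed
  then have "AE x in lborel. \<forall>X\<in>D. x \<in> X \<longrightarrow> P x"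
    using AE_ball_countable[OF D(1), of "\<lambda>x X. x \<in> X \<longrightarrow> P x" lborel] by blast
  then show "AE x in lborel. x \<in> ball 0 (1 - 1 / real (Suc n)) \<longrightarrow> P x"
    unfolding D(4)[symmetric] by eventually_elim blast
qed

lemma AE_zero_if_tensor_integrals_zero:
  assumes "integrable lborel f"
    and "\<And>a b. test_pair a b \<Longrightarrow> (\<integral>x. f x * tensor a b x \<partial>lborel) = 0"
  shows "AE x in lborel. x \<in> unit_disk \<longrightarrow> f x = 0"
  using assms by (intro AE_disk_if_AE_boxes AE_box_zero_if_tensor_integrals_zero) auto

lemma integrable_lebesgue_borel_representative:
  fixes f :: "'a::euclidean_space \<Rightarrow> real"
  assumes "integrable lebesgue f"
  obtains f' where "integrable lborel f'" "AE x in lborel. f x = f' x"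
proof -
  obtain f' where f': "f' \<in> borel_measurable lborel" "AE x in lborel. f x = f' x"
    using completion_ex_borel_measurable_real borel_measurable_integrable[OF assms] by blast
  have "integrable lebesgue f'"
  proof (rule integrable_cong_AE_imp[OF assms])
    show "f' \<in> borel_measurable lebesgue" using f'(1) by (rule measurable_completion)
    show "AE x in lebesgue. f x = f' x" using AE_completion[OF f'(2)] by eventually_elim simp
  qed
  then have "integrable lborel f'" using integrable_completion[OF f'(1)] by simp
  then show ?thesis using f'(2) that by blast
qed

text \<open>Meant for the Hessian selected by \<open>weak_hessian\<close>, which is at first known
  to be only locally integrable and need not be Borel. Each box is treated by truncation and a Borel
  representative.\<close>

lemma AE_disk_zero_if_locally_integrable:
  assumes f: "\<And>l u. cbox l u \<subseteq> unit_disk \<Longrightarrow> integrable lebesgue (\<lambda>x. f x * indicator (cbox l u) x)"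
    and zero: "\<And>a b l u. test_pair a b \<Longrightarrow> cbox l u \<subseteq> unit_disk
      \<Longrightarrow> (\<And>x. tensor a b x \<noteq> 0 \<Longrightarrow> x \<in> cbox l u)
      \<Longrightarrow> (\<integral>x. f x * indicator (cbox l u) x * tensor a b x \<partial>lebesgue) = 0"
  shows "AE x in lborel. x \<in> unit_disk \<longrightarrow> f x = (0::real)"
proof (rule AE_disk_if_AE_boxes)
  fix l u :: "real ^ 2"
  assume lu: "cbox l u \<subseteq> unit_disk"
  obtain f' where f': "integrable lborel f'" "AE x in lborel. f x * indicator (cbox l u) x = f' x"
    using integrable_lebesgue_borel_representative[OF f[OF lu]] by blast
  have "AE x in lborel. x \<in> box l u \<longrightarrow> f' x = 0"
  proof (rule AE_box_zero_if_tensor_integrals_zero[OF f'(1) lu])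
    fix a b assume ab: "test_pair a b" "\<And>x. tensor a b x \<noteq> 0 \<Longrightarrow> x \<in> cbox l u"
    have m: "tensor a b \<in> borel_measurable lborel"
      using tensor_measurable[OF test_pair_smooth[OF ab(1)]] by simp
    have "(\<integral>x. f' x * tensor a b x \<partial>lborel) = (\<integral>x. f' x * tensor a b x \<partial>lebesgue)"
      using f'(1) m by (intro integral_completion[symmetric]) auto
    also have "\<dots> = (\<integral>x. f x * indicator (cbox l u) x * tensor a b x \<partial>lebesgue)"
    proof (rule integral_cong_AE)
      show "(\<lambda>x. f' x * tensor a b x) \<in> borel_measurable lebesgue"
        using f'(1) m by (intro measurable_completion) auto
      show "(\<lambda>x. f x * indicator (cbox l u) x * tensor a b x) \<in> borel_measurable lebesgue"
        using borel_measurable_integrable[OF f[OF lu]] measurable_completion[OF m]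
        by (rule borel_measurable_times)
      show "AE x in lebesgue. f' x * tensor a b x = f x * indicator (cbox l u) x * tensor a b x"
        using AE_completion[OF f'(2)] by eventually_elim simp
    qed
    also have "\<dots> = 0" using ab lu by (intro zero)
    finally show "(\<integral>x. f' x * tensor a b x \<partial>lborel) = 0" .
  qed
  with f'(2) show "AE x in lborel. x \<in> box l u \<longrightarrow> f x = 0"
    by eventually_elim (use box_subset_cbox in \<open>force split: split_indicator_asm\<close>)
qed

section \<open>Rotations\<close>

text \<open>It is enough to compare the measures on boxes. The preimage of a box is its image under
  the inverse map, which is orthogonal as well and therefore preserves measure.\<close>

lemma distr_lborel_orthogonal:
  fixes f :: "real ^ 'n::{finite,wellorder} \<Rightarrow> real ^ 'n::_"
  assumes f: "orthogonal_transformation f"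
  shows "distr lborel borel f = lborel"
proof (rule lborel_eqI[symmetric])
  have "linear f" using f orthogonal_transformation_linear by blast
  then have [measurable]: "f \<in> borel_measurable borel"
    by (simp add: borel_measurable_continuous_onI linear_continuous_on linear_linear)
  fix l u :: "real ^ 'n::_"
  assume lu: "\<And>b. b \<in> Basis \<Longrightarrow> l \<bullet> b \<le> u \<bullet> b"
  have inv: "orthogonal_transformation (inv f)"
    using f by (rule orthogonal_transformation_inv)
  have vim: "f -` box l u = inv f ` box l u"
    using orthogonal_transformation_bij[OF f] by (rule bij_vimage_eq_inv_image)
  have m: "inv f ` box l u \<in> lmeasurable"
    by (rule measurable_orthogonal_image[OF inv]) simp
  have "emeasure (distr lborel borel f) (box l u) = emeasure lborel (f -` box l u)"
    by (simp add: emeasure_distr)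
  also have "\<dots> = emeasure lebesgue (f -` box l u)"
    using measurable_sets[of f borel borel "box l u"] by simp
  also have "\<dots> = ennreal (measure lebesgue (inv f ` box l u))"
    unfolding vim using m by (simp add: emeasure_eq_measure2)
  also have "measure lebesgue (inv f ` box l u) = measure lebesgue (box l u)"
    by (rule measure_orthogonal_image[OF inv]) simp
  also have "ennreal \<dots> = (\<Prod>b\<in>Basis. (u - l) \<bullet> b)"
    using lu by (simp add: measure_lborel_box_eq inner_diff_left)
  finally show "emeasure (distr lborel borel f) (box l u) = (\<Prod>b\<in>Basis. (u - l) \<bullet> b)" .
qed simp

lemma borel_measurable_vec_nth [measurable (raw)]:
  fixes f :: "'a \<Rightarrow> real ^ 'n"
  assumes "f \<in> borel_measurable M"
  shows "(\<lambda>x. f x $ i) \<in> borel_measurable M"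
  using assms by (rule measurable_compose)
    (intro borel_measurable_continuous_onI continuous_on_component continuous_on_id)

definition rotation :: "real \<Rightarrow> real ^ 2 \<Rightarrow> real ^ 2" where
  "rotation s x = (\<chi> i. if i = 1 then cos s * x $ 1 - sin s * x $ 2 else sin s * x $ 1 + cos s * x $ 2)"

lemma rotation_nth [simp]:
  "rotation s x $ 1 = cos s * x $ 1 - sin s * x $ 2"
  "rotation s x $ 2 = sin s * x $ 1 + cos s * x $ 2"
  by (simp_all add: rotation_def)

lemma norm_rotation [simp]: "norm (rotation s x) = norm x"
proof -
  have "(cos s * x $ 1 - sin s * x $ 2)\<^sup>2 + (sin s * x $ 1 + cos s * x $ 2)\<^sup>2
      = ((sin s)\<^sup>2 + (cos s)\<^sup>2) * ((x $ 1)\<^sup>2 + (x $ 2)\<^sup>2)" by algebra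
  then show ?thesis by (simp add: norm_vec_def L2_set_def sum_2)
qed

lemma orthogonal_transformation_rotation: "orthogonal_transformation (rotation s)"
  unfolding orthogonal_transformation
  by (auto intro!: linearI simp: vec_eq_iff forall_2 algebra_simps)

lemma rotation_measurable [measurable]: "rotation s \<in> borel_measurable borel"
  by (rule borel_measurable_continuous_onI)
     (simp add: linear_continuous_on linear_linear orthogonal_transformation_linear orthogonal_transformation_rotation)

text \<open>The derivative \<open>x\<^sub>1 \<partial>\<^sub>2 - x\<^sub>2 \<partial>\<^sub>1\<close> of \<open>a(x\<^sub>1) b(x\<^sub>2)\<close> in the polar angle.\<close>

definition angular_deriv :: "(real \<Rightarrow> real) \<Rightarrow> (real \<Rightarrow> real) \<Rightarrow> real ^ 2 \<Rightarrow> real" where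
  "angular_deriv a b x = tensor (\<lambda>t. t * a t) (deriv b) x - tensor (deriv a) (\<lambda>t. t * b t) x"

lemma tensor_rotation_DERIV:
  assumes "smooth_real a" "smooth_real b"
  shows "((\<lambda>s. tensor a b (rotation s x)) has_real_derivative angular_deriv a b (rotation s x)) (at s)"
  unfolding tensor_def rotation_nth angular_deriv_def
  by (auto intro!: derivative_eq_intros DERIV_chain'[where g=a] DERIV_chain'[where g=b]
        smooth_real_DERIV[OF assms(1)] smooth_real_DERIV[OF assms(2)] simp: algebra_simps)

text \<open>Rotating a test function by one radian does not change its integral against U. The
  change is also the integral over s in [0, 1] of U against the angular derivative rotated by s, and
  by invariance each of these integrals equals the unrotated one. As the interval has length 1, that
  integral itself is 0.\<close>

lemma angular_deriv_weakly_zero: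
  assumes U: "integrable lborel U"
    and inv: "\<And>s. AE x in lborel. U (rotation s x) = U x"
    and ab: "test_pair a b"
  shows "(\<integral>x. U x * angular_deriv a b x \<partial>lborel) = 0"
proof -
  note sm = test_pair_smooth[OF ab]
  note [measurable] = borel_measurable_integrable[OF U]
  have [measurable]: "a \<in> borel_measurable borel" "b \<in> borel_measurable borel"
    "deriv a \<in> borel_measurable borel" "deriv b \<in> borel_measurable borel"
    using sm smooth_real_deriv smooth_real_measurable by blast+
  have tp: "test_pair (\<lambda>t. t * a t) (deriv b)" "test_pair (deriv a) (\<lambda>t. t * b t)"
    using ab by (auto intro: test_pair_mult_id1 test_pair_mult_id2 test_pair_deriv1 test_pair_deriv2)
  obtain C1 C2 where C: "\<And>x. \<bar>tensor (\<lambda>t. t * a t) (deriv b) x\<bar> \<le> C1"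
      "\<And>x. \<bar>tensor (deriv a) (\<lambda>t. t * b t) x\<bar> \<le> C2"
    using tensor_bounded[OF tp(1)] tensor_bounded[OF tp(2)] by blast
  have bd: "\<bar>angular_deriv a b x\<bar> \<le> C1 + C2" for x
    unfolding angular_deriv_def using C(1)[of x] C(2)[of x] by linarith
  then have C0: "0 \<le> C1 + C2" by (meson abs_ge_zero order_trans)
  have [measurable]: "angular_deriv a b \<in> borel_measurable borel"
    unfolding angular_deriv_def[abs_def] tensor_def by measurable
  have [measurable]: "(\<lambda>p. angular_deriv a b (rotation (snd p) (fst p))) \<in> borel_measurable (lborel \<Otimes>\<^sub>M lborel)"
    unfolding angular_deriv_def tensor_def rotation_nth by measurable
  have invariant: "(\<integral>x. U x * \<phi> (rotation s x) \<partial>lborel) = (\<integral>x. U x * \<phi> x \<partial>lborel)"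
    if [measurable]: "\<phi> \<in> borel_measurable borel" for \<phi> :: "real ^ 2 \<Rightarrow> real" and s
  proof -
    have "(\<integral>x. U x * \<phi> (rotation s x) \<partial>lborel) = (\<integral>x. U (rotation s x) * \<phi> (rotation s x) \<partial>lborel)"
      using inv[of s] by (intro integral_cong_AE) auto
    also have "\<dots> = (\<integral>x. U x * \<phi> x \<partial>distr lborel borel (rotation s))"
      by (subst integral_distr) auto
    finally show ?thesis by (simp add: distr_lborel_orthogonal orthogonal_transformation_rotation)
  qed
  define F where "F = (\<lambda>(x, s). U x * angular_deriv a b (rotation s x) * indicator {0..1} s)"
  have Fm: "F \<in> borel_measurable (lborel \<Otimes>\<^sub>M lborel)"
    unfolding F_def case_prod_unfold by measurable
  have F: "integrable (lborel \<Otimes>\<^sub>M lborel) F"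
  proof (rule Bochner_Integration.integrable_bound[OF _ Fm])
    have "integrable (lborel \<Otimes>\<^sub>M lborel) (\<lambda>(x, s). U x * indicator {0..1::real} s)"
      by (rule lborel_pair.Fubini_integrable) (use U in \<open>auto simp: abs_mult\<close>)
    then show "integrable (lborel \<Otimes>\<^sub>M lborel) (\<lambda>z. (C1 + C2) * (case z of (x, s) \<Rightarrow> U x * indicator {0..1::real} s))"
      by simp
    show "AE z in lborel \<Otimes>\<^sub>M lborel. norm (F z)
        \<le> norm ((C1 + C2) * (case z of (x, s) \<Rightarrow> U x * indicator {0..1} s))"
    proof (rule AE_I2, clarify)
      fix x s
      have "\<bar>U x\<bar> * \<bar>angular_deriv a b (rotation s x)\<bar> \<le> \<bar>U x\<bar> * (C1 + C2)"
        using bd by (intro mult_left_mono) auto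
      then show "norm (F (x, s)) \<le> norm ((C1 + C2) * (U x * indicator {0..1} s))"
        using C0 by (auto simp: F_def abs_mult mult.commute split: split_indicator)
    qed
  qed
  have FTC: "(\<integral>s. F (x, s) \<partial>lborel) = U x * tensor a b (rotation 1 x) - U x * tensor a b x" for x
  proof -
    have "(\<integral>s. indicator {0..1} s *\<^sub>R angular_deriv a b (rotation s x) \<partial>lborel)
        = tensor a b (rotation 1 x) - tensor a b (rotation 0 x)"
    proof (rule integral_FTC_Icc)
      show "((\<lambda>s. tensor a b (rotation s x)) has_vector_derivative angular_deriv a b (rotation s x)) (at s within {0..1})" for s
        unfolding has_real_derivative_iff_has_vector_derivative[symmetric]
        using tensor_rotation_DERIV[OF sm] by (rule DERIV_subset) simp
      have c: "continuous_on UNIV c" if "smooth_real c" for c using smooth_real_continuous_on[OF that] .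
      show "continuous_on {0..1} (\<lambda>s. angular_deriv a b (rotation s x))"
        unfolding angular_deriv_def tensor_def rotation_nth
        by (intro continuous_intros continuous_on_compose2[OF c[OF sm(1)]] continuous_on_compose2[OF c[OF sm(2)]]
           continuous_on_compose2[OF c[OF smooth_real_deriv[OF sm(1)]]]
           continuous_on_compose2[OF c[OF smooth_real_deriv[OF sm(2)]]]) auto
    qed simp
    moreover have "rotation 0 x = x" by (simp add: vec_eq_iff forall_2)
    moreover have "(\<integral>s. F (x, s) \<partial>lborel) = U x * (\<integral>s. indicator {0..1} s *\<^sub>R angular_deriv a b (rotation s x) \<partial>lborel)"
      by (subst integral_mult_right_zero[symmetric]) (simp add: F_def ac_simps)
    ultimately show ?thesis by (simp add: right_diff_distrib)
  qed
  have inner: "(\<integral>x. F (x, s) \<partial>lborel) = indicator {0..1} s * (\<integral>x. U x * angular_deriv a b x \<partial>lborel)" for s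
    unfolding F_def by (simp add: invariant mult.commute)
  have "(\<integral>x. U x * angular_deriv a b x \<partial>lborel)
      = (\<integral>s. indicator {0..1::real} s * (\<integral>x. U x * angular_deriv a b x \<partial>lborel) \<partial>lborel)"
    by simp
  also have "\<dots> = (\<integral>s. (\<integral>x. F (x, s) \<partial>lborel) \<partial>lborel)" by (simp add: inner)
  also have "\<dots> = (\<integral>x. (\<integral>s. F (x, s) \<partial>lborel) \<partial>lborel)"
    using lborel_pair.Fubini_integral[of "\<lambda>x s. F (x, s)"] F by simp
  also have "\<dots> = (\<integral>x. U x * tensor a b (rotation 1 x) \<partial>lborel) - (\<integral>x. U x * tensor a b x \<partial>lborel)"
  proof -
    have t [measurable]: "tensor a b \<in> borel_measurable borel" using sm by (rule tensor_measurable)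
    \<comment> \<open>A rotated tensor is in general no longer a tensor, so
      \<open>integrable_mult_tensor\<close> does not apply to it. Its integrability is read off from
      the identity \<open>FTC\<close>, whose left-hand side is integrable by Fubini.\<close>
    have "integrable lborel (\<lambda>x. (\<integral>s. F (x, s) \<partial>lborel) + U x * tensor a b x)"
      using lborel_pair.integrable_fst'[OF F] integrable_mult_tensor[OF U ab]
      by (intro Bochner_Integration.integrable_add) auto
    then have "integrable lborel (\<lambda>x. U x * tensor a b (rotation 1 x))"
      by (simp add: FTC)
    then show ?thesis
      using integrable_mult_tensor[OF U ab] by (simp add: FTC)
  qed
  also have "\<dots> = 0"
    using invariant[OF tensor_measurable[OF sm]] by simp
  finally show ?thesis .
qed

section \<open>Dilations\<close>

lemma AE_lborel_scale:
  fixes P :: "'a::euclidean_space \<Rightarrow> bool"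
  assumes "AE x in lborel. P x" "c \<noteq> 0"
  shows "AE x in lborel. P (c *\<^sub>R x)"
proof -
  have "AE x in density (distr lborel borel (\<lambda>x. 0 + c *\<^sub>R x)) (\<lambda>_. \<bar>c\<bar> ^ DIM('a)). P x"
    using assms(1) by (subst lborel_affine[OF assms(2), of "0 :: 'a", symmetric])
  then have "AE x in distr lborel borel (\<lambda>x :: 'a. 0 + c *\<^sub>R x). 0 < ennreal (\<bar>c\<bar> ^ DIM('a)) \<longrightarrow> P x"
    by (subst (asm) AE_density) auto
  then have "AE x in distr lborel borel (\<lambda>x :: 'a. 0 + c *\<^sub>R x). P x"
    using assms(2) by simp
  then show ?thesis
    using AE_distrD[of "\<lambda>x. 0 + c *\<^sub>R x" lborel borel P] by simp
qed

lemma nn_integral_lborel_scale: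
  fixes f :: "'a::euclidean_space \<Rightarrow> ennreal"
  assumes [measurable]: "f \<in> borel_measurable borel" and c: "c \<noteq> 0"
  shows "(\<integral>\<^sup>+x. f x \<partial>lborel) = ennreal (\<bar>c\<bar> ^ DIM('a)) * (\<integral>\<^sup>+x. f (c *\<^sub>R x) \<partial>lborel)"
  by (subst lborel_affine[OF c, of 0])
     (simp add: nn_integral_density nn_integral_distr nn_integral_cmult)

lemma integrable_lborel_scale:
  fixes f :: "'a::euclidean_space \<Rightarrow> real"
  assumes f: "integrable lborel f" and c: "c \<noteq> 0"
  shows "integrable lborel (\<lambda>x. f (c *\<^sub>R x))"
proof -
  note [measurable] = borel_measurable_integrable[OF f]
  have "ennreal (\<bar>c\<bar> ^ DIM('a)) * (\<integral>\<^sup>+x. ennreal (norm (f (c *\<^sub>R x))) \<partial>lborel) < \<infinity>"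
    using f nn_integral_lborel_scale[OF _ c, of "\<lambda>x. ennreal (norm (f x))"]
    by (simp add: integrable_iff_bounded)
  then show ?thesis
    using c by (auto simp: integrable_iff_bounded ennreal_mult_less_top)
qed

lemma integral_lborel_scale:
  fixes f :: "'a::euclidean_space \<Rightarrow> real"
  assumes [measurable]: "f \<in> borel_measurable borel" and c: "c \<noteq> 0"
  shows "(\<integral>x. f x \<partial>lborel) = \<bar>c\<bar> ^ DIM('a) * (\<integral>x. f (c *\<^sub>R x) \<partial>lborel)"
  by (subst lborel_affine[OF c, of 0]) (simp add: integral_density integral_distr)

text \<open>Substituting y = s x shows that the inner integral of the absolute value is the L1 norm
  of f divided by s^3. This is integrable over s because \<sigma> keeps s away from 0.\<close>

lemma integrable_dilations:
  fixes f :: "real ^ 2 \<Rightarrow> real"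
  assumes f: "integrable lborel f" and \<sigma>: "0 < \<sigma>"
  shows "integrable (lborel \<Otimes>\<^sub>M lborel) (\<lambda>(s, x). f (s *\<^sub>R x) / s * indicator {\<sigma>..\<tau>} s)"
proof (rule lborel_pair.Fubini_integrable)
  note [measurable] = borel_measurable_integrable[OF f]
  show "(\<lambda>(s, x). f (s *\<^sub>R x) / s * indicator {\<sigma>..\<tau>} s) \<in> borel_measurable (lborel \<Otimes>\<^sub>M lborel)"
    by measurable
  have "(\<integral>x. norm (f (s *\<^sub>R x) / s * indicator {\<sigma>..\<tau>} s) \<partial>lborel)
      = indicator {\<sigma>..\<tau>} s * ((\<integral>x. \<bar>f x\<bar> \<partial>lborel) / s ^ 3)" for s
  proof (cases "s \<in> {\<sigma>..\<tau>}")
    case True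
    then have "s > 0" using \<sigma> by simp
    then show ?thesis
      using True integral_lborel_scale[of "\<lambda>x. \<bar>f x\<bar>" s]
      by (simp add: abs_mult power2_eq_square power3_eq_cube)
  qed simp
  moreover have "integrable lborel (\<lambda>s. indicator {\<sigma>..\<tau>} s *\<^sub>R ((\<integral>x. \<bar>f x\<bar> \<partial>lborel) / s ^ 3))"
    using \<sigma> by (intro borel_integrable_compact continuous_intros) auto
  ultimately show "integrable lborel (\<lambda>s. \<integral>x. norm (case (s, x) of (s, x) \<Rightarrow> f (s *\<^sub>R x) / s * indicator {\<sigma>..\<tau>} s) \<partial>lborel)"
    by simp
  show "AE s in lborel. integrable lborel (\<lambda>x. case (s, x) of (s, x) \<Rightarrow> f (s *\<^sub>R x) / s * indicator {\<sigma>..\<tau>} s)"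
  proof (rule AE_I2)
    fix s
    show "integrable lborel (\<lambda>x. case (s, x) of (s, x) \<Rightarrow> f (s *\<^sub>R x) / s * indicator {\<sigma>..\<tau>} s)"
    proof (cases "s \<in> {\<sigma>..\<tau>}")
      case True
      then show ?thesis using \<sigma> integrable_lborel_scale[OF f, of s] by simp
    qed simp
  qed
qed

text \<open>For a test function \<open>\<phi> = a \<otimes> b\<close> this is \<open>2 \<phi> + x \<cdot> \<nabla>\<phi> = div (x \<phi>)\<close>.\<close>

definition radial_div :: "(real \<Rightarrow> real) \<Rightarrow> (real \<Rightarrow> real) \<Rightarrow> real ^ 2 \<Rightarrow> real" where
  "radial_div a b x = tensor (deriv (\<lambda>t. t * a t)) b x + tensor a (deriv (\<lambda>t. t * b t)) x"

lemma deriv_mult_id: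
  assumes "smooth_real a"
  shows "deriv (\<lambda>t. t * a t) t = a t + t * deriv a t"
  by (rule DERIV_imp_deriv) (auto intro!: derivative_eq_intros smooth_real_DERIV[OF assms])

text \<open>The divisor s^2 is the Jacobian of y = s x in the plane. With it, the integral of g (s
  x) \<phi>(x) over x becomes that of g y times this function of y, so the dependence on s sits in a
  smooth factor.\<close>

lemma tensor_scale_DERIV:
  assumes "smooth_real a" "smooth_real b" "s > 0"
  shows "((\<lambda>s. tensor a b ((1 / s) *\<^sub>R y) / s\<^sup>2) has_real_derivative
    - (radial_div a b ((1 / s) *\<^sub>R y) / s ^ 3)) (at s)"
proof -
  have 1: "((\<lambda>s. a (y $ i / s)) has_real_derivative deriv a (y $ i / s) * (- (y $ i) / s\<^sup>2)) (at s)"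
    if "smooth_real a" for a i
    by (rule DERIV_chain'[OF _ smooth_real_DERIV[OF that]])
       (use assms(3) in \<open>auto intro!: derivative_eq_intros simp: power2_eq_square\<close>)
  have 2: "((\<lambda>s. a (y $ 1 / s) * b (y $ 2 / s) / s\<^sup>2) has_real_derivative
    - (radial_div a b ((1 / s) *\<^sub>R y) / s ^ 3)) (at s)"
    using assms(3)
    by (auto intro!: derivative_eq_intros 1[OF assms(1)] 1[OF assms(2)]
        simp: radial_div_def tensor_def deriv_mult_id[OF assms(1)] deriv_mult_id[OF assms(2)]
           field_simps power2_eq_square power3_eq_cube)
  then show ?thesis by (simp add: tensor_def)
qed

lemma integrable_coordinate:
  assumes "integrable lborel f" "\<And>x. x \<notin> unit_disk \<Longrightarrow> f x = 0"
  shows "integrable lborel (\<lambda>x. x $ i * f x)"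
proof (rule Bochner_Integration.integrable_bound[OF assms(1)])
  show "(\<lambda>x. x $ i * f x) \<in> borel_measurable lborel"
    using borel_measurable_integrable[OF assms(1)] by measurable
  show "AE x in lborel. norm (x $ i * f x) \<le> norm (f x)"
  proof (rule AE_I2)
    fix x :: "real ^ 2"
    show "norm (x $ i * f x) \<le> norm (f x)"
    proof (cases "x \<in> unit_disk")
      case True
      then have "\<bar>x $ i\<bar> \<le> 1" using component_le_norm_cart[of x i] by simp
      then show ?thesis using mult_right_mono[of "\<bar>x $ i\<bar>" 1 "\<bar>f x\<bar>"] by (simp add: abs_mult)
    qed (simp add: assms(2))
  qed
qed

section \<open>Increments along rays of a function with a weak gradient\<close>

text \<open>The functions are extended by zero so that dilations and Fubini act on the whole plane.
  The weak derivatives are nevertheless those in the disk only, as the extension of g may jump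
  across the circle.\<close>

locale weak_radial_derivative =
  fixes g g1 g2 :: "real ^ 2 \<Rightarrow> real"
  assumes integrable: "integrable lborel g" "integrable lborel g1" "integrable lborel g2"
    and outside: "\<And>x. x \<notin> unit_disk \<Longrightarrow> g x = 0 \<and> g1 x = 0 \<and> g2 x = 0"
    and weak1: "\<And>a b. test_pair a b \<Longrightarrow>
      (\<integral>x. g x * tensor (deriv a) b x \<partial>lborel) = - (\<integral>x. g1 x * tensor a b x \<partial>lborel)"
    and weak2: "\<And>a b. test_pair a b \<Longrightarrow>
      (\<integral>x. g x * tensor a (deriv b) x \<partial>lborel) = - (\<integral>x. g2 x * tensor a b x \<partial>lborel)"
begin

definition radial_deriv where "radial_deriv x = x $ 1 * g1 x + x $ 2 * g2 x"

lemma integrable_radial_deriv: "integrable lborel radial_deriv"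
  unfolding radial_deriv_def[abs_def] using integrable outside by (intro Bochner_Integration.integrable_add integrable_coordinate) auto

text \<open>The weak gradient is tested with the vector field y \<phi>(y / s), whose divergence is
  \<open>radial_div\<close> at y / s. The field is supported in the disk because s \<le> 1.\<close>

lemma weak_radial:
  assumes ab: "test_pair a b" and s: "0 < s" "s \<le> 1"
  shows "(\<integral>y. g y * radial_div a b ((1 / s) *\<^sub>R y) \<partial>lborel) = - (\<integral>y. radial_deriv y * tensor a b ((1 / s) *\<^sub>R y) \<partial>lborel)"
proof -
  define \<alpha> \<beta> where "\<alpha> = (\<lambda>t. a (t / s))" and "\<beta> = (\<lambda>t. b (t / s))"
  have t: "test_pair \<alpha> \<beta>" unfolding \<alpha>_def \<beta>_def using ab s by (rule test_pair_scale)
  note sm = test_pair_smooth[OF ab]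
  have d: "deriv (\<lambda>t. t * c (t / s)) t = deriv (\<lambda>t. t * c t) (t / s)" if "smooth_real c" for c t
  proof -
    have "((\<lambda>t. c (t / s)) has_real_derivative deriv c (t / s) * (1 / s)) (at t)"
      by (rule DERIV_chain'[OF _ smooth_real_DERIV[OF that]])
         (use s in \<open>auto intro!: derivative_eq_intros\<close>)
    from DERIV_imp_deriv[OF DERIV_mult[OF DERIV_ident this]] show ?thesis
      by (simp add: deriv_mult_id[OF that])
  qed
  have eq1: "radial_div a b ((1 / s) *\<^sub>R y) = tensor (deriv (\<lambda>t. t * \<alpha> t)) \<beta> y + tensor \<alpha> (deriv (\<lambda>t. t * \<beta> t)) y" for y
    by (simp add: radial_div_def tensor_def \<alpha>_def \<beta>_def d[OF sm(1)] d[OF sm(2)])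
  have eq2: "radial_deriv y * tensor a b ((1 / s) *\<^sub>R y) = g1 y * tensor (\<lambda>t. t * \<alpha> t) \<beta> y + g2 y * tensor \<alpha> (\<lambda>t. t * \<beta> t) y" for y
    by (simp add: radial_deriv_def tensor_def \<alpha>_def \<beta>_def algebra_simps)
  note t1 = test_pair_mult_id1[OF t] and t2 = test_pair_mult_id2[OF t]
  show ?thesis
    unfolding eq1 eq2 distrib_left
    using integrable_mult_tensor[OF integrable(1) test_pair_deriv1[OF t1]]
      integrable_mult_tensor[OF integrable(1) test_pair_deriv2[OF t2]]
      integrable_mult_tensor[OF integrable(2) t1] integrable_mult_tensor[OF integrable(3) t2]
      weak1[OF t1] weak2[OF t2]
    by simp
qed

text \<open>Against a test function, the increment of g turns into that of the smooth function in
  \<open>tensor_scale_DERIV\<close>, to which the fundamental theorem in s applies. Fubini and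
  \<open>weak_radial\<close> then move the derivative to g, and the substitution is undone. The
  integrand is the derivative of g (s x) in s: \<open>radial_deriv\<close> at s x carries an extra
  factor s, which the division removes. The exceptional null set depends on \<sigma> and
  \<tau>.\<close>

lemma radial_increment:
  assumes \<sigma>: "0 < \<sigma>" "\<sigma> \<le> \<tau>" "\<tau> \<le> 1"
  shows "AE x in lborel. x \<in> unit_disk \<longrightarrow>
    g (\<tau> *\<^sub>R x) - g (\<sigma> *\<^sub>R x) = (\<integral>s. radial_deriv (s *\<^sub>R x) / s * indicator {\<sigma>..\<tau>} s \<partial>lborel)"
proof -
  note [measurable] = borel_measurable_integrable[OF integrable(1)] borel_measurable_integrable[OF integrable_radial_deriv]
  define K where "K = (\<lambda>x. \<integral>s. radial_deriv (s *\<^sub>R x) / s * indicator {\<sigma>..\<tau>} s \<partial>lborel)"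
  have dil: "integrable (lborel \<Otimes>\<^sub>M lborel) (\<lambda>(s, x). radial_deriv (s *\<^sub>R x) / s * indicator {\<sigma>..\<tau>} s)"
    using integrable_radial_deriv \<sigma>(1) by (rule integrable_dilations)
  have K: "integrable lborel K"
    unfolding K_def using lborel_pair.integrable_snd[OF dil] .
  have "AE x in lborel. x \<in> unit_disk \<longrightarrow> g (\<tau> *\<^sub>R x) - g (\<sigma> *\<^sub>R x) - K x = 0"
  proof (rule AE_zero_if_tensor_integrals_zero)
    show int: "integrable lborel (\<lambda>x. g (\<tau> *\<^sub>R x) - g (\<sigma> *\<^sub>R x) - K x)"
      using \<sigma> by (intro Bochner_Integration.integrable_diff integrable_lborel_scale integrable(1) K) auto
    fix a b assume ab: "test_pair a b"
    note sm = test_pair_smooth[OF ab]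
    have [measurable]: "tensor a b \<in> borel_measurable borel" using sm by (rule tensor_measurable)
    have smid: "smooth_real (deriv (\<lambda>t. t * a t))" "smooth_real (deriv (\<lambda>t. t * b t))"
      using sm by (auto intro!: smooth_real_deriv smooth_real_mult smooth_real_id)
    have [measurable]: "radial_div a b \<in> borel_measurable borel"
      unfolding radial_div_def[abs_def] using sm smid by (intro borel_measurable_add tensor_measurable)
    have scale: "(\<integral>y. f y * tensor a b ((1 / s) *\<^sub>R y) \<partial>lborel) = s\<^sup>2 * (\<integral>x. f (s *\<^sub>R x) * tensor a b x \<partial>lborel)"
      if [measurable]: "f \<in> borel_measurable borel" and s: "s > 0" for f s
      using integral_lborel_scale[of "\<lambda>y. f y * tensor a b ((1 / s) *\<^sub>R y)" s] s by simp
    obtain C1 where C1: "\<And>x. \<bar>tensor (deriv (\<lambda>t. t * a t)) b x\<bar> \<le> C1"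
      using tensor_bounded[OF test_pair_deriv1[OF test_pair_mult_id1[OF ab]]] by blast
    obtain C2 where C2: "\<And>x. \<bar>tensor a (deriv (\<lambda>t. t * b t)) x\<bar> \<le> C2"
      using tensor_bounded[OF test_pair_deriv2[OF test_pair_mult_id2[OF ab]]] by blast
    have C: "\<bar>radial_div a b x\<bar> \<le> C1 + C2" for x
      unfolding radial_div_def using C1[of x] C2[of x] by linarith
    then have C0: "0 \<le> C1 + C2" by (meson abs_ge_zero order_trans)

    define F where "F = (\<lambda>(y, s). g y * (radial_div a b ((1 / s) *\<^sub>R y) / s ^ 3) * indicator {\<sigma>..\<tau>} s)"
    have Fm: "F \<in> borel_measurable (lborel \<Otimes>\<^sub>M lborel)"
      unfolding F_def by measurable
    have F: "integrable (lborel \<Otimes>\<^sub>M lborel) F"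
    proof (rule Bochner_Integration.integrable_bound[OF _ Fm])
      have "integrable (lborel \<Otimes>\<^sub>M lborel) (\<lambda>(y, s). g y * indicator {\<sigma>..\<tau>} s)"
        by (rule lborel_pair.Fubini_integrable)
           (use integrable(1) in \<open>auto simp: abs_mult integrable_indicator_iff emeasure_lborel_Icc_eq\<close>)
      then show "integrable (lborel \<Otimes>\<^sub>M lborel) (\<lambda>z. (C1 + C2) / \<sigma> ^ 3 * (case z of (y, s) \<Rightarrow> g y * indicator {\<sigma>..\<tau>} s))"
        by simp
      show "AE z in lborel \<Otimes>\<^sub>M lborel. norm (F z)
          \<le> norm ((C1 + C2) / \<sigma> ^ 3 * (case z of (y, s) \<Rightarrow> g y * indicator {\<sigma>..\<tau>} s))"
      proof (rule AE_I2, clarify)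
        fix y s
        show "norm (F (y, s)) \<le> norm ((C1 + C2) / \<sigma> ^ 3 * (g y * indicator {\<sigma>..\<tau>} s))"
        proof (cases "s \<in> {\<sigma>..\<tau>}")
          case True
          then have "\<bar>radial_div a b ((1 / s) *\<^sub>R y)\<bar> / s ^ 3 \<le> (C1 + C2) / \<sigma> ^ 3"
            using \<sigma> C C0 by (intro frac_le power_mono) auto
          then have "\<bar>g y\<bar> * (\<bar>radial_div a b ((1 / s) *\<^sub>R y)\<bar> / s ^ 3) \<le> \<bar>g y\<bar> * ((C1 + C2) / \<sigma> ^ 3)"
            by (rule mult_left_mono) simp
          then show ?thesis
            using True \<sigma> C0 by (simp add: F_def abs_mult mult.commute)
        qed (simp add: F_def)
      qed
    qed
    have FTC: "(\<integral>s. F (y, s) \<partial>lborel)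
        = - (g y * tensor a b ((1 / \<tau>) *\<^sub>R y) / \<tau>\<^sup>2 - g y * tensor a b ((1 / \<sigma>) *\<^sub>R y) / \<sigma>\<^sup>2)" for y
    proof -
      have "(\<integral>s. indicator {\<sigma>..\<tau>} s *\<^sub>R (- (radial_div a b ((1 / s) *\<^sub>R y) / s ^ 3)) \<partial>lborel)
          = tensor a b ((1 / \<tau>) *\<^sub>R y) / \<tau>\<^sup>2 - tensor a b ((1 / \<sigma>) *\<^sub>R y) / \<sigma>\<^sup>2"
      proof (rule integral_FTC_Icc)
        show "((\<lambda>s. tensor a b ((1 / s) *\<^sub>R y) / s\<^sup>2) has_vector_derivative
            - (radial_div a b ((1 / s) *\<^sub>R y) / s ^ 3)) (at s within {\<sigma>..\<tau>})" if "\<sigma> \<le> s" "s \<le> \<tau>" for s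
          unfolding has_real_derivative_iff_has_vector_derivative[symmetric]
          by (rule DERIV_subset[OF tensor_scale_DERIV[OF sm]]) (use that \<sigma> in auto)
        have c: "continuous_on UNIV c" if "smooth_real c" for c using smooth_real_continuous_on[OF that] .
        show "continuous_on {\<sigma>..\<tau>} (\<lambda>s. - (radial_div a b ((1 / s) *\<^sub>R y) / s ^ 3))"
          unfolding radial_div_def tensor_def vector_scaleR_component
          by (intro continuous_intros continuous_on_compose2[OF c[OF sm(1)]] continuous_on_compose2[OF c[OF sm(2)]]
             continuous_on_compose2[OF c[OF smid(1)]]
             continuous_on_compose2[OF c[OF smid(2)]]) (use \<sigma> in auto)
      qed (use \<sigma> in auto)
      moreover have "(\<integral>s. F (y, s) \<partial>lborel)
        = - g y * (\<integral>s. indicator {\<sigma>..\<tau>} s *\<^sub>R (- (radial_div a b ((1 / s) *\<^sub>R y) / s ^ 3)) \<partial>lborel)"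
        by (subst integral_mult_right_zero[symmetric]) (simp add: F_def ac_simps)
      ultimately show ?thesis by (simp add: right_diff_distrib)
    qed
    \<comment> \<open>Of the divisor s^3, two powers cancel against the Jacobian of y = s x; the
      third is the division by s in the claim.\<close>
    have slice: "(\<integral>y. F (y, s) \<partial>lborel) = - (\<integral>x. radial_deriv (s *\<^sub>R x) / s * indicator {\<sigma>..\<tau>} s * tensor a b x \<partial>lborel)" for s
    proof (cases "s \<in> {\<sigma>..\<tau>}")
      case True
      then have s: "0 < s" "s \<le> 1" using \<sigma> by auto
      have "(\<integral>y. F (y, s) \<partial>lborel) = (\<integral>y. g y * radial_div a b ((1 / s) *\<^sub>R y) \<partial>lborel) / s ^ 3"
        using True by (simp add: F_def)
      also have "\<dots> = - (s\<^sup>2 * (\<integral>x. radial_deriv (s *\<^sub>R x) * tensor a b x \<partial>lborel)) / s ^ 3"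
        using s by (simp add: weak_radial[OF ab] scale)
      also have "\<dots> = - ((\<integral>x. radial_deriv (s *\<^sub>R x) * tensor a b x \<partial>lborel) / s)"
        using s by (simp add: power2_eq_square power3_eq_cube)
      also have "(\<integral>x. radial_deriv (s *\<^sub>R x) * tensor a b x \<partial>lborel) / s = (\<integral>x. radial_deriv (s *\<^sub>R x) / s * indicator {\<sigma>..\<tau>} s * tensor a b x \<partial>lborel)"
        using True by (subst integral_divide_zero[symmetric]) simp
      finally show ?thesis .
    qed (simp add: F_def)

    obtain C3 where C3: "\<And>x. \<bar>tensor a b x\<bar> \<le> C3" using tensor_bounded[OF ab] by blast
    define G where "G = (\<lambda>(s, x). radial_deriv (s *\<^sub>R x) / s * indicator {\<sigma>..\<tau>} s * tensor a b x)"
    have Gm: "G \<in> borel_measurable (lborel \<Otimes>\<^sub>M lborel)"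
      unfolding G_def by measurable
    have G: "integrable (lborel \<Otimes>\<^sub>M lborel) G"
    proof (rule Bochner_Integration.integrable_bound[OF _ Gm])
      show "integrable (lborel \<Otimes>\<^sub>M lborel) (\<lambda>z. C3 * (case z of (s, x) \<Rightarrow> radial_deriv (s *\<^sub>R x) / s * indicator {\<sigma>..\<tau>} s))"
        using dil by simp
      show "AE z in lborel \<Otimes>\<^sub>M lborel. norm (G z)
          \<le> norm (C3 * (case z of (s, x) \<Rightarrow> radial_deriv (s *\<^sub>R x) / s * indicator {\<sigma>..\<tau>} s))"
      proof (rule AE_I2, clarify)
        fix s x
        have "\<bar>radial_deriv (s *\<^sub>R x) / s * indicator {\<sigma>..\<tau>} s\<bar> * \<bar>tensor a b x\<bar>
          \<le> \<bar>radial_deriv (s *\<^sub>R x) / s * indicator {\<sigma>..\<tau>} s\<bar> * \<bar>C3\<bar>"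
          using C3[of x] by (intro mult_left_mono) auto
        then show "norm (G (s, x)) \<le> norm (C3 * (radial_deriv (s *\<^sub>R x) / s * indicator {\<sigma>..\<tau>} s))"
          by (simp add: G_def abs_mult mult.commute)
      qed
    qed
    have "(\<integral>x. K x * tensor a b x \<partial>lborel) = (\<integral>x. (\<integral>s. G (s, x) \<partial>lborel) \<partial>lborel)"
      unfolding G_def K_def by (simp only: prod.case integral_mult_left_zero)
    also have "\<dots> = (\<integral>s. (\<integral>x. G (s, x) \<partial>lborel) \<partial>lborel)"
      using lborel_pair.Fubini_integral[of "\<lambda>s x. G (s, x)"] G by simp
    also have "\<dots> = - (\<integral>s. (\<integral>y. F (y, s) \<partial>lborel) \<partial>lborel)"
      by (simp add: slice G_def)
    also have "(\<integral>s. (\<integral>y. F (y, s) \<partial>lborel) \<partial>lborel) = (\<integral>y. (\<integral>s. F (y, s) \<partial>lborel) \<partial>lborel)"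
      using lborel_pair.Fubini_integral[of "\<lambda>y s. F (y, s)"] F by simp
    also have "- \<dots> = (\<integral>y. g y * tensor a b ((1 / \<tau>) *\<^sub>R y) / \<tau>\<^sup>2 - g y * tensor a b ((1 / \<sigma>) *\<^sub>R y) / \<sigma>\<^sup>2 \<partial>lborel)"
      unfolding FTC by (simp only: Bochner_Integration.integral_minus minus_minus)
    also have "\<dots> = (\<integral>y. g y * tensor a b ((1 / \<tau>) *\<^sub>R y) \<partial>lborel) / \<tau>\<^sup>2 - (\<integral>y. g y * tensor a b ((1 / \<sigma>) *\<^sub>R y) \<partial>lborel) / \<sigma>\<^sup>2"
    proof -
      have "integrable lborel (\<lambda>y. g y * tensor a b ((1 / s) *\<^sub>R y))" if "0 < s" "s \<le> 1" for s
        using integrable_mult_tensor[OF integrable(1) test_pair_scale[OF ab that]] by (simp add: tensor_def)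
      then show ?thesis using \<sigma> by simp
    qed
    also have "\<dots> = (\<integral>x. g (\<tau> *\<^sub>R x) * tensor a b x \<partial>lborel) - (\<integral>x. g (\<sigma> *\<^sub>R x) * tensor a b x \<partial>lborel)"
      using \<sigma> by (simp add: scale)
    finally have "(\<integral>x. K x * tensor a b x \<partial>lborel) = \<dots>" .
    then show "(\<integral>x. (g (\<tau> *\<^sub>R x) - g (\<sigma> *\<^sub>R x) - K x) * tensor a b x \<partial>lborel) = 0"
      using \<sigma> integrable_mult_tensor[OF integrable_lborel_scale[OF integrable(1)] ab]
        integrable_mult_tensor[OF K ab]
      by (simp add: left_diff_distrib)
  qed
  then show ?thesis by eventually_elim (simp add: K_def)
qed

end

section \<open>Absolutely continuous functions of one variable\<close>

text \<open>Integration by parts in integral form: the half-planes r \<le> s and s \<le> r cover the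
  plane and overlap in the diagonal only, which every slice meets in a single point. So the two
  iterated integrals add up to that of f(r) g(s) over the plane.\<close>

lemma integrable_triangle:
  fixes f g :: "real \<Rightarrow> real"
  assumes f: "integrable lborel f" and g: "integrable lborel g"
  shows "integrable lborel (\<lambda>s. g s * (\<integral>r. f r * indicator {..s} r \<partial>lborel))"
    and "(\<integral>s. g s * (\<integral>r. f r * indicator {..s} r \<partial>lborel) \<partial>lborel)
      + (\<integral>r. f r * (\<integral>s. g s * indicator {..r} s \<partial>lborel) \<partial>lborel)
      = (\<integral>r. f r \<partial>lborel) * (\<integral>s. g s \<partial>lborel)"
proof -
  note [measurable] = borel_measurable_integrable[OF f] borel_measurable_integrable[OF g]
  define F where "F = (\<lambda>(r, s). f r * g s)"
  have F: "integrable (lborel \<Otimes>\<^sub>M lborel) F"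
  proof (rule lborel_pair.Fubini_integrable)
    show "F \<in> borel_measurable (lborel \<Otimes>\<^sub>M lborel)" unfolding F_def by measurable
    show "integrable lborel (\<lambda>x. \<integral>y. norm (F (x, y)) \<partial>lborel)"
      using f by (simp add: F_def abs_mult)
    show "AE x in lborel. integrable lborel (\<lambda>y. F (x, y))"
      using g by (simp add: F_def)
  qed
  have bd: "integrable (lborel \<Otimes>\<^sub>M lborel) (\<lambda>z. F z * indicator A z)"
    if "A \<in> sets (lborel \<Otimes>\<^sub>M lborel)" for A
    using integrable_real_mult_indicator[OF that F] .
  have sets: "{z. fst z \<le> snd z} \<in> sets (lborel \<Otimes>\<^sub>M (lborel :: real measure))"
    "{z. snd z \<le> fst z} \<in> sets (lborel \<Otimes>\<^sub>M (lborel :: real measure))"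
  proof -
    have "{z \<in> space (lborel \<Otimes>\<^sub>M (lborel :: real measure)). fst z \<le> snd z} \<in> sets (lborel \<Otimes>\<^sub>M lborel)"
      "{z \<in> space (lborel \<Otimes>\<^sub>M (lborel :: real measure)). snd z \<le> fst z} \<in> sets (lborel \<Otimes>\<^sub>M lborel)"
      by measurable
    then show "{z. fst z \<le> snd z} \<in> sets (lborel \<Otimes>\<^sub>M (lborel :: real measure))"
      "{z. snd z \<le> fst z} \<in> sets (lborel \<Otimes>\<^sub>M (lborel :: real measure))"
      by (simp_all add: space_pair_measure)
  qed
  have 1: "integrable (lborel \<Otimes>\<^sub>M lborel) (\<lambda>(r, s). f r * g s * indicator {..s} r)"
    by (rule Bochner_Integration.integrable_cong[THEN iffD1, OF refl _ bd[OF sets(1)]])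
       (auto simp: F_def split: split_indicator)
  have 2: "integrable (lborel \<Otimes>\<^sub>M lborel) (\<lambda>(r, s). f r * g s * indicator {..r} s)"
    by (rule Bochner_Integration.integrable_cong[THEN iffD1, OF refl _ bd[OF sets(2)]])
       (auto simp: F_def split: split_indicator)
  have inner: "(\<integral>r. f r * g s * indicator {..s} r \<partial>lborel) = g s * (\<integral>r. f r * indicator {..s} r \<partial>lborel)" for s
    by (subst integral_mult_right_zero[symmetric]) (simp add: ac_simps)
  have inner': "(\<integral>s. f r * g s * indicator {..r} s \<partial>lborel) = f r * (\<integral>s. g s * indicator {..r} s \<partial>lborel)" for r
    by (subst integral_mult_right_zero[symmetric]) (simp add: ac_simps)
  show "integrable lborel (\<lambda>s. g s * (\<integral>r. f r * indicator {..s} r \<partial>lborel))"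
    using lborel_pair.integrable_snd[OF 1] by (simp add: inner)
  have "(\<integral>r. f r * (\<integral>s. g s * indicator {..r} s \<partial>lborel) \<partial>lborel)
      = (\<integral>s. (\<integral>r. f r * g s * indicator {..r} s \<partial>lborel) \<partial>lborel)"
    using lborel_pair.Fubini_integral[OF 2] by (simp add: inner')
  moreover have "integrable lborel (\<lambda>s. \<integral>r. f r * g s * indicator {..r} s \<partial>lborel)"
    using lborel_pair.integrable_snd[OF 2] by simp
  moreover have "integrable lborel (\<lambda>s. \<integral>r. f r * g s * indicator {..s} r \<partial>lborel)"
    using lborel_pair.integrable_snd[OF 1] by simp
  ultimately have "(\<integral>s. g s * (\<integral>r. f r * indicator {..s} r \<partial>lborel) \<partial>lborel)
      + (\<integral>r. f r * (\<integral>s. g s * indicator {..r} s \<partial>lborel) \<partial>lborel)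
      = (\<integral>s. (\<integral>r. f r * g s * indicator {..s} r \<partial>lborel)
           + (\<integral>r. f r * g s * indicator {..r} s \<partial>lborel) \<partial>lborel)"
    by (simp add: inner)
  also have "\<dots> = (\<integral>s. (\<integral>r. f r \<partial>lborel) * g s \<partial>lborel)"
  proof (rule Bochner_Integration.integral_cong[OF refl])
    fix s
    have i1: "integrable lborel (\<lambda>r. f r * g s * indicator {..s} r)"
      by (intro integrable_real_mult_indicator integrable_mult_left f) auto
    have eq: "(\<lambda>r. f r * g s * indicator {..r} s) = (\<lambda>r. f r * g s * indicator {s..} r)"
      by (auto split: split_indicator)
    have i2: "integrable lborel (\<lambda>r. f r * g s * indicator {..r} s)"
      unfolding eq by (intro integrable_real_mult_indicator integrable_mult_left f) auto
    have "(\<integral>r. f r * g s * indicator {..s} r \<partial>lborel) + (\<integral>r. f r * g s * indicator {..r} s \<partial>lborel)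
      = (\<integral>r. f r * g s * indicator {..s} r + f r * g s * indicator {..r} s \<partial>lborel)"
      using i1 i2 by simp
    also have "\<dots> = (\<integral>r. f r * g s \<partial>lborel)"
    proof (rule integral_cong_AE)
      show "AE r in lborel. f r * g s * indicator {..s} r + f r * g s * indicator {..r} s = f r * g s"
        using AE_lborel_singleton[of s] by eventually_elim (auto split: split_indicator)
      show "(\<lambda>r. f r * g s * indicator {..s} r + f r * g s * indicator {..r} s) \<in> borel_measurable lborel"
        using i1 i2 by (intro borel_measurable_add) auto
    qed measurable
    finally show "(\<integral>r. f r * g s * indicator {..s} r \<partial>lborel) + (\<integral>r. f r * g s * indicator {..r} s \<partial>lborel)
      = (\<integral>r. f r \<partial>lborel) * g s" by simp
  qed
  finally show "(\<integral>s. g s * (\<integral>r. f r * indicator {..s} r \<partial>lborel) \<partial>lborel)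
      + (\<integral>r. f r * (\<integral>s. g s * indicator {..r} s \<partial>lborel) \<partial>lborel)
      = (\<integral>r. f r \<partial>lborel) * (\<integral>s. g s \<partial>lborel)" by simp
qed

text \<open>Absolute continuity on [a, b] with almost everywhere derivative q, in integral form so
  that no pointwise derivative has to be handled.\<close>

definition primitive_on :: "real \<Rightarrow> real \<Rightarrow> (real \<Rightarrow> real) \<Rightarrow> (real \<Rightarrow> real) \<Rightarrow> bool" where
  "primitive_on a b p q \<longleftrightarrow> integrable lborel (\<lambda>t. q t * indicator {a..b} t) \<and>
     (\<forall>t\<in>{a..b}. p t = p a + (\<integral>s. q s * indicator {a..t} s \<partial>lborel))"

lemma primitive_onI:
  assumes "integrable lborel (\<lambda>t. q t * indicator {a..b} t)"
    "\<And>t. t \<in> {a..b} \<Longrightarrow> p t = p a + (\<integral>s. q s * indicator {a..t} s \<partial>lborel)"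
  shows "primitive_on a b p q"
  using assms unfolding primitive_on_def by blast

lemma primitive_on_eq:
  assumes "primitive_on a b p q" "t \<in> {a..b}"
  shows "p t = p a + (\<integral>s. q s * indicator {a..t} s \<partial>lborel)"
  using assms unfolding primitive_on_def by blast

lemma primitive_on_integrable:
  assumes "primitive_on a b p q" "a \<le> c" "d \<le> b"
  shows "integrable lborel (\<lambda>t. q t * indicator {c..d} t)"
proof -
  have "(\<lambda>t. q t * indicator {a..b} t * indicator {c..d} t) = (\<lambda>t. q t * indicator {c..d} t)"
    using assms(2,3) by (auto split: split_indicator)
  moreover have "integrable lborel (\<lambda>t. q t * indicator {a..b} t * indicator {c..d} t)"
    by (rule integrable_real_mult_indicator) (simp, use assms(1) primitive_on_def in blast)
  ultimately show ?thesis by simp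
qed

lemma primitive_on_const: "primitive_on a b (\<lambda>_. c) (\<lambda>_. 0)"
  by (simp add: primitive_on_def)

lemma primitive_on_add:
  assumes "primitive_on a b p q" "primitive_on a b p' q'"
  shows "primitive_on a b (\<lambda>t. p t + p' t) (\<lambda>t. q t + q' t)"
proof -
  show ?thesis
  proof (rule primitive_onI)
    show "integrable lborel (\<lambda>t. (q t + q' t) * indicator {a..b} t)"
      using primitive_on_integrable[OF assms(1), of a b] primitive_on_integrable[OF assms(2), of a b]
      by (simp add: distrib_right)
    fix t assume t: "t \<in> {a..b}"
    then have "(\<integral>s. (q s + q' s) * indicator {a..t} s \<partial>lborel)
      = (\<integral>s. q s * indicator {a..t} s \<partial>lborel) + (\<integral>s. q' s * indicator {a..t} s \<partial>lborel)"
      using primitive_on_integrable[OF assms(1), of a t] primitive_on_integrable[OF assms(2), of a t]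
      by (simp add: distrib_right)
    then show "p t + p' t = p a + p' a + (\<integral>s. (q s + q' s) * indicator {a..t} s \<partial>lborel)"
      using primitive_on_eq[OF assms(1) t] primitive_on_eq[OF assms(2) t] by linarith
  qed
qed

text \<open>Truncating both derivatives to [a, t] makes their integrals over the line equal to the
  increments of p and p'. The product of the increments is then the right-hand side of
  \<open>integrable_triangle\<close>, and the constants p a and p' a contribute linear
  terms.\<close>

lemma primitive_on_mult:
  assumes "primitive_on a b p q" "primitive_on a b p' q'"
  shows "primitive_on a b (\<lambda>t. p t * p' t) (\<lambda>t. p t * q' t + q t * p' t)"
proof -
  have main: "integrable lborel (\<lambda>s. (p s * q' s + q s * p' s) * indicator {a..t} s) \<and>
    (\<integral>s. (p s * q' s + q s * p' s) * indicator {a..t} s \<partial>lborel) = p t * p' t - p a * p' a"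
    if t: "t \<in> {a..b}" for t
  proof -
    define f g where "f = (\<lambda>s. q s * indicator {a..t} s)" and "g = (\<lambda>s. q' s * indicator {a..t} s)"
    have f: "integrable lborel f" and g: "integrable lborel g"
      using primitive_on_integrable[OF assms(1)] primitive_on_integrable[OF assms(2)] t
      by (auto simp: f_def g_def)
    have pf: "p s = p a + (\<integral>r. f r * indicator {..s} r \<partial>lborel)" if "s \<in> {a..t}" for s
    proof -
      have "(\<lambda>r. f r * indicator {..s} r) = (\<lambda>r. q r * indicator {a..s} r)"
        using that by (auto simp: f_def split: split_indicator)
      then show ?thesis using primitive_on_eq[OF assms(1), of s] that t by simp
    qed
    have pg: "p' s = p' a + (\<integral>r. g r * indicator {..s} r \<partial>lborel)" if "s \<in> {a..t}" for s
    proof -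
      have "(\<lambda>r. g r * indicator {..s} r) = (\<lambda>r. q' r * indicator {a..s} r)"
        using that by (auto simp: g_def split: split_indicator)
      then show ?thesis using primitive_on_eq[OF assms(2), of s] that t by simp
    qed
    have pt: "p t = p a + (\<integral>r. f r \<partial>lborel)" "p' t = p' a + (\<integral>r. g r \<partial>lborel)"
      using primitive_on_eq[OF assms(1) t] primitive_on_eq[OF assms(2) t] by (simp_all add: f_def g_def)
    have eq: "(p s * q' s + q s * p' s) * indicator {a..t} s
      = (p a * g s + p' a * f s) + (g s * (\<integral>r. f r * indicator {..s} r \<partial>lborel)
         + f s * (\<integral>r. g r * indicator {..s} r \<partial>lborel))" for s
    proof (cases "s \<in> {a..t}")
      case True
      show ?thesis
        by (subst pf[OF True], subst pg[OF True]) (simp add: True f_def g_def algebra_simps)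
    qed (simp add: f_def g_def)
    show ?thesis
      unfolding eq
      using integrable_triangle(1)[OF f g] integrable_triangle(1)[OF g f] f g
        integrable_triangle(2)[OF f g] pt
      by (simp add: algebra_simps)
  qed
  show ?thesis
  proof (cases "a \<le> b")
    case True
    show ?thesis
    proof (rule primitive_onI)
      show "integrable lborel (\<lambda>t. (p t * q' t + q t * p' t) * indicator {a..b} t)"
        using main[of b] True by simp
      show "p t * p' t = p a * p' a + (\<integral>s. (p s * q' s + q s * p' s) * indicator {a..t} s \<partial>lborel)"
        if "t \<in> {a..b}" for t
        using main[OF that] by linarith
    qed
  qed (simp add: primitive_on_def)
qed

text \<open>Sum and product rule give the chain rule for polynomials. No other outer functions are
  composed with p below: the cut-off at its zero set is done by polynomials.\<close>

lemma primitive_on_poly: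
  assumes "primitive_on a b p q"
  shows "primitive_on a b (\<lambda>t. poly P (p t)) (\<lambda>t. poly (pderiv P) (p t) * q t)"
proof (induction P)
  case 0
  then show ?case using primitive_on_const[of a b 0] by simp
next
  case (pCons c P)
  show ?case
    using primitive_on_add[OF primitive_on_const[of a b c] primitive_on_mult[OF assms pCons(2)]]
    by (simp add: pderiv_pCons algebra_simps)
qed

lemma primitive_on_subinterval:
  assumes "primitive_on a b p q" "a \<le> c" "d \<le> b"
  shows "primitive_on c d p q"
proof -
  have "p t = p c + (\<integral>s. q s * indicator {c..t} s \<partial>lborel)" if t: "t \<in> {c..d}" for t
  proof -
    have i: "integrable lborel (\<lambda>s. q s * indicator {a..c} s)" "integrable lborel (\<lambda>s. q s * indicator {c..t} s)"
      using primitive_on_integrable[OF assms(1)] assms t by auto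
    have "(\<integral>s. q s * indicator {a..t} s \<partial>lborel)
        = (\<integral>s. q s * indicator {a..c} s + q s * indicator {c..t} s \<partial>lborel)"
    proof (rule integral_cong_AE)
      show "AE s in lborel. q s * indicator {a..t} s = q s * indicator {a..c} s + q s * indicator {c..t} s"
        using AE_lborel_singleton[of c] by eventually_elim (use assms t in \<open>auto split: split_indicator\<close>)
      show "(\<lambda>s. q s * indicator {a..t} s) \<in> borel_measurable lborel"
        using primitive_on_integrable[OF assms(1), of a t] assms t by auto
      show "(\<lambda>s. q s * indicator {a..c} s + q s * indicator {c..t} s) \<in> borel_measurable lborel"
        using i by (intro borel_measurable_add) auto
    qed
    moreover have "p t = p a + (\<integral>s. q s * indicator {a..t} s \<partial>lborel)"
      "p c = p a + (\<integral>s. q s * indicator {a..c} s \<partial>lborel)"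
      using primitive_on_eq[OF assms(1), of t] primitive_on_eq[OF assms(1), of c] assms t by simp_all
    ultimately show ?thesis using i by simp
  qed
  then show ?thesis
    using primitive_on_integrable[OF assms] by (intro primitive_onI)
qed

lemma primitive_on_bounded:
  assumes "primitive_on a b p q"
  shows "\<exists>M>0. \<forall>t\<in>{a..b}. \<bar>p t\<bar> < M"
proof -
  define K where "K = (\<integral>s. \<bar>q s * indicator {a..b} s\<bar> \<partial>lborel)"
  have "\<bar>p t\<bar> \<le> \<bar>p a\<bar> + K" if t: "t \<in> {a..b}" for t
  proof -
    have "norm (\<integral>s. q s * indicator {a..t} s \<partial>lborel) \<le> K"
      unfolding K_def
      by (rule Bochner_Integration.integral_norm_bound_integral)
         (use primitive_on_integrable[OF assms, of a t] primitive_on_integrable[OF assms, of a b] t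
          in \<open>auto split: split_indicator\<close>)
    moreover have "p t = p a + (\<integral>s. q s * indicator {a..t} s \<partial>lborel)"
      using primitive_on_eq[OF assms t] .
    ultimately show ?thesis by simp
  qed
  moreover have "0 \<le> K" by (simp add: K_def)
  \<comment> \<open>The summand 1 makes the bound strict and positive, so that p / M stays strictly
    inside (-1, 1).\<close>
  ultimately show ?thesis by (intro exI[of _ "\<bar>p a\<bar> + K + 1"]) force
qed

section \<open>The derivative of an absolutely continuous function on its zero set\<close>

text \<open>By Bernoulli 1 + n z \<le> (1 + z)^n, and (1 - z)(1 + z) \<le> 1. This gives a bound
  independent of n for the derivatives of the approximating polynomials, as dominated convergence
  requires.\<close>

lemma power_one_minus_mult_le:
  fixes z :: real
  assumes "0 \<le> z" "z \<le> 1"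
  shows "(1 - z) ^ n * (1 + real n * z) \<le> 1"
proof -
  have "(1 - z) ^ n * (1 + real n * z) \<le> (1 - z) ^ n * (1 + z) ^ n"
    using assms Bernoulli_inequality[of z n] by (intro mult_left_mono) auto
  also have "\<dots> = (1 - z\<^sup>2) ^ n" by (simp add: power_mult_distrib[symmetric] power2_eq_square algebra_simps)
  also have "\<dots> \<le> 1" using assms by (intro power_le_one) (auto simp: power_le_one)
  finally show ?thesis .
qed

text \<open>The polynomials \<open>y (1 - (y/M)\<^sup>2)\<^sup>n\<close> tend to 0 on \<open>(-M, M)\<close>, while their derivatives stay
  bounded there and tend to the indicator of \<open>0\<close>.\<close>

lemma primitive_on_integral_zero_set:
  assumes "primitive_on a b p q" "a \<le> b"
  shows "(\<integral>t. q t * indicator {a..b} t * indicator {0} (p t) \<partial>lborel) = 0"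
    "(\<lambda>t. q t * indicator {a..b} t * indicator {0} (p t)) \<in> borel_measurable lborel"
proof -
  obtain M where M: "M > 0" "\<forall>t\<in>{a..b}. \<bar>p t\<bar> < M" using primitive_on_bounded[OF assms(1)] by blast
  define z where "z = (\<lambda>y. (y / M)\<^sup>2)"
  define Q where "Q = (\<lambda>n. [:0, 1:] * [:1, 0, - 1 / M\<^sup>2:] ^ Suc n)"
  have Q: "poly (Q n) y = y * (1 - z y) ^ Suc n" for n y
    by (simp add: Q_def z_def poly_power power2_eq_square field_simps)
  have "pderiv [:1, 0, - 1 / M\<^sup>2:] = [:0, - 2 / M\<^sup>2:]" by (simp add: pderiv_pCons)
  then have Q': "poly (pderiv (Q n)) y = (1 - z y) ^ Suc n - 2 * (real (Suc n) * (z y * (1 - z y) ^ n))" for n y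
    unfolding Q_def pderiv_mult pderiv_power_Suc
    by (simp add: pderiv_pCons z_def poly_power power2_eq_square field_simps)
  have z01: "0 \<le> z (p t)" "z (p t) < 1" if "t \<in> {a..b}" for t
  proof -
    have "\<bar>p t / M\<bar> < 1" using M that by (simp add: field_simps)
    then show "z (p t) < 1" unfolding z_def by (simp add: abs_square_less_1)
  qed (simp add: z_def)
  \<comment> \<open>The first summand of the derivative lies in [0, 1] and the second in [-2, 0]; 3
    is a crude common bound.\<close>
  have bound: "\<bar>poly (pderiv (Q n)) (p t)\<bar> \<le> 3" if "t \<in> {a..b}" for n t
  proof -
    note z = z01[OF that]
    have "0 \<le> (1 - z (p t)) ^ Suc n" "(1 - z (p t)) ^ Suc n \<le> 1" using z by (auto intro!: power_le_one simp del: power_Suc)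
    moreover have "real (Suc n) * (z (p t) * (1 - z (p t)) ^ n) \<le> (1 - z (p t)) ^ n * (1 + real n * z (p t))"
    proof -
      have "z (p t) * (1 - z (p t)) ^ n \<le> 1 * (1 - z (p t)) ^ n" using z by (intro mult_right_mono) auto
      then show ?thesis by (simp add: algebra_simps)
    qed
    moreover have "(1 - z (p t)) ^ n * (1 + real n * z (p t)) \<le> 1" using z by (intro power_one_minus_mult_le) auto
    moreover have "0 \<le> real (Suc n) * (z (p t) * (1 - z (p t)) ^ n)" using z by simp
    ultimately show ?thesis unfolding Q' by linarith
  qed
  have Q_lim: "(\<lambda>n. poly (Q n) (p t)) \<longlonglongrightarrow> 0" if "t \<in> {a..b}" for t
  proof (cases "p t = 0")
    case False
    then have "0 < z (p t)" using M by (simp add: z_def)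
    then have "(\<lambda>n. (1 - z (p t)) ^ n) \<longlonglongrightarrow> 0"
      using z01[OF that] by (intro LIMSEQ_realpow_zero) auto
    from tendsto_mult_right_zero[OF LIMSEQ_Suc[OF this], of "p t"] show ?thesis by (simp add: Q)
  qed (simp add: Q)
  have Q'_lim: "(\<lambda>n. poly (pderiv (Q n)) (p t)) \<longlonglongrightarrow> indicator {0} (p t)" if "t \<in> {a..b}" for t
  proof (cases "p t = 0")
    case False
    then have "0 < z (p t)" using M by (simp add: z_def)
    then have 1: "(\<lambda>n. (1 - z (p t)) ^ n) \<longlonglongrightarrow> 0" and 2: "(\<lambda>n. real n * (1 - z (p t)) ^ n) \<longlonglongrightarrow> 0"
      using z01[OF that] by (auto intro!: LIMSEQ_realpow_zero powser_times_n_limit_0)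
    have "(\<lambda>n. (1 - z (p t)) * (1 - z (p t)) ^ n
        - 2 * (z (p t) * (real n * (1 - z (p t)) ^ n + (1 - z (p t)) ^ n)))
      \<longlonglongrightarrow> (1 - z (p t)) * 0 - 2 * (z (p t) * (0 + 0))"
      by (intro tendsto_intros 1 2)
    then show ?thesis using False by (simp add: Q' algebra_simps)
  next
    case True
    then show ?thesis by (simp add: Q' z_def)
  qed
  let ?f = "\<lambda>n t. q t * indicator {a..b} t * poly (pderiv (Q n)) (p t)"
  have prim: "primitive_on a b (\<lambda>t. poly (Q n) (p t)) (\<lambda>t. poly (pderiv (Q n)) (p t) * q t)" for n
    using primitive_on_poly[OF assms(1)] .
  have f_eq: "?f n = (\<lambda>t. poly (pderiv (Q n)) (p t) * q t * indicator {a..b} t)" for n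
    by (auto simp: ac_simps)
  have meas: "?f n \<in> borel_measurable lborel" for n
    using primitive_on_integrable[OF prim[of n], of a b] unfolding f_eq by simp
  have lim: "(\<lambda>n. ?f n t) \<longlonglongrightarrow> q t * indicator {a..b} t * indicator {0} (p t)" for t
    using Q'_lim[of t] by (cases "t \<in> {a..b}") (auto intro!: tendsto_mult_left)
  show m: "(\<lambda>t. q t * indicator {a..b} t * indicator {0} (p t)) \<in> borel_measurable lborel"
    using borel_measurable_LIMSEQ_real[OF lim meas] by blast
  have "(\<lambda>n. \<integral>t. ?f n t \<partial>lborel) \<longlonglongrightarrow> (\<integral>t. q t * indicator {a..b} t * indicator {0} (p t) \<partial>lborel)"
  proof (rule integral_dominated_convergence[OF m meas])
    show "integrable lborel (\<lambda>t. 3 * \<bar>q t * indicator {a..b} t\<bar>)"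
      using primitive_on_integrable[OF assms(1), of a b] by simp
    show "AE t in lborel. norm (?f n t) \<le> 3 * \<bar>q t * indicator {a..b} t\<bar>" for n
    proof (rule AE_I2)
      fix t
      show "norm (?f n t) \<le> 3 * \<bar>q t * indicator {a..b} t\<bar>"
        using mult_left_mono[OF bound[of t n], of "\<bar>q t\<bar>"]
        by (cases "t \<in> {a..b}") (auto simp: abs_mult mult.commute)
    qed
  qed (use lim in auto)
  moreover have "(\<integral>t. ?f n t \<partial>lborel) = poly (Q n) (p b) - poly (Q n) (p a)" for n
    using primitive_on_eq[OF prim[of n], of b] assms(2) unfolding f_eq by simp
  moreover have "(\<lambda>n. poly (Q n) (p b) - poly (Q n) (p a)) \<longlonglongrightarrow> 0 - 0"
    using assms(2) by (intro tendsto_diff Q_lim) auto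
  ultimately show "(\<integral>t. q t * indicator {a..b} t * indicator {0} (p t) \<partial>lborel) = 0"
    using LIMSEQ_unique by fastforce
qed

text \<open>A primitive on [a, b] is one on every subinterval. So the integral of q over the zero
  set of p vanishes on all subintervals, which forces q to vanish almost everywhere on that
  set.\<close>

lemma primitive_on_AE_zero_set:
  assumes "primitive_on a b p q" "a \<le> b"
  shows "AE t in lborel. t \<in> {a..b} \<longrightarrow> p t = 0 \<longrightarrow> q t = 0"
proof -
  let ?h = "\<lambda>t. q t * indicator {a..b} t * indicator {0} (p t)"
  have "AE t in lborel. ?h t = 0"
  proof (rule AE_zero_if_box_integrals_zero)
    show "integrable lborel ?h"
    proof (rule Bochner_Integration.integrable_bound)
      show "integrable lborel (\<lambda>t. q t * indicator {a..b} t)" using primitive_on_integrable[OF assms(1), of a b] by simp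
      show "?h \<in> borel_measurable lborel" using primitive_on_integral_zero_set(2)[OF assms] .
    qed (auto split: split_indicator)
    fix c d :: real
    show "(\<integral>t. ?h t * indicator (box c d) t \<partial>lborel) = 0"
    proof (cases "max a c \<le> min b d")
      case True
      have prim: "primitive_on (max a c) (min b d) p q"
        by (rule primitive_on_subinterval[OF assms(1)]) auto
      have "(\<integral>t. ?h t * indicator (box c d) t \<partial>lborel)
        = (\<integral>t. q t * indicator {max a c..min b d} t * indicator {0} (p t) \<partial>lborel)"
      proof (rule integral_cong_AE)
        show "(\<lambda>t. ?h t * indicator (box c d) t) \<in> borel_measurable lborel"
          using primitive_on_integral_zero_set(2)[OF assms] by measurable
        show "(\<lambda>t. q t * indicator {max a c..min b d} t * indicator {0} (p t)) \<in> borel_measurable lborel"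
          using primitive_on_integral_zero_set(2)[OF prim True] .
        show "AE t in lborel. ?h t * indicator (box c d) t
            = q t * indicator {max a c..min b d} t * indicator {0} (p t)"
          using AE_lborel_singleton[of c] AE_lborel_singleton[of d]
          by eventually_elim (auto split: split_indicator)
      qed
      then show ?thesis using primitive_on_integral_zero_set(1)[OF prim True] by simp
    next
      case False
      then have "(\<lambda>t. ?h t * indicator (box c d) t) = (\<lambda>_. 0)"
        by (auto split: split_indicator)
      then show ?thesis by simp
    qed
  qed
  then show ?thesis by eventually_elim (auto split: split_indicator_asm)
qed

section \<open>Equality of the squared eigenvalues on a single ray\<close>

lemma nn_integral_inverse_Ioc_infinite:
  fixes C :: real
  assumes "C > 0"
  shows "(\<integral>\<^sup>+t. ennreal (C / t) * indicator {0<..1} t \<partial>lborel) = \<infinity>"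
proof (rule ccontr)
  let ?I = "\<integral>\<^sup>+t. ennreal (C / t) * indicator {0<..1} t \<partial>lborel"
  assume "?I \<noteq> \<infinity>"
  then obtain K where K: "?I = ennreal K" "K \<ge> 0" by (cases ?I) auto
  \<comment> \<open>Chosen so that the integral of C / t from e to 1, which is - C ln e, equals K +
    1 and thus exceeds the supposed value K.\<close>
  define e where "e = exp (- (K + 1) / C)"
  have "(- K - 1) / C \<le> 0" using K assms by (simp add: divide_nonpos_pos)
  then have e: "0 < e" "e \<le> 1" by (auto simp: e_def)
  have "(\<integral>\<^sup>+t. ennreal (C / t) * indicator {e..1} t \<partial>lborel) = ennreal (C * ln 1 - C * ln e)"
  proof (rule nn_integral_FTC_Icc)
    show "((\<lambda>t. C * ln t) has_real_derivative C / t) (at t)" if "t \<in> {e..1}" for t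
      using that e by (auto intro!: derivative_eq_intros)
    show "0 \<le> C / t" if "t \<in> {e..1}" for t using that e assms by auto
  qed (use e in auto)
  also have "C * ln 1 - C * ln e = K + 1" using assms by (simp add: e_def)
  finally have "ennreal (K + 1) = (\<integral>\<^sup>+t. ennreal (C / t) * indicator {e..1} t \<partial>lborel)" by simp
  also have "\<dots> \<le> ?I"
    using e by (intro nn_integral_mono) (auto split: split_indicator)
  finally show False using K by simp
qed

text \<open>The rays \<open>t \<mapsto> t x\<close> through a given \<open>x\<close>: \<open>l\<close> and \<open>m\<close> are the tangential and the radial
  eigenvalue of the Hessian at \<open>t x\<close>, so that \<open>t l\<close> is a primitive of \<open>m\<close>.\<close>

lemma eigenvalue_squares_eq_on_ray:
  fixes l m l' m' :: "real \<Rightarrow> real"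
  assumes prim: "\<And>n. \<exists>p. primitive_on (1 / real (n + 2)) 1 p m
        \<and> (AE t in lborel. t \<in> {1 / real (n + 2)..1} \<longrightarrow> t * l t = p t)"
    and prim': "\<And>n. \<exists>p. primitive_on (1 / real (n + 2)) 1 p m'
        \<and> (AE t in lborel. t \<in> {1 / real (n + 2)..1} \<longrightarrow> t * l' t = p t)"
    and det: "AE t in lborel. t \<in> {0<..1} \<longrightarrow> l t * m t = l' t * m' t"
    and [measurable]: "l \<in> borel_measurable borel" "l' \<in> borel_measurable borel"
    and fin: "(\<integral>\<^sup>+t. ennreal (t * (l t)\<^sup>2) * indicator {0<..1} t \<partial>lborel) < \<infinity>"
    and fin': "(\<integral>\<^sup>+t. ennreal (t * (l' t)\<^sup>2) * indicator {0<..1} t \<partial>lborel) < \<infinity>"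
  shows "AE t in lborel. t \<in> {0<..1} \<longrightarrow> (l t)\<^sup>2 = (l' t)\<^sup>2 \<and> (m t)\<^sup>2 = (m' t)\<^sup>2"
proof -
  \<comment> \<open>The primitives are available only away from 0. The offset 2 makes even
    \<open>J 0\<close> an interval of positive length, on which the constants for different n are
    compared.\<close>
  define J where "J = (\<lambda>n::nat. {1 / real (n + 2)..1})"
  have J_sub: "J n \<subseteq> {0<..1}" for n
  proof
    fix t assume "t \<in> J n"
    moreover have "0 < 1 / real (n + 2)" by simp
    ultimately show "t \<in> {0<..1}" unfolding J_def atLeastAtMost_iff greaterThanAtMost_iff by linarith
  qed
  have "\<exists>C. AE t in lborel. t \<in> J n \<longrightarrow> t\<^sup>2 * ((l t)\<^sup>2 - (l' t)\<^sup>2) = C" for n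
  proof -
    let ?a = "1 / real (n + 2)"
    obtain p where p: "primitive_on ?a 1 p m" "AE t in lborel. t \<in> J n \<longrightarrow> t * l t = p t"
      using prim[of n] unfolding J_def by blast
    obtain p' where p': "primitive_on ?a 1 p' m'" "AE t in lborel. t \<in> J n \<longrightarrow> t * l' t = p' t"
      using prim'[of n] unfolding J_def by blast
    define d where "d = (\<lambda>t. p t * p t + (- 1) * (p' t * p' t))"
    \<comment> \<open>The derivative of d literally as the sum and product rules deliver it; the
      last summand comes from differentiating the constant factor -1.\<close>
    define D where "D = (\<lambda>t. (p t * m t + m t * p t) + ((- 1) * (p' t * m' t + m' t * p' t) + 0 * (p' t * p' t)))"
    have d: "primitive_on ?a 1 d D"
      unfolding d_def D_def
      by (intro primitive_on_add primitive_on_mult primitive_on_const p(1) p'(1))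
    have D0: "AE t in lborel. t \<in> J n \<longrightarrow> D t = 0"
      using p(2) p'(2) det
    proof eventually_elim
      case (elim t)
      show ?case
      proof
        assume t: "t \<in> J n"
        then have "t * l t = p t" "t * l' t = p' t" "l t * m t = l' t * m' t" using elim J_sub by blast+
        then have "p t * m t = p' t * m' t" by (metis mult.assoc)
        then show "D t = 0" by (simp add: D_def mult.commute)
      qed
    qed
    have d_const: "d t = d ?a" if t: "t \<in> J n" for t
    proof -
      have "(\<integral>s. D s * indicator {?a..t} s \<partial>lborel) = (\<integral>(s::real). 0 \<partial>lborel)"
      proof (rule integral_cong_AE)
        show "(\<lambda>s. D s * indicator {?a..t} s) \<in> borel_measurable lborel"
          using primitive_on_integrable[OF d, of ?a t] t by (simp add: J_def)
        show "AE s in lborel. D s * indicator {?a..t} s = 0"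
          using D0 by eventually_elim (use t in \<open>auto simp: J_def split: split_indicator\<close>)
      qed simp
      then show ?thesis using primitive_on_eq[OF d, of t] t by (simp add: J_def)
    qed
    have "AE t in lborel. t \<in> J n \<longrightarrow> t\<^sup>2 * ((l t)\<^sup>2 - (l' t)\<^sup>2) = d ?a"
      using p(2) p'(2)
    proof eventually_elim
      case (elim t)
      show ?case
      proof
        assume t: "t \<in> J n"
        then have "t * l t = p t" "t * l' t = p' t" using elim by blast+
        then have "t\<^sup>2 * ((l t)\<^sup>2 - (l' t)\<^sup>2) = d t"
          by (simp add: d_def power2_eq_square algebra_simps flip: \<open>t * l t = p t\<close> \<open>t * l' t = p' t\<close>)
        then show "t\<^sup>2 * ((l t)\<^sup>2 - (l' t)\<^sup>2) = d ?a" using d_const[OF t] by simp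
      qed
    qed
    then show ?thesis by blast
  qed
  then obtain C where C: "\<And>n. AE t in lborel. t \<in> J n \<longrightarrow> t\<^sup>2 * ((l t)\<^sup>2 - (l' t)\<^sup>2) = C n"
    by metis
  \<comment> \<open>\<open>J 0\<close> lies in every \<open>J n\<close>. If the constants differed,
    the two almost everywhere identities would contradict each other on a set of positive
    measure.\<close>
  have C0: "C n = C 0" for n
  proof (rule ccontr)
    assume ne: "C n \<noteq> C 0"
    have "AE t in lborel. t \<notin> J 0"
      using C[of n] C[of 0]
    proof eventually_elim
      case (elim t)
      have "J 0 \<subseteq> J n" by (simp add: J_def field_simps)
      then show ?case using elim ne by auto
    qed
    then have "emeasure lborel (J 0) = 0"
      by (subst (asm) AE_iff_measurable[where N="J 0"]) (auto simp: J_def)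
    then show False by (simp add: J_def)
  qed
  have ae_all: "AE t in lborel. t \<in> {0<..1} \<longrightarrow> P t" if "\<And>n. AE t in lborel. t \<in> J n \<longrightarrow> P t" for P
  proof -
    have "AE t in lborel. \<forall>n. t \<in> J n \<longrightarrow> P t"
      using that by (subst AE_all_countable) blast
    then show ?thesis
    proof eventually_elim
      case (elim t)
      show ?case
      proof
        assume t: "t \<in> {0<..1}"
        then obtain n where "inverse (real (Suc n)) < t" using reals_Archimedean[of t] by auto
        moreover have "1 / real (n + 2) \<le> inverse (real (Suc n))" by (simp add: field_simps)
        ultimately have "t \<in> J n" using t by (simp add: J_def)
        then show "P t" using elim by blast
      qed
    qed
  qed
  have CC: "AE t in lborel. t \<in> {0<..1} \<longrightarrow> t\<^sup>2 * ((l t)\<^sup>2 - (l' t)\<^sup>2) = C 0"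
    by (rule ae_all) (use C C0 in metis)
  have C_zero: "C 0 = 0"
  proof (rule ccontr)
    assume "C 0 \<noteq> 0"
    then have "\<infinity> = (\<integral>\<^sup>+t. ennreal (\<bar>C 0\<bar> / t) * indicator {0<..1} t \<partial>lborel)"
      by (intro nn_integral_inverse_Ioc_infinite[symmetric]) simp
    also have "(\<integral>\<^sup>+t. ennreal (\<bar>C 0\<bar> / t) * indicator {0<..1} t \<partial>lborel)
      \<le> (\<integral>\<^sup>+t. ennreal (t * (l t)\<^sup>2) * indicator {0<..1} t + ennreal (t * (l' t)\<^sup>2) * indicator {0<..1} t \<partial>lborel)"
    proof (rule nn_integral_mono_AE)
      show "AE t in lborel. ennreal (\<bar>C 0\<bar> / t) * indicator {0<..1} t
        \<le> ennreal (t * (l t)\<^sup>2) * indicator {0<..1} t + ennreal (t * (l' t)\<^sup>2) * indicator {0<..1} t"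
        using CC
      proof eventually_elim
        case (elim t)
        show ?case
        proof (cases "t \<in> {0<..1}")
          case True
          then have "\<bar>C 0\<bar> / t = \<bar>t\<^sup>2 * ((l t)\<^sup>2 - (l' t)\<^sup>2)\<bar> / t" using elim by simp
          also have "\<dots> = t * \<bar>(l t)\<^sup>2 - (l' t)\<^sup>2\<bar>"
            using True by (simp add: abs_mult power2_eq_square)
          also have "\<dots> \<le> t * ((l t)\<^sup>2 + (l' t)\<^sup>2)"
            using True by (intro mult_left_mono) (auto simp: abs_le_iff)
          finally have "ennreal (\<bar>C 0\<bar> / t) \<le> ennreal (t * (l t)\<^sup>2 + t * (l' t)\<^sup>2)"
            by (intro ennreal_leI) (simp add: algebra_simps)
          then show ?thesis using True by (simp add: ennreal_plus)
        qed simp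
      qed
    qed
    also have "\<dots> = (\<integral>\<^sup>+t. ennreal (t * (l t)\<^sup>2) * indicator {0<..1} t \<partial>lborel)
        + (\<integral>\<^sup>+t. ennreal (t * (l' t)\<^sup>2) * indicator {0<..1} t \<partial>lborel)"
      by (rule nn_integral_add) measurable
    finally show False using fin fin' by (auto simp: top_unique)
  qed
  have l: "AE t in lborel. t \<in> {0<..1} \<longrightarrow> (l t)\<^sup>2 = (l' t)\<^sup>2"
    using CC by eventually_elim (auto simp: C_zero)
  have zero: "AE t in lborel. t \<in> {0<..1} \<longrightarrow> l t = 0 \<longrightarrow> m t = 0"
    if prim: "\<And>n. \<exists>p. primitive_on (1 / real (n + 2)) 1 p m
        \<and> (AE t in lborel. t \<in> {1 / real (n + 2)..1} \<longrightarrow> t * l t = p t)" for l m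
  proof (rule ae_all)
    fix n
    obtain p where p: "primitive_on (1 / real (n + 2)) 1 p m" "AE t in lborel. t \<in> J n \<longrightarrow> t * l t = p t"
      using prim[of n] unfolding J_def by blast
    have "AE t in lborel. t \<in> J n \<longrightarrow> p t = 0 \<longrightarrow> m t = 0"
      unfolding J_def by (rule primitive_on_AE_zero_set[OF p(1)]) simp
    with p(2) show "AE t in lborel. t \<in> J n \<longrightarrow> l t = 0 \<longrightarrow> m t = 0"
      by eventually_elim auto
  qed
  show ?thesis
    using l zero[OF prim] zero[OF prim'] det
  proof eventually_elim
    case (elim t)
    show ?case
    proof
      assume t: "t \<in> {0<..1}"
      then have eq: "(l t)\<^sup>2 = (l' t)\<^sup>2" using elim by blast
      moreover have "(m t)\<^sup>2 = (m' t)\<^sup>2"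
      proof (cases "l t = 0")
        case True
        then show ?thesis using elim t eq by simp
      next
        case False
        have "(l t)\<^sup>2 * (m t)\<^sup>2 = (l t)\<^sup>2 * (m' t)\<^sup>2"
          using elim t eq by (metis power_mult_distrib)
        then show ?thesis using False by simp
      qed
      ultimately show "(l t)\<^sup>2 = (l' t)\<^sup>2 \<and> (m t)\<^sup>2 = (m' t)\<^sup>2" by blast
    qed
  qed
qed

section \<open>Hessians of radial functions\<close>

text \<open>Radial symmetry enters only as invariance under each single rotation, with its own null
  set. The i-th row of the Hessian is represented as the weak gradient of the i-th component of the
  gradient.\<close>

locale radial_weak_hessian =
  fixes U G1 G2 H11 H12 H21 H22 :: "real ^ 2 \<Rightarrow> real"
  assumes integrable_U: "integrable lborel U"
    and invariant: "\<And>s. AE x in lborel. U (rotation s x) = U x"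
    and gradient1: "\<And>a b. test_pair a b \<Longrightarrow>
      (\<integral>x. U x * tensor (deriv a) b x \<partial>lborel) = - (\<integral>x. G1 x * tensor a b x \<partial>lborel)"
    and gradient2: "\<And>a b. test_pair a b \<Longrightarrow>
      (\<integral>x. U x * tensor a (deriv b) x \<partial>lborel) = - (\<integral>x. G2 x * tensor a b x \<partial>lborel)"
    and hessian1: "weak_radial_derivative G1 H11 H12"
    and hessian2: "weak_radial_derivative G2 H21 H22"
begin

sublocale D1: weak_radial_derivative G1 H11 H12 by (rule hessian1)
sublocale D2: weak_radial_derivative G2 H21 H22 by (rule hessian2)

lemma hessian_symmetric: "AE x in lborel. x \<in> unit_disk \<longrightarrow> H12 x - H21 x = 0"
proof (rule AE_zero_if_tensor_integrals_zero)
  show "integrable lborel (\<lambda>x. H12 x - H21 x)" using D1.integrable D2.integrable by simp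
  fix a b assume ab: "test_pair a b"
  have "(\<integral>x. H12 x * tensor a b x \<partial>lborel) = (\<integral>x. U x * tensor (deriv a) (deriv b) x \<partial>lborel)"
    using D1.weak2[OF ab] gradient1[OF test_pair_deriv2[OF ab]] by simp
  moreover have "(\<integral>x. H21 x * tensor a b x \<partial>lborel) = (\<integral>x. U x * tensor (deriv a) (deriv b) x \<partial>lborel)"
    using D2.weak1[OF ab] gradient2[OF test_pair_deriv1[OF ab]] by simp
  ultimately show "(\<integral>x. (H12 x - H21 x) * tensor a b x \<partial>lborel) = 0"
    using integrable_mult_tensor[OF D1.integrable(3) ab] integrable_mult_tensor[OF D2.integrable(2) ab]
    by (simp add: left_diff_distrib)
qed

text \<open>Multiplication by one coordinate commutes with the derivative in the other, so
  integrating by parts leaves, up to sign, U against \<open>angular_deriv\<close>. Outside the disk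
  both gradient components are 0 by convention, hence the identity on the whole plane.\<close>

lemma gradient_radial: "AE x in lborel. x $ 1 * G2 x - x $ 2 * G1 x = 0"
proof -
  have "AE x in lborel. x \<in> unit_disk \<longrightarrow> x $ 1 * G2 x - x $ 2 * G1 x = 0"
  proof (rule AE_zero_if_tensor_integrals_zero)
    show "integrable lborel (\<lambda>x. x $ 1 * G2 x - x $ 2 * G1 x)"
      using D1.integrable D2.integrable D1.outside D2.outside
      by (intro Bochner_Integration.integrable_diff integrable_coordinate) auto
    fix a b assume ab: "test_pair a b"
    note t1 = test_pair_mult_id1[OF ab] and t2 = test_pair_mult_id2[OF ab]
    have eq: "(x $ 1 * G2 x - x $ 2 * G1 x) * tensor a b x
        = G2 x * tensor (\<lambda>t. t * a t) b x - G1 x * tensor a (\<lambda>t. t * b t) x" for x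
      by (simp add: tensor_def algebra_simps)
    have "0 = (\<integral>x. U x * angular_deriv a b x \<partial>lborel)"
      using angular_deriv_weakly_zero[OF integrable_U invariant ab] by simp
    also have "\<dots> = (\<integral>x. U x * tensor (\<lambda>t. t * a t) (deriv b) x \<partial>lborel)
        - (\<integral>x. U x * tensor (deriv a) (\<lambda>t. t * b t) x \<partial>lborel)"
      using integrable_mult_tensor[OF integrable_U test_pair_deriv2[OF t1]]
        integrable_mult_tensor[OF integrable_U test_pair_deriv1[OF t2]]
      by (simp add: angular_deriv_def right_diff_distrib)
    finally show "(\<integral>x. (x $ 1 * G2 x - x $ 2 * G1 x) * tensor a b x \<partial>lborel) = 0"
      unfolding eq
      using gradient2[OF t1] gradient1[OF t2]
        integrable_mult_tensor[OF D2.integrable(1) t1] integrable_mult_tensor[OF D1.integrable(1) t2]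
      by simp
  qed
  then show ?thesis
    by eventually_elim (use D1.outside D2.outside in fastforce)
qed

lemma angular_integral_zero:
  assumes "test_pair a b"
  shows "(\<integral>x. G2 x * tensor (\<lambda>t. t * a t) b x \<partial>lborel) = (\<integral>x. G1 x * tensor a (\<lambda>t. t * b t) x \<partial>lborel)"
proof (rule integral_cong_AE)
  show "AE x in lborel. G2 x * tensor (\<lambda>t. t * a t) b x = G1 x * tensor a (\<lambda>t. t * b t) x"
    using gradient_radial
  proof eventually_elim
    case (elim x)
    then have "x $ 1 * G2 x * tensor a b x = x $ 2 * G1 x * tensor a b x" by simp
    then show ?case by (simp add: tensor_def ac_simps)
  qed
qed (use integrable_mult_tensor[OF D2.integrable(1) test_pair_mult_id1[OF assms]]
    integrable_mult_tensor[OF D1.integrable(1) test_pair_mult_id2[OF assms]] in auto)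

lemma deriv_mult_id_tensor:
  assumes "test_pair a b"
  shows "tensor (\<lambda>t. t * deriv a t) b x = tensor (deriv (\<lambda>t. t * a t)) b x - tensor a b x"
    "tensor a (\<lambda>t. t * deriv b t) x = tensor a (deriv (\<lambda>t. t * b t)) x - tensor a b x"
  using test_pair_smooth[OF assms] by (simp_all add: tensor_def deriv_mult_id algebra_simps)

text \<open>This is the weak x1-derivative of \<open>gradient_radial\<close>; the term G2 comes from
  differentiating the factor x1. Together with the x2-derivative and the symmetry of the Hessian it
  says that the Hessian maps the tangential vector (-x2, x1) to (-G2, G1), which is parallel to it
  because the gradient is parallel to x.\<close>

lemma tangential_eigenvector1:
  "AE x in lborel. x \<in> unit_disk \<longrightarrow> x $ 1 * H21 x - x $ 2 * H11 x + G2 x = 0"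
proof (rule AE_zero_if_tensor_integrals_zero)
  show "integrable lborel (\<lambda>x. x $ 1 * H21 x - x $ 2 * H11 x + G2 x)"
    using D1.integrable D2.integrable D1.outside D2.outside
    by (intro Bochner_Integration.integrable_diff Bochner_Integration.integrable_add integrable_coordinate) auto
  fix a b assume ab: "test_pair a b"
  note t1 = test_pair_mult_id1[OF ab] and t2 = test_pair_mult_id2[OF ab]
  have eq: "(x $ 1 * H21 x - x $ 2 * H11 x + G2 x) * tensor a b x
      = H21 x * tensor (\<lambda>t. t * a t) b x - H11 x * tensor a (\<lambda>t. t * b t) x + G2 x * tensor a b x" for x
    by (simp add: tensor_def algebra_simps)
  have "(\<integral>x. G2 x * tensor (\<lambda>t. t * deriv a t) b x \<partial>lborel)
      = (\<integral>x. G2 x * tensor (deriv (\<lambda>t. t * a t)) b x \<partial>lborel) - (\<integral>x. G2 x * tensor a b x \<partial>lborel)"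
    using integrable_mult_tensor[OF D2.integrable(1) test_pair_deriv1[OF t1]]
      integrable_mult_tensor[OF D2.integrable(1) ab]
    by (simp add: deriv_mult_id_tensor[OF ab] right_diff_distrib)
  then show "(\<integral>x. (x $ 1 * H21 x - x $ 2 * H11 x + G2 x) * tensor a b x \<partial>lborel) = 0"
    unfolding eq
    using angular_integral_zero[OF test_pair_deriv1[OF ab]] D2.weak1[OF t1] D1.weak1[OF t2]
      integrable_mult_tensor[OF D2.integrable(2) t1] integrable_mult_tensor[OF D1.integrable(2) t2]
      integrable_mult_tensor[OF D2.integrable(1) ab]
    by simp
qed

text \<open>The weak x2-derivative of \<open>gradient_radial\<close>, where now the factor x2
  contributes the term in G1.\<close>

lemma tangential_eigenvector2:
  "AE x in lborel. x \<in> unit_disk \<longrightarrow> x $ 1 * H22 x - x $ 2 * H12 x - G1 x = 0"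
proof (rule AE_zero_if_tensor_integrals_zero)
  show "integrable lborel (\<lambda>x. x $ 1 * H22 x - x $ 2 * H12 x - G1 x)"
    using D1.integrable D2.integrable D1.outside D2.outside
    by (intro Bochner_Integration.integrable_diff integrable_coordinate) auto
  fix a b assume ab: "test_pair a b"
  note t1 = test_pair_mult_id1[OF ab] and t2 = test_pair_mult_id2[OF ab]
  have eq: "(x $ 1 * H22 x - x $ 2 * H12 x - G1 x) * tensor a b x
      = H22 x * tensor (\<lambda>t. t * a t) b x - H12 x * tensor a (\<lambda>t. t * b t) x - G1 x * tensor a b x" for x
    by (simp add: tensor_def algebra_simps)
  have "(\<integral>x. G1 x * tensor a (\<lambda>t. t * deriv b t) x \<partial>lborel)
      = (\<integral>x. G1 x * tensor a (deriv (\<lambda>t. t * b t)) x \<partial>lborel) - (\<integral>x. G1 x * tensor a b x \<partial>lborel)"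
    using integrable_mult_tensor[OF D1.integrable(1) test_pair_deriv2[OF t2]]
      integrable_mult_tensor[OF D1.integrable(1) ab]
    by (simp add: deriv_mult_id_tensor[OF ab] right_diff_distrib)
  then show "(\<integral>x. (x $ 1 * H22 x - x $ 2 * H12 x - G1 x) * tensor a b x \<partial>lborel) = 0"
    unfolding eq
    using angular_integral_zero[OF test_pair_deriv2[OF ab]] D2.weak2[OF t1] D1.weak2[OF t2]
      integrable_mult_tensor[OF D2.integrable(3) t1] integrable_mult_tensor[OF D1.integrable(3) t2]
      integrable_mult_tensor[OF D1.integrable(1) ab]
    by simp
qed

text \<open>The gradient is the tangential eigenvalue times x, and the Hessian applied to x is the
  radial eigenvalue times x; \<open>D1.radial_deriv\<close> is the first component of the latter.
  Both eigenvalues are thus ratios of first components, meaningful off the null line x1 = 0, where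
  division by zero yields 0.\<close>

definition tangential :: "real ^ 2 \<Rightarrow> real" where "tangential x = G1 x / x $ 1"
definition radial :: "real ^ 2 \<Rightarrow> real" where "radial x = D1.radial_deriv x / x $ 1"

lemma AE_first_coordinate_nonzero: "AE x in lborel. (x :: real ^ 2) $ 1 \<noteq> 0"
proof -
  have "negligible {x :: real ^ 2. x $ 1 = 0}" by (rule negligible_standard_hyperplane_cart)
  then have "AE x in lebesgue. x \<notin> {x :: real ^ 2. x $ 1 = 0}"
    unfolding negligible_iff_null_sets by (rule AE_not_in)
  then show ?thesis by (simp add: AE_completion_iff)
qed

text \<open>With k = x2 / x1 the eigenvector equations give the Hessian as l times the identity plus
  d times the rank one matrix of the vector (1, k). So the eigenvalues are l and l + (1 + k^2) d,
  and determinant and squared norm follow by expansion.\<close>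

lemma hessian_eigenvalues:
  "AE x in lborel. x \<in> unit_disk \<longrightarrow>
    H11 x * H22 x - H12 x * H21 x = tangential x * radial x
    \<and> (H11 x)\<^sup>2 + (H12 x)\<^sup>2 + ((H21 x)\<^sup>2 + (H22 x)\<^sup>2) = (tangential x)\<^sup>2 + (radial x)\<^sup>2"
  using hessian_symmetric gradient_radial tangential_eigenvector1 tangential_eigenvector2
    AE_first_coordinate_nonzero
proof eventually_elim
  case (elim x)
  show ?case
  proof
    assume "x \<in> unit_disk"
    with elim have e: "H21 x = H12 x" "x $ 1 * G2 x - x $ 2 * G1 x = 0"
      "x $ 1 * H21 x - x $ 2 * H11 x + G2 x = 0" "x $ 1 * H22 x - x $ 2 * H12 x - G1 x = 0" "x $ 1 \<noteq> 0"
      by auto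
    define k l d where "k = x $ 2 / x $ 1" and "l = tangential x" and "d = H11 x - tangential x"
    have x2: "x $ 2 = k * x $ 1" using e(5) by (simp add: k_def)
    have G1: "G1 x = l * x $ 1" using e(5) by (simp add: l_def tangential_def)
    have G2: "G2 x = l * k * x $ 1"
    proof -
      have "x $ 1 * G2 x = x $ 1 * (l * k * x $ 1)" using e(2) by (simp add: G1 x2 algebra_simps)
      then show ?thesis using e(5) by simp
    qed
    have H11: "H11 x = l + d" by (simp add: d_def l_def)
    have H12: "H12 x = k * d"
    proof -
      have "x $ 1 * H12 x = x $ 1 * (k * d)"
        using e(3) by (simp add: e(1) x2 G2 H11 algebra_simps)
      then show ?thesis using e(5) by simp
    qed
    have H22: "H22 x = l + k\<^sup>2 * d"
    proof -
      have "x $ 1 * H22 x = x $ 1 * (l + k\<^sup>2 * d)"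
        using e(4) by (simp add: x2 G1 H12 power2_eq_square algebra_simps)
      then show ?thesis using e(5) by simp
    qed
    have r: "radial x = l + (1 + k\<^sup>2) * d"
      using e(5) by (simp add: radial_def D1.radial_deriv_def H11 H12 x2 field_simps power2_eq_square)
    show "H11 x * H22 x - H12 x * H21 x = tangential x * radial x
      \<and> (H11 x)\<^sup>2 + (H12 x)\<^sup>2 + ((H21 x)\<^sup>2 + (H22 x)\<^sup>2) = (tangential x)\<^sup>2 + (radial x)\<^sup>2"
      unfolding e(1) r H11 H12 H22 l_def[symmetric] by (simp add: power2_eq_square algebra_simps)
  qed
qed

lemma tangential_outside: "x \<notin> unit_disk \<Longrightarrow> tangential x = 0"
  using D1.outside by (simp add: tangential_def)

lemma tangential_measurable [measurable]: "tangential \<in> borel_measurable borel"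
  using borel_measurable_integrable[OF D1.integrable(1)] unfolding tangential_def[abs_def] by measurable

lemma radial_measurable [measurable]: "radial \<in> borel_measurable borel"
  using borel_measurable_integrable[OF D1.integrable_radial_deriv] unfolding radial_def[abs_def] by measurable

text \<open>\<open>radial_increment\<close> has a null set of points x for each upper radius t;
  Fubini exchanges the quantifiers, so for almost every x it holds for almost every t. This is why p
  is a separate function, defined as the integral and equal to t times the tangential eigenvalue
  only almost everywhere. Dividing by x1, a constant on the ray, turns G1 at t x into t
  \<open>tangential\<close> and the integrand into \<open>radial\<close>.\<close>

lemma primitive_on_rays:
  "AE x in lborel. x \<in> unit_disk \<longrightarrow> (\<forall>n. \<exists>p. primitive_on (1 / real (n + 2)) 1 p (\<lambda>t. radial (t *\<^sub>R x))
    \<and> (AE t in lborel. t \<in> {1 / real (n + 2)..1} \<longrightarrow> t * tangential (t *\<^sub>R x) = p t))"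
proof -
  have "AE x in lborel. x \<in> unit_disk \<longrightarrow> (\<exists>p. primitive_on (1 / real (n + 2)) 1 p (\<lambda>t. radial (t *\<^sub>R x))
    \<and> (AE t in lborel. t \<in> {1 / real (n + 2)..1} \<longrightarrow> t * tangential (t *\<^sub>R x) = p t))" for n
  proof -
    define \<sigma> where "\<sigma> = 1 / real (n + 2)"
    have \<sigma>: "0 < \<sigma>" "\<sigma> \<le> 1" by (auto simp: \<sigma>_def)
    note [measurable] = borel_measurable_integrable[OF D1.integrable(1)] borel_measurable_integrable[OF D1.integrable_radial_deriv]
    have dil: "integrable (lborel \<Otimes>\<^sub>M lborel) (\<lambda>(s, x). D1.radial_deriv (s *\<^sub>R x) / s * indicator {\<sigma>..1} s)"
      using D1.integrable_radial_deriv \<sigma>(1) by (rule integrable_dilations)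
    have int: "AE x in lborel. integrable lborel (\<lambda>s. D1.radial_deriv (s *\<^sub>R x) / s * indicator {\<sigma>..1} s)"
    proof -
      have "integrable (lborel \<Otimes>\<^sub>M lborel) (\<lambda>(x, s). D1.radial_deriv (s *\<^sub>R x) / s * indicator {\<sigma>..1} s)"
        using lborel_pair.integrable_product_swap[OF dil] by (simp add: case_prod_unfold)
      from lborel_pair.AE_integrable_fst'[OF this] show ?thesis by simp
    qed
    have "AE t in lborel. AE x in lborel. t \<in> {\<sigma>..1} \<and> x \<in> unit_disk \<longrightarrow>
      G1 (t *\<^sub>R x) - G1 (\<sigma> *\<^sub>R x) = (\<integral>s. D1.radial_deriv (s *\<^sub>R x) / s * indicator {\<sigma>..t} s \<partial>lborel)"
    proof (rule AE_I2)
      fix t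
      show "AE x in lborel. t \<in> {\<sigma>..1} \<and> x \<in> unit_disk \<longrightarrow>
        G1 (t *\<^sub>R x) - G1 (\<sigma> *\<^sub>R x) = (\<integral>s. D1.radial_deriv (s *\<^sub>R x) / s * indicator {\<sigma>..t} s \<partial>lborel)"
        using D1.radial_increment[OF \<sigma>(1), of t] by (cases "t \<in> {\<sigma>..1}") auto
    qed
    then have "AE x in lborel. AE t in lborel. t \<in> {\<sigma>..1} \<and> x \<in> unit_disk \<longrightarrow>
      G1 (t *\<^sub>R x) - G1 (\<sigma> *\<^sub>R x) = (\<integral>s. D1.radial_deriv (s *\<^sub>R x) / s * indicator {\<sigma>..t} s \<partial>lborel)"
    proof (subst (asm) lborel_pair.AE_commute)
      have [measurable]: "(\<lambda>p. \<integral>s. D1.radial_deriv (s *\<^sub>R snd p) / s * indicator {\<sigma>..fst p} s \<partial>lborel)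
        \<in> borel_measurable (lborel \<Otimes>\<^sub>M lborel)"
      proof (rule lborel.borel_measurable_lebesgue_integral)
        \<comment> \<open>The upper end of the interval is itself a variable here, and the
          conditional form exposes joint measurability.\<close>
        have ind: "indicator {\<sigma>..t} s = (if \<sigma> \<le> s \<and> s \<le> t then 1 else (0 :: real))" for t s
          by (auto split: split_indicator)
        show "(\<lambda>(p, s). D1.radial_deriv (s *\<^sub>R snd p) / s * indicator {\<sigma>..fst p} s)
          \<in> borel_measurable ((lborel \<Otimes>\<^sub>M lborel) \<Otimes>\<^sub>M lborel)"
          unfolding ind by measurable
      qed
      have [measurable]: "unit_disk \<in> sets borel" by simp
      show "{p \<in> space (lborel \<Otimes>\<^sub>M lborel). fst p \<in> {\<sigma>..1} \<and> snd p \<in> unit_disk \<longrightarrow>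
        G1 (fst p *\<^sub>R snd p) - G1 (\<sigma> *\<^sub>R snd p)
          = (\<integral>s. D1.radial_deriv (s *\<^sub>R snd p) / s * indicator {\<sigma>..fst p} s \<partial>lborel)} \<in> sets (lborel \<Otimes>\<^sub>M lborel)"
        by measurable
    qed simp
    with int AE_first_coordinate_nonzero show ?thesis
    proof eventually_elim
      case (elim x)
      show ?case
        unfolding \<sigma>_def[symmetric]
      proof
        assume x: "x \<in> unit_disk"
        define p where "p = (\<lambda>t. (G1 (\<sigma> *\<^sub>R x) + (\<integral>s. D1.radial_deriv (s *\<^sub>R x) / s * indicator {\<sigma>..t} s \<partial>lborel)) / x $ 1)"
        have eq: "radial (s *\<^sub>R x) = D1.radial_deriv (s *\<^sub>R x) / s / x $ 1" for s
          by (simp add: radial_def)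
        have "primitive_on \<sigma> 1 p (\<lambda>t. radial (t *\<^sub>R x))"
        proof (rule primitive_onI)
          have mv: "(\<lambda>t. radial (t *\<^sub>R x) * indicator {\<sigma>..t'} t) = (\<lambda>t. D1.radial_deriv (t *\<^sub>R x) / t * indicator {\<sigma>..t'} t / x $ 1)" for t'
            unfolding eq by (simp add: divide_inverse ac_simps)
          show "integrable lborel (\<lambda>t. radial (t *\<^sub>R x) * indicator {\<sigma>..1} t)"
            unfolding mv using elim(1) by (intro integrable_divide_zero impI)
          fix t assume "t \<in> {\<sigma>..1}"
          have "(\<integral>s. D1.radial_deriv (s *\<^sub>R x) / s * indicator {\<sigma>..\<sigma>} s \<partial>lborel) = (\<integral>(s::real). 0 \<partial>lborel)"
          proof (rule integral_cong_AE)
            show "AE s in lborel. D1.radial_deriv (s *\<^sub>R x) / s * indicator {\<sigma>..\<sigma>} s = 0"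
              using AE_lborel_singleton[of \<sigma>] by eventually_elim (auto split: split_indicator)
          qed measurable
          then show "p t = p \<sigma> + (\<integral>s. radial (s *\<^sub>R x) * indicator {\<sigma>..t} s \<partial>lborel)"
            unfolding mv integral_divide_zero by (simp only: p_def add_divide_distrib Bochner_Integration.integral_zero div_0 add_0_right)
        qed
        moreover have "AE t in lborel. t \<in> {\<sigma>..1} \<longrightarrow> t * tangential (t *\<^sub>R x) = p t"
          using elim(3)
        proof eventually_elim
          case (elim t)
          show ?case
          proof
            assume t: "t \<in> {\<sigma>..1}"
            then have "t * tangential (t *\<^sub>R x) = G1 (t *\<^sub>R x) / x $ 1" using \<sigma> by (simp add: tangential_def)
            also have "G1 (t *\<^sub>R x) = G1 (\<sigma> *\<^sub>R x) + (\<integral>s. D1.radial_deriv (s *\<^sub>R x) / s * indicator {\<sigma>..t} s \<partial>lborel)"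
              using elim t x by simp
            finally show "t * tangential (t *\<^sub>R x) = p t" by (simp add: p_def)
          qed
        qed
        ultimately show "\<exists>p. primitive_on \<sigma> 1 p (\<lambda>t. radial (t *\<^sub>R x))
          \<and> (AE t in lborel. t \<in> {\<sigma>..1} \<longrightarrow> t * tangential (t *\<^sub>R x) = p t)" by blast
      qed
    qed
  qed
  then have "AE x in lborel. \<forall>n. x \<in> unit_disk \<longrightarrow> (\<exists>p. primitive_on (1 / real (n + 2)) 1 p (\<lambda>t. radial (t *\<^sub>R x))
    \<and> (AE t in lborel. t \<in> {1 / real (n + 2)..1} \<longrightarrow> t * tangential (t *\<^sub>R x) = p t))"
    by (subst AE_all_countable) blast
  then show ?thesis by eventually_elim blast
qed

end

section \<open>Passing between the disk and almost every ray\<close>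

text \<open>For each fixed t in (0, 1] the dilation by t preserves null sets and maps the disk into
  itself. Fubini then exchanges t and x.\<close>

lemma AE_rays_if_AE_disk:
  fixes P :: "real ^ 2 \<Rightarrow> bool"
  assumes [measurable]: "Measurable.pred borel P" and P: "AE y in lborel. y \<in> unit_disk \<longrightarrow> P y"
  shows "AE x in lborel. x \<in> unit_disk \<longrightarrow> (AE t in lborel. t \<in> {0<..1} \<longrightarrow> P (t *\<^sub>R x))"
proof -
  have [measurable]: "unit_disk \<in> sets borel" by simp
  have "AE t in lborel. AE x in lborel. t \<in> {0<..1} \<and> x \<in> unit_disk \<longrightarrow> P (t *\<^sub>R x)"
  proof (rule AE_I2)
    fix t :: real
    show "AE x in lborel. t \<in> {0<..1} \<and> x \<in> unit_disk \<longrightarrow> P (t *\<^sub>R x)"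
    proof (cases "t \<in> {0<..1}")
      case True
      then have "t \<noteq> 0" by simp
      from AE_lborel_scale[OF P this] show ?thesis
      proof eventually_elim
        case (elim x)
        have "t *\<^sub>R x \<in> unit_disk" if "x \<in> unit_disk"
        proof -
          have "t * norm x \<le> 1 * norm x" using True by (intro mult_right_mono) auto
          then show ?thesis using that True by simp
        qed
        then show ?case using elim by blast
      qed
    next
      case False
      then show ?thesis by (intro AE_I2) blast
    qed
  qed
  then have "AE x in lborel. AE t in lborel. t \<in> {0<..1} \<and> x \<in> unit_disk \<longrightarrow> P (t *\<^sub>R x)"
  proof (subst (asm) lborel_pair.AE_commute)
    show "{p \<in> space (lborel \<Otimes>\<^sub>M lborel). fst p \<in> {0<..1} \<and> snd p \<in> unit_disk \<longrightarrow> P (fst p *\<^sub>R snd p)}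
      \<in> sets (lborel \<Otimes>\<^sub>M lborel)" by measurable
  qed simp
  then show ?thesis by eventually_elim auto
qed

text \<open>By Fubini, almost every t has the property P (t x) for almost every x in the disk. Every
  interval to the left of 1 contains such a t, and undoing its dilation yields P almost everywhere
  on the ball of radius t.\<close>

lemma AE_disk_if_AE_rays:
  fixes P :: "real ^ 2 \<Rightarrow> bool"
  assumes [measurable]: "Measurable.pred borel P"
    and rays: "AE x in lborel. x \<in> unit_disk \<longrightarrow> (AE t in lborel. t \<in> {0<..1} \<longrightarrow> P (t *\<^sub>R x))"
  shows "AE y in lborel. y \<in> unit_disk \<longrightarrow> P y"
proof -
  have [measurable]: "unit_disk \<in> sets borel" by simp
  have "AE x in lborel. AE t in lborel. x \<in> unit_disk \<and> t \<in> {0<..1} \<longrightarrow> P (t *\<^sub>R x)"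
    using rays by eventually_elim auto
  then have swap: "AE t in lborel. AE x in lborel. x \<in> unit_disk \<and> t \<in> {0<..1} \<longrightarrow> P (t *\<^sub>R x)"
  proof (subst (asm) lborel_pair.AE_commute)
    show "{p \<in> space (lborel \<Otimes>\<^sub>M lborel). fst p \<in> unit_disk \<and> snd p \<in> {0<..1} \<longrightarrow> P (snd p *\<^sub>R fst p)}
      \<in> sets (lborel \<Otimes>\<^sub>M lborel)" by measurable
  qed simp
  have "AE y in lborel. y \<in> ball 0 (1 - 1 / real (Suc n)) \<longrightarrow> P y" for n
  proof -
    let ?r = "1 - 1 / real (Suc n)"
    obtain t where t: "t \<in> {?r<..1}" "t > 0" and tP: "AE x in lborel. x \<in> unit_disk \<longrightarrow> P (t *\<^sub>R x)"
    proof (rule ccontr)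
      assume no: "\<not> thesis"
      have r: "0 \<le> ?r" "?r < 1" by (auto simp: field_simps)
      have "AE t in lborel. t \<notin> {?r<..1}"
        using swap
      proof eventually_elim
        case (elim t)
        show ?case
        proof
          assume t: "t \<in> {?r<..1}"
          then have "t > 0" using r(1) unfolding greaterThanAtMost_iff by linarith
          with t elim have "AE x in lborel. x \<in> unit_disk \<longrightarrow> P (t *\<^sub>R x)" by simp
          with t \<open>t > 0\<close> no that show False by blast
        qed
      qed
      then have "emeasure lborel {?r<..1} = 0"
        by (subst (asm) AE_iff_measurable[where N="{?r<..1}"]) auto
      then show False using r by simp
    qed
    have "AE y in lborel. (1 / t) *\<^sub>R y \<in> unit_disk \<longrightarrow> P (t *\<^sub>R (1 / t) *\<^sub>R y)"
      using t(2) by (intro AE_lborel_scale[OF tP]) simp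
    then show ?thesis
    proof eventually_elim
      case (elim y)
      show ?case
      proof
        assume "y \<in> ball 0 ?r"
        then have "norm y < t" using t by auto
        then have "(1 / t) *\<^sub>R y \<in> unit_disk" using t(2) by simp
        then show "P y" using elim t(2) by simp
      qed
    qed
  qed
  then show ?thesis by (rule AE_disk_if_AE_balls)
qed

text \<open>In polar coordinates the ray integral is the inner integral of \<open>q\<close> over the disk;
  weighting with \<open>norm x\<close> makes the integral over all rays \<open>x\<close> in the disk converge.\<close>

lemma AE_ray_integral_finite:
  fixes q :: "real ^ 2 \<Rightarrow> real"
  assumes q: "integrable lborel q" and q0: "\<And>x. 0 \<le> q x"
  shows "AE x in lborel. x \<in> unit_disk \<longrightarrow>
    (\<integral>\<^sup>+t. ennreal (t * q (t *\<^sub>R x)) * indicator {0<..1} t \<partial>lborel) < \<infinity>"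
proof -
  note [measurable] = borel_measurable_integrable[OF q]
  have [measurable]: "unit_disk \<in> sets borel" by simp
  define R where "R = (\<lambda>(x, t). ennreal (norm x * (t * q (t *\<^sub>R x))) * (indicator unit_disk x * indicator {0<..1} t))"
  have [measurable]: "R \<in> borel_measurable (lborel \<Otimes>\<^sub>M lborel)"
    unfolding R_def by measurable
  \<comment> \<open>R after the substitution y = t x: the weight |x| t becomes |y| and the Jacobian
    gives 1 / t^2. The integral of 1 / t^2 from |y| to 1 is at most 1 / |y|, which the weight |y|
    cancels.\<close>
  define S where "S = (\<lambda>(y, t). ennreal (norm y * q y) * (ennreal (1 / t\<^sup>2) * (if norm y < t \<and> t \<le> 1 then 1 else 0)))"
  have [measurable]: "S \<in> borel_measurable (lborel \<Otimes>\<^sub>M lborel)"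
    unfolding S_def by measurable
  have slice: "(\<integral>\<^sup>+x. R (x, t) \<partial>lborel) = (\<integral>\<^sup>+y. S (y, t) \<partial>lborel)" for t
  proof (cases "t \<in> {0<..1}")
    case True
    have eq: "ennreal (t\<^sup>2) * S (t *\<^sub>R x, t) = R (x, t)" for x
    proof -
      have "ennreal (t\<^sup>2) * (ennreal (t * norm x * q (t *\<^sub>R x)) * ennreal (1 / t\<^sup>2)) = ennreal (t * norm x * q (t *\<^sub>R x))"
        using True q0 by (simp add: ennreal_mult[symmetric] field_simps)
      moreover have "t * norm x < t \<longleftrightarrow> norm x < 1" using True by simp
      ultimately show ?thesis
        using True by (auto simp: S_def R_def ac_simps split: split_indicator)
    qed
    have "(\<integral>\<^sup>+y. S (y, t) \<partial>lborel) = ennreal (t\<^sup>2) * (\<integral>\<^sup>+x. S (t *\<^sub>R x, t) \<partial>lborel)"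
      using nn_integral_lborel_scale[of "\<lambda>y. S (y, t)" t] True by simp
    also have "\<dots> = (\<integral>\<^sup>+x. R (x, t) \<partial>lborel)"
      unfolding eq[symmetric] by (rule nn_integral_cmult[symmetric]) measurable
    finally show ?thesis by simp
  next
    case False
    have outside: "\<not> (norm y < t \<and> t \<le> 1)" for y :: "real ^ 2"
      using False norm_ge_zero[of y] unfolding greaterThanAtMost_iff by linarith
    have "S (y, t) = 0" for y
      using outside[of y] by (auto simp: S_def)
    moreover have "R (x, t) = 0" for x
      using False by (auto simp: R_def)
    ultimately show ?thesis by simp
  qed
  have inner: "(\<integral>\<^sup>+t. S (y, t) \<partial>lborel) \<le> ennreal (q y)" for y
  proof (cases "0 < norm y \<and> norm y \<le> 1")
    case True
    define r where "r = norm y"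
    have r: "0 < r" "r \<le> 1" using True by (auto simp: r_def)
    have "(\<integral>\<^sup>+t. ennreal (1 / t\<^sup>2) * (if norm y < t \<and> t \<le> 1 then 1 else 0) \<partial>lborel)
        \<le> (\<integral>\<^sup>+t. ennreal (1 / t\<^sup>2) * indicator {r..1} t \<partial>lborel)"
      by (intro nn_integral_mono) (auto simp: r_def split: split_indicator)
    also have "\<dots> = ennreal (- (1 / 1) - (- (1 / r)))"
    proof (rule nn_integral_FTC_Icc)
      show "((\<lambda>t. - (1 / t)) has_real_derivative 1 / t\<^sup>2) (at t)" if "t \<in> {r..1}" for t
        using that r by (auto intro!: derivative_eq_intros simp: power2_eq_square)
    qed (use r in auto)
    also have "\<dots> \<le> ennreal (1 / r)" by (intro ennreal_leI) simp
    finally have le: "(\<integral>\<^sup>+t. ennreal (1 / t\<^sup>2) * (if norm y < t \<and> t \<le> 1 then 1 else 0) \<partial>lborel) \<le> ennreal (1 / r)" .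
    have "(\<integral>\<^sup>+t. S (y, t) \<partial>lborel) = ennreal (r * q y) * (\<integral>\<^sup>+t. ennreal (1 / t\<^sup>2) * (if norm y < t \<and> t \<le> 1 then 1 else 0) \<partial>lborel)"
      unfolding S_def prod.case r_def by (rule nn_integral_cmult) measurable
    also have "\<dots> \<le> ennreal (r * q y) * ennreal (1 / r)"
      using le by (rule mult_left_mono) simp
    also have "\<dots> = ennreal (q y)" using r q0 by (simp add: ennreal_mult[symmetric])
    finally show ?thesis .
  next
    case False
    then have "S (y, t) = 0" for t by (auto simp: S_def)
    then show ?thesis by simp
  qed
  have "(\<integral>\<^sup>+x. \<integral>\<^sup>+t. R (x, t) \<partial>lborel \<partial>lborel) = (\<integral>\<^sup>+t. \<integral>\<^sup>+x. R (x, t) \<partial>lborel \<partial>lborel)"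
    by (rule lborel_pair.Fubini'[symmetric]) simp
  also have "\<dots> = (\<integral>\<^sup>+t. \<integral>\<^sup>+y. S (y, t) \<partial>lborel \<partial>lborel)" by (simp add: slice)
  also have "\<dots> = (\<integral>\<^sup>+y. \<integral>\<^sup>+t. S (y, t) \<partial>lborel \<partial>lborel)"
    by (rule lborel_pair.Fubini') simp
  also have "\<dots> \<le> (\<integral>\<^sup>+y. ennreal (q y) \<partial>lborel)" by (intro nn_integral_mono inner)
  also have "\<dots> < \<infinity>" using q q0 by (simp add: integrable_iff_bounded)
  finally have "AE x in lborel. (\<integral>\<^sup>+t. R (x, t) \<partial>lborel) \<noteq> \<infinity>"
    by (intro nn_integral_noteq_infinite) auto
  \<comment> \<open>The origin has to be excluded: the weight |x| vanishes there, so finiteness of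
    the weighted integral says nothing.\<close>
  then show ?thesis
    using AE_lborel_singleton[of "0 :: real ^ 2"]
  proof eventually_elim
    case (elim x)
    show ?case
    proof
      assume x: "x \<in> unit_disk"
      have "(\<integral>\<^sup>+t. R (x, t) \<partial>lborel)
          = (\<integral>\<^sup>+t. ennreal (norm x) * (ennreal (t * q (t *\<^sub>R x)) * indicator {0<..1} t) \<partial>lborel)"
        using x q0 by (intro nn_integral_cong) (auto simp: R_def ennreal_mult' split: split_indicator)
      also have "\<dots> = ennreal (norm x) * (\<integral>\<^sup>+t. ennreal (t * q (t *\<^sub>R x)) * indicator {0<..1} t \<partial>lborel)"
        by (rule nn_integral_cmult) measurable
      finally show "(\<integral>\<^sup>+t. ennreal (t * q (t *\<^sub>R x)) * indicator {0<..1} t \<partial>lborel) < \<infinity>"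
        using elim by (auto simp: ennreal_mult_eq_top_iff less_top)
    qed
  qed
qed

section \<open>Borel representatives and the weak Hessian of a Sobolev function\<close>

text \<open>The disk has finite measure, so square integrable functions are integrable. A Borel
  representative extended by zero moves the problem to \<open>lborel\<close>, where Fubini and the
  substitution rules are applied.\<close>

lemma square_integrable_representative:
  assumes g: "square_integrable unit_disk g"
  shows "\<exists>g'. integrable lborel g' \<and> integrable lborel (\<lambda>x. (g' x)\<^sup>2) \<and>
    (\<forall>x. x \<notin> unit_disk \<longrightarrow> g' x = 0) \<and> (AE x in lborel. x \<in> unit_disk \<longrightarrow> g x = g' x)"
proof -
  have m: "g \<in> borel_measurable (lebesgue_on unit_disk)"
    and i2: "integrable (lebesgue_on unit_disk) (\<lambda>x. (g x)\<^sup>2)"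
    using g by (auto simp: square_integrable_def)
  have one: "integrable (lebesgue_on unit_disk) (\<lambda>x. 1 :: real)"
    by (intro finite_measure.integrable_const finite_measure_lebesgue_on) simp
  have i1: "integrable (lebesgue_on unit_disk) g"
  proof (rule Bochner_Integration.integrable_bound[OF Bochner_Integration.integrable_add[OF one i2] m])
    \<comment> \<open>Expanding the square of |g| - 1 gives 2 |g| \<le> 1 + g^2.\<close>
    have "\<bar>g x\<bar> \<le> \<bar>1 + (g x)\<^sup>2\<bar>" for x
      using zero_le_power2[of "\<bar>g x\<bar> - 1"] by (simp add: power2_diff)
    then show "AE x in lebesgue_on unit_disk. norm (g x) \<le> norm (1 + (g x)\<^sup>2)" by simp
  qed
  have L: "integrable lebesgue (\<lambda>x. indicator unit_disk x * g x)"
    using i1 by (subst (asm) integrable_restrict_space) auto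
  have L2: "integrable lebesgue (\<lambda>x. indicator unit_disk x * (g x)\<^sup>2)"
    using i2 by (subst (asm) integrable_restrict_space) auto
  obtain f where f: "integrable lborel f" "AE x in lborel. indicator unit_disk x * g x = f x"
    using integrable_lebesgue_borel_representative[OF L] by blast
  obtain k where k: "integrable lborel k" "AE x in lborel. indicator unit_disk x * (g x)\<^sup>2 = k x"
    using integrable_lebesgue_borel_representative[OF L2] by blast
  define g' where "g' = (\<lambda>x. f x * indicator unit_disk x)"
  have g': "integrable lborel g'"
    unfolding g'_def by (rule integrable_real_mult_indicator[OF _ f(1)]) simp
  moreover have "integrable lborel (\<lambda>x. (g' x)\<^sup>2)"
  proof (rule integrable_cong_AE_imp[OF k(1)])
    show "(\<lambda>x. (g' x)\<^sup>2) \<in> borel_measurable lborel" using g' by (intro borel_measurable_power) auto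
    show "AE x in lborel. k x = (g' x)\<^sup>2"
      using f(2) k(2) by eventually_elim (auto simp: g'_def split: split_indicator)
  qed
  moreover have "AE x in lborel. x \<in> unit_disk \<longrightarrow> g x = g' x"
    using f(2) by eventually_elim (auto simp: g'_def)
  moreover have "\<forall>x. x \<notin> unit_disk \<longrightarrow> g' x = 0"
    by (simp add: g'_def)
  ultimately show ?thesis by blast
qed

lemma AE_lebesgue_on_disk:
  "(AE x in lebesgue_on unit_disk. P x) \<longleftrightarrow> (AE x in lborel. x \<in> unit_disk \<longrightarrow> P x)"
  by (simp add: AE_restrict_space_iff AE_completion_iff)

lemma integral_lebesgue_on_disk_representative:
  fixes g g' \<phi> :: "real ^ 2 \<Rightarrow> real"
  assumes g: "g \<in> borel_measurable (lebesgue_on unit_disk)"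
    and g': "integrable lborel g'" "\<And>x. x \<notin> unit_disk \<Longrightarrow> g' x = 0"
    and eq: "AE x in lborel. x \<in> unit_disk \<longrightarrow> g x = g' x"
    and \<phi>: "\<phi> \<in> borel_measurable borel"
  shows "(LINT x|lebesgue_on unit_disk. g x * \<phi> x) = (\<integral>x. g' x * \<phi> x \<partial>lborel)"
proof -
  have m': "(\<lambda>x. g' x * \<phi> x) \<in> borel_measurable lborel"
    by (rule borel_measurable_times[OF borel_measurable_integrable[OF g'(1)]]) (simp add: \<phi>)
  have \<phi>L: "\<phi> \<in> borel_measurable (lebesgue_on unit_disk)"
    using \<phi> by (intro measurable_restrict_space1 measurable_completion) simp
  have "(LINT x|lebesgue_on unit_disk. g x * \<phi> x) = (LINT x|lebesgue_on unit_disk. g' x * \<phi> x)"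
  proof (rule integral_cong_AE)
    show "(\<lambda>x. g x * \<phi> x) \<in> borel_measurable (lebesgue_on unit_disk)"
      using g \<phi>L by (rule borel_measurable_times)
    show "(\<lambda>x. g' x * \<phi> x) \<in> borel_measurable (lebesgue_on unit_disk)"
      using m' by (intro measurable_restrict_space1 measurable_completion) simp
    show "AE x in lebesgue_on unit_disk. g x * \<phi> x = g' x * \<phi> x"
      unfolding AE_lebesgue_on_disk using eq by eventually_elim simp
  qed
  also have "\<dots> = (LINT x|lebesgue. indicator unit_disk x *\<^sub>R (g' x * \<phi> x))"
    by (rule integral_restrict_space) simp
  also have "\<dots> = (LINT x|lebesgue. g' x * \<phi> x)"
    by (intro Bochner_Integration.integral_cong) (auto simp: g'(2) split: split_indicator)
  also have "\<dots> = (\<integral>x. g' x * \<phi> x \<partial>lborel)"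
    using m' by (rule integral_completion)
  finally show ?thesis .
qed

text \<open>W is the Hessian whose determinant and norm are at stake; it is linked to the Borel
  functions used in the analysis only almost everywhere.\<close>

locale disk_hessian_representative = radial_weak_hessian U G1 G2 H11 H12 H21 H22
  for U G1 G2 H11 H12 H21 H22 :: "real ^ 2 \<Rightarrow> real" +
  fixes W :: "real ^ 2 \<Rightarrow> real ^ 2 ^ 2"
  assumes square_integrable:
    "integrable lborel (\<lambda>x. (H11 x)\<^sup>2 + (H12 x)\<^sup>2 + ((H21 x)\<^sup>2 + (H22 x)\<^sup>2))"
    and representative: "AE x in lborel. x \<in> unit_disk \<longrightarrow>
      W x $ 1 $ 1 = H11 x \<and> W x $ 1 $ 2 = H12 x \<and> W x $ 2 $ 1 = H21 x \<and> W x $ 2 $ 2 = H22 x"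
begin

lemma det_frob_eigenvalues:
  "AE x in lborel. x \<in> unit_disk \<longrightarrow>
    det (W x) = tangential x * radial x \<and> frob_sq (W x) = (tangential x)\<^sup>2 + (radial x)\<^sup>2"
  using hessian_eigenvalues representative
  by eventually_elim (auto simp: det_2 frob_sq_def sum_2)

lemma finite_on_rays:
  "AE x in lborel. x \<in> unit_disk \<longrightarrow>
    (\<integral>\<^sup>+t. ennreal (t * (tangential (t *\<^sub>R x))\<^sup>2) * indicator {0<..1} t \<partial>lborel) < \<infinity>"
proof (rule AE_ray_integral_finite)
  show "integrable lborel (\<lambda>x. (tangential x)\<^sup>2)"
  proof (rule Bochner_Integration.integrable_bound[OF square_integrable])
    show "AE x in lborel. norm ((tangential x)\<^sup>2)
      \<le> norm ((H11 x)\<^sup>2 + (H12 x)\<^sup>2 + ((H21 x)\<^sup>2 + (H22 x)\<^sup>2))"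
      using hessian_eigenvalues
    proof eventually_elim
      case (elim x)
      show ?case
      proof (cases "x \<in> unit_disk")
        case True
        then show ?thesis using elim by simp
      qed (simp add: tangential_outside)
    qed
  qed measurable
qed simp

end

lemma weak_deriv_tensor:
  assumes "weak_deriv unit_disk js f g" "test_pair a b"
    and f: "f \<in> borel_measurable (lebesgue_on unit_disk)" "integrable lborel f'"
      "\<And>x. x \<notin> unit_disk \<Longrightarrow> f' x = 0" "AE x in lborel. x \<in> unit_disk \<longrightarrow> f x = f' x"
    and g: "g \<in> borel_measurable (lebesgue_on unit_disk)" "integrable lborel g'"
      "\<And>x. x \<notin> unit_disk \<Longrightarrow> g' x = 0" "AE x in lborel. x \<in> unit_disk \<longrightarrow> g x = g' x"
  shows "(\<integral>x. f' x * iter_partial js (tensor a b) x \<partial>lborel)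
    = (- 1) ^ length js * (\<integral>x. g' x * tensor a b x \<partial>lborel)"
proof -
  note sm = test_pair_smooth[OF assms(2)]
  obtain m n where mn: "iter_partial js (tensor a b) = tensor ((deriv ^^ m) a) ((deriv ^^ n) b)"
    using iter_partial_tensor[OF sm] by blast
  have meas: "iter_partial js (tensor a b) \<in> borel_measurable borel"
    unfolding mn using sm by (intro tensor_measurable smooth_real_deriv_iter)
  have "(LINT x|lebesgue_on unit_disk. f x * iter_partial js (tensor a b) x)
      = (- 1) ^ length js * (LINT x|lebesgue_on unit_disk. g x * tensor a b x)"
    using assms(1) test_function_tensor[OF assms(2)] unfolding weak_deriv_def by blast
  moreover have "(LINT x|lebesgue_on unit_disk. f x * iter_partial js (tensor a b) x)
      = (\<integral>x. f' x * iter_partial js (tensor a b) x \<partial>lborel)"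
    by (rule integral_lebesgue_on_disk_representative[OF f(1,2) _ f(4) meas]) (rule f(3))
  moreover have "(LINT x|lebesgue_on unit_disk. g x * tensor a b x) = (\<integral>x. g' x * tensor a b x \<partial>lborel)"
    by (rule integral_lebesgue_on_disk_representative[OF g(1,2) _ g(4) tensor_measurable[OF sm]]) (rule g(3))
  ultimately show ?thesis by simp
qed

lemma integrable_on_box:
  assumes "locally_integrable unit_disk w" "cbox l u \<subseteq> unit_disk"
  shows "integrable lebesgue (\<lambda>x. w x * indicator (cbox l u) x)"
proof -
  have "integrable (lebesgue_on (cbox l u)) w"
    using assms compact_cbox unfolding locally_integrable_def by blast
  then show ?thesis
    by (subst (asm) integrable_restrict_space) (auto simp: mult.commute)
qed

lemma weak_deriv_unique:
  assumes w: "weak_deriv unit_disk js f w" and g: "weak_deriv unit_disk js f g"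
  shows "AE x in lborel. x \<in> unit_disk \<longrightarrow> w x = g x"
proof -
  have loc: "locally_integrable unit_disk w" "locally_integrable unit_disk g"
    using w g by (auto simp: weak_deriv_def)
  have "AE x in lborel. x \<in> unit_disk \<longrightarrow> w x - g x = 0"
  proof (rule AE_disk_zero_if_locally_integrable)
    show "integrable lebesgue (\<lambda>x. (w x - g x) * indicator (cbox l u) x)" if "cbox l u \<subseteq> unit_disk" for l u
      using integrable_on_box[OF loc(1) that] integrable_on_box[OF loc(2) that]
      by (simp add: left_diff_distrib)
    fix a b l u
    assume ab: "test_pair a b" and lu: "cbox l u \<subseteq> unit_disk"
      and supp: "\<And>x. tensor a b x \<noteq> 0 \<Longrightarrow> x \<in> cbox l u"
    have m: "tensor a b \<in> borel_measurable lebesgue"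
      using tensor_measurable[OF test_pair_smooth[OF ab]] by (intro measurable_completion) simp
    obtain C where C: "\<And>x. \<bar>tensor a b x\<bar> \<le> C" using tensor_bounded[OF ab] by blast
    have int: "integrable lebesgue (\<lambda>x. h x * indicator (cbox l u) x * tensor a b x)"
      if h: "locally_integrable unit_disk h" for h
    proof (rule Bochner_Integration.integrable_bound)
      show "integrable lebesgue (\<lambda>x. C * (h x * indicator (cbox l u) x))"
        using integrable_on_box[OF h lu] by simp
      show "(\<lambda>x. h x * indicator (cbox l u) x * tensor a b x) \<in> borel_measurable lebesgue"
        by (rule borel_measurable_times[OF borel_measurable_integrable[OF integrable_on_box[OF h lu]] m])
      show "AE x in lebesgue. norm (h x * indicator (cbox l u) x * tensor a b x)
          \<le> norm (C * (h x * indicator (cbox l u) x))"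
      proof (rule AE_I2)
        fix x
        have "\<bar>h x * indicator (cbox l u) x\<bar> * \<bar>tensor a b x\<bar> \<le> \<bar>h x * indicator (cbox l u) x\<bar> * \<bar>C\<bar>"
          using C[of x] by (intro mult_left_mono) auto
        then show "norm (h x * indicator (cbox l u) x * tensor a b x)
            \<le> norm (C * (h x * indicator (cbox l u) x))"
          by (simp add: abs_mult mult.commute)
      qed
    qed
    have disk: "(\<integral>x. h x * indicator (cbox l u) x * tensor a b x \<partial>lebesgue)
        = (LINT x|lebesgue_on unit_disk. h x * tensor a b x)" for h
    proof -
      have "(LINT x|lebesgue_on unit_disk. h x * tensor a b x)
          = (LINT x|lebesgue. indicator unit_disk x *\<^sub>R (h x * tensor a b x))"
        by (rule integral_restrict_space) simp
      also have "\<dots> = (\<integral>x. h x * indicator (cbox l u) x * tensor a b x \<partial>lebesgue)"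
      proof (rule Bochner_Integration.integral_cong[OF refl])
        fix x
        show "indicator unit_disk x *\<^sub>R (h x * tensor a b x) = h x * indicator (cbox l u) x * tensor a b x"
          using supp[of x] lu by (cases "tensor a b x = 0") (auto split: split_indicator)
      qed
      finally show ?thesis by simp
    qed
    have "(LINT x|lebesgue_on unit_disk. w x * tensor a b x) = (LINT x|lebesgue_on unit_disk. g x * tensor a b x)"
      using w g test_function_tensor[OF ab] by (simp add: weak_deriv_def)
    then show "(\<integral>x. (w x - g x) * indicator (cbox l u) x * tensor a b x \<partial>lebesgue) = 0"
      using int[OF loc(1)] int[OF loc(2)]
      by (simp add: left_diff_distrib disk)
  qed
  then show ?thesis by eventually_elim simp
qed

text \<open>The profile v may be an arbitrary, even non-measurable function. It only serves to
  compare U' at x and at the rotated point, and the exceptional set is pulled back by the rotation,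
  which preserves null sets.\<close>

lemma radial_representative_invariant:
  assumes "radially_symmetric U" and U': "\<And>x. x \<notin> unit_disk \<Longrightarrow> U' x = 0"
    "AE x in lborel. x \<in> unit_disk \<longrightarrow> U x = U' x"
  shows "AE x in lborel. U' (rotation s x) = U' x"
proof -
  obtain v where "AE x in lebesgue_on unit_disk. U x = v (norm x)"
    using assms(1) unfolding radially_symmetric_def by blast
  then have v: "AE x in lborel. x \<in> unit_disk \<longrightarrow> U' x = v (norm x)"
    unfolding AE_lebesgue_on_disk using U'(2) by eventually_elim simp
  then have "AE x in distr lborel borel (rotation s). x \<in> unit_disk \<longrightarrow> U' x = v (norm x)"
    unfolding distr_lborel_orthogonal[OF orthogonal_transformation_rotation] .
  then have "AE x in lborel. rotation s x \<in> unit_disk \<longrightarrow> U' (rotation s x) = v (norm (rotation s x))"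
    by (rule AE_distrD[of _ lborel borel, rotated]) simp
  with v show ?thesis
  proof eventually_elim
    case (elim x)
    then show ?case using U'(1)[of x] U'(1)[of "rotation s x"] by (cases "norm x < 1") auto
  qed
qed

text \<open>Bundled as a property of g' alone, so that a single use of choice gives a family
  \<open>D\<close> indexed by lists of directions.\<close>

definition weak_deriv_representative ::
    "(real ^ 2 \<Rightarrow> real) \<Rightarrow> 2 list \<Rightarrow> (real ^ 2 \<Rightarrow> real) \<Rightarrow> bool" where
  "weak_deriv_representative U js g' \<longleftrightarrow>
    (\<exists>g. weak_deriv unit_disk js U g \<and> g \<in> borel_measurable (lebesgue_on unit_disk)
      \<and> integrable lborel g' \<and> integrable lborel (\<lambda>x. (g' x)\<^sup>2) \<and> (\<forall>x. x \<notin> unit_disk \<longrightarrow> g' x = 0)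
      \<and> (AE x in lborel. x \<in> unit_disk \<longrightarrow> g x = g' x))"

lemma sobolev_disk_hessian_representative:
  assumes U: "U \<in> sobolev2 2 unit_disk" and rad: "radially_symmetric U"
  shows "\<exists>U' G1 G2 H11 H12 H21 H22.
    disk_hessian_representative U' G1 G2 H11 H12 H21 H22 (weak_hessian unit_disk U)"
proof -
  have sq: "square_integrable unit_disk U"
    and ex: "\<And>js. length js \<le> 2 \<Longrightarrow> \<exists>g. weak_deriv unit_disk js U g \<and> square_integrable unit_disk g"
    using U by (auto simp: sobolev2_def)
  have "\<exists>g'. length js \<le> 2 \<longrightarrow> weak_deriv_representative U js g'" for js
  proof (cases "length js \<le> 2")
    case True
    then obtain g where g: "weak_deriv unit_disk js U g" "square_integrable unit_disk g"
      using ex by blast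
    then show ?thesis
      using square_integrable_representative[OF g(2)]
      unfolding square_integrable_def weak_deriv_representative_def by blast
  qed simp
  then obtain D where D: "\<And>js. length js \<le> 2 \<Longrightarrow> weak_deriv_representative U js (D js)"
    using choice[of "\<lambda>js g'. length js \<le> 2 \<longrightarrow> weak_deriv_representative U js g'"] by blast
  have D_int: "integrable lborel (D js)" "integrable lborel (\<lambda>x. (D js x)\<^sup>2)" "x \<notin> unit_disk \<Longrightarrow> D js x = 0"
    if "length js \<le> 2" for js x
    using D[OF that] unfolding weak_deriv_representative_def by (elim exE conjE, simp)+
  obtain U' where U': "integrable lborel U'"
      "\<forall>x. x \<notin> unit_disk \<longrightarrow> U' x = 0" "AE x in lborel. x \<in> unit_disk \<longrightarrow> U x = U' x"
    using square_integrable_representative[OF sq] by blast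
  have Um: "U \<in> borel_measurable (lebesgue_on unit_disk)" using sq by (simp add: square_integrable_def)
  have D_weak: "(\<integral>x. U' x * iter_partial js (tensor a b) x \<partial>lborel)
      = (- 1) ^ length js * (\<integral>x. D js x * tensor a b x \<partial>lborel)"
    if js: "length js \<le> 2" and ab: "test_pair a b" for js a b
  proof -
    obtain g where g: "weak_deriv unit_disk js U g" "g \<in> borel_measurable (lebesgue_on unit_disk)"
      "AE x in lborel. x \<in> unit_disk \<longrightarrow> g x = D js x"
      using D[OF js] unfolding weak_deriv_representative_def by blast
    show ?thesis
      by (rule weak_deriv_tensor[OF g(1) ab Um U'(1) _ U'(3) g(2) D_int(1)[OF js] _ g(3)])
         (use U'(2) D_int(3)[OF js] in auto)
  qed
  define W where "W = weak_hessian unit_disk U"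
  have "\<exists>H. has_weak_hessian unit_disk U H"
  proof -
    have "\<forall>i j. \<exists>g. weak_deriv unit_disk [i, j] U g" using ex by force
    then obtain h where "\<And>i j. weak_deriv unit_disk [i, j] U (h i j)" by metis
    then have "has_weak_hessian unit_disk U (\<lambda>x. \<chi> i j. h i j x)"
      by (simp add: has_weak_hessian_def)
    then show ?thesis by blast
  qed
  then have "has_weak_hessian unit_disk U W"
    unfolding W_def weak_hessian_def by (rule someI_ex)
  then have W: "weak_deriv unit_disk [i, j] U (\<lambda>x. W x $ i $ j)" for i j
    unfolding has_weak_hessian_def by blast
  \<comment> \<open>\<open>weak_hessian\<close> is an arbitrary choice, not tied to the square
    integrable derivatives of the Sobolev space. Uniqueness of weak derivatives identifies the two
    almost everywhere.\<close>
  have WD: "AE x in lborel. x \<in> unit_disk \<longrightarrow> W x $ i $ j = D [i, j] x" for i j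
  proof -
    obtain g where g: "weak_deriv unit_disk [i, j] U g" "AE x in lborel. x \<in> unit_disk \<longrightarrow> g x = D [i, j] x"
      using D[of "[i, j]"] by (auto simp: weak_deriv_representative_def)
    show ?thesis using weak_deriv_unique[OF W g(1)] g(2) by eventually_elim simp
  qed
  have first: "(\<integral>x. U' x * tensor (deriv a) b x \<partial>lborel) = - (\<integral>x. D [1] x * tensor a b x \<partial>lborel)"
    "(\<integral>x. U' x * tensor a (deriv b) x \<partial>lborel) = - (\<integral>x. D [2] x * tensor a b x \<partial>lborel)"
    if ab: "test_pair a b" for a b
    using D_weak[of "[1]", OF _ ab] D_weak[of "[2]", OF _ ab]
    by (simp_all add: partial_deriv_tensor[OF test_pair_smooth[OF ab]])
  have second: "(\<integral>x. U' x * tensor (deriv (deriv a)) b x \<partial>lborel) = (\<integral>x. D [1, 1] x * tensor a b x \<partial>lborel)"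
    "(\<integral>x. U' x * tensor (deriv a) (deriv b) x \<partial>lborel) = (\<integral>x. D [1, 2] x * tensor a b x \<partial>lborel)"
    "(\<integral>x. U' x * tensor (deriv a) (deriv b) x \<partial>lborel) = (\<integral>x. D [2, 1] x * tensor a b x \<partial>lborel)"
    "(\<integral>x. U' x * tensor a (deriv (deriv b)) x \<partial>lborel) = (\<integral>x. D [2, 2] x * tensor a b x \<partial>lborel)"
    if ab: "test_pair a b" for a b
  proof -
    note sm = test_pair_smooth[OF ab] test_pair_smooth[OF ab, THEN smooth_real_deriv]
    show "(\<integral>x. U' x * tensor (deriv (deriv a)) b x \<partial>lborel) = (\<integral>x. D [1, 1] x * tensor a b x \<partial>lborel)"
      "(\<integral>x. U' x * tensor (deriv a) (deriv b) x \<partial>lborel) = (\<integral>x. D [1, 2] x * tensor a b x \<partial>lborel)"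
      "(\<integral>x. U' x * tensor (deriv a) (deriv b) x \<partial>lborel) = (\<integral>x. D [2, 1] x * tensor a b x \<partial>lborel)"
      "(\<integral>x. U' x * tensor a (deriv (deriv b)) x \<partial>lborel) = (\<integral>x. D [2, 2] x * tensor a b x \<partial>lborel)"
      using D_weak[of "[1, 1]", OF _ ab] D_weak[of "[1, 2]", OF _ ab] D_weak[of "[2, 1]", OF _ ab] D_weak[of "[2, 2]", OF _ ab]
      by (simp_all add: partial_deriv_tensor sm)
  qed
  have inv: "AE x in lborel. U' (rotation s x) = U' x" for s
    by (rule radial_representative_invariant[OF rad _ U'(3)]) (use U'(2) in blast)
  \<comment> \<open>The derivatives of \<open>D [1]\<close> are obtained from those of U': testing
    \<open>first\<close> with a derivative of the test function moves both derivatives onto it, and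
    \<open>second\<close> then brings them to the Hessian entry.\<close>
  have D1: "weak_radial_derivative (D [1]) (D [1, 1]) (D [1, 2])"
  proof (rule weak_radial_derivative.intro)
    fix a b assume ab: "test_pair a b"
    show "(\<integral>x. D [1] x * tensor (deriv a) b x \<partial>lborel) = - (\<integral>x. D [1, 1] x * tensor a b x \<partial>lborel)"
      using first(1)[OF test_pair_deriv1[OF ab]] second(1)[OF ab] by simp
    show "(\<integral>x. D [1] x * tensor a (deriv b) x \<partial>lborel) = - (\<integral>x. D [1, 2] x * tensor a b x \<partial>lborel)"
      using first(1)[OF test_pair_deriv2[OF ab]] second(2)[OF ab] by simp
  qed (simp_all add: D_int)
  have D2: "weak_radial_derivative (D [2]) (D [2, 1]) (D [2, 2])"
  proof (rule weak_radial_derivative.intro)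
    fix a b assume ab: "test_pair a b"
    show "(\<integral>x. D [2] x * tensor (deriv a) b x \<partial>lborel) = - (\<integral>x. D [2, 1] x * tensor a b x \<partial>lborel)"
      using first(2)[OF test_pair_deriv1[OF ab]] second(3)[OF ab] by simp
    show "(\<integral>x. D [2] x * tensor a (deriv b) x \<partial>lborel) = - (\<integral>x. D [2, 2] x * tensor a b x \<partial>lborel)"
      using first(2)[OF test_pair_deriv2[OF ab]] second(4)[OF ab] by simp
  qed (simp_all add: D_int)
  have sq_int: "integrable lborel (\<lambda>x. (D [1, 1] x)\<^sup>2 + (D [1, 2] x)\<^sup>2 + ((D [2, 1] x)\<^sup>2 + (D [2, 2] x)\<^sup>2))"
    by (intro Bochner_Integration.integrable_add D_int) simp_all
  have entries: "AE x in lborel. x \<in> unit_disk \<longrightarrow> W x $ 1 $ 1 = D [1, 1] x \<and> W x $ 1 $ 2 = D [1, 2] x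
      \<and> W x $ 2 $ 1 = D [2, 1] x \<and> W x $ 2 $ 2 = D [2, 2] x"
    using WD[of 1 1] WD[of 1 2] WD[of 2 1] WD[of 2 2] by eventually_elim simp
  have "disk_hessian_representative U' (D [1]) (D [2]) (D [1, 1]) (D [1, 2]) (D [2, 1]) (D [2, 2]) W"
    by (intro disk_hessian_representative.intro radial_weak_hessian.intro
        disk_hessian_representative_axioms.intro U'(1) inv first D1 D2 sq_int entries)
  then show ?thesis unfolding W_def by blast
qed

theorem mainTheorem3:
  fixes U V :: "real ^ 2 \<Rightarrow> real"
  assumes "U \<in> sobolev2 2 unit_disk" and "V \<in> sobolev2 2 unit_disk"
    and "radially_symmetric U" and "radially_symmetric V"
    and "AE x in lebesgue_on unit_disk.
           det (weak_hessian unit_disk U x) = det (weak_hessian unit_disk V x)"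
  shows "(AE x in lebesgue_on unit_disk.
            frob_sq (weak_hessian unit_disk U x) = frob_sq (weak_hessian unit_disk V x))
    \<and> W_energy (\<lambda>x. det (weak_hessian unit_disk V x)) U
        = W_energy (\<lambda>x. det (weak_hessian unit_disk V x)) V
    \<and> (\<forall>k. W_energy k U = W_energy k V)"
proof -
  obtain U' G1 G2 H11 H12 H21 H22 where
    "disk_hessian_representative U' G1 G2 H11 H12 H21 H22 (weak_hessian unit_disk U)"
    using sobolev_disk_hessian_representative[OF assms(1,3)] by blast
  then interpret U: disk_hessian_representative U' G1 G2 H11 H12 H21 H22 "weak_hessian unit_disk U" .
  obtain V' K1 K2 L11 L12 L21 L22 where
    "disk_hessian_representative V' K1 K2 L11 L12 L21 L22 (weak_hessian unit_disk V)"
    using sobolev_disk_hessian_representative[OF assms(2,4)] by blast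
  then interpret V: disk_hessian_representative V' K1 K2 L11 L12 L21 L22 "weak_hessian unit_disk V" .
  have det_eq: "AE x in lborel. x \<in> unit_disk \<longrightarrow> U.tangential x * U.radial x = V.tangential x * V.radial x"
    using assms(5)[unfolded AE_lebesgue_on_disk] U.det_frob_eigenvalues V.det_frob_eigenvalues
    by eventually_elim auto
  have det_rays: "AE x in lborel. x \<in> unit_disk \<longrightarrow> (AE t in lborel. t \<in> {0<..1} \<longrightarrow>
      U.tangential (t *\<^sub>R x) * U.radial (t *\<^sub>R x) = V.tangential (t *\<^sub>R x) * V.radial (t *\<^sub>R x))"
    by (rule AE_rays_if_AE_disk[OF _ det_eq]) measurable
  have "AE x in lborel. x \<in> unit_disk \<longrightarrow>
    (U.tangential x)\<^sup>2 = (V.tangential x)\<^sup>2 \<and> (U.radial x)\<^sup>2 = (V.radial x)\<^sup>2"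
  proof (rule AE_disk_if_AE_rays)
    show "AE x in lborel. x \<in> unit_disk \<longrightarrow> (AE t in lborel. t \<in> {0<..1} \<longrightarrow>
        (U.tangential (t *\<^sub>R x))\<^sup>2 = (V.tangential (t *\<^sub>R x))\<^sup>2
        \<and> (U.radial (t *\<^sub>R x))\<^sup>2 = (V.radial (t *\<^sub>R x))\<^sup>2)"
      using det_rays U.primitive_on_rays V.primitive_on_rays U.finite_on_rays V.finite_on_rays
    proof eventually_elim
      case (elim x)
      show ?case
      proof
        assume x: "x \<in> unit_disk"
        show "AE t in lborel. t \<in> {0<..1} \<longrightarrow>
          (U.tangential (t *\<^sub>R x))\<^sup>2 = (V.tangential (t *\<^sub>R x))\<^sup>2
          \<and> (U.radial (t *\<^sub>R x))\<^sup>2 = (V.radial (t *\<^sub>R x))\<^sup>2"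
        proof (rule eigenvalue_squares_eq_on_ray)
          show "(\<lambda>t. U.tangential (t *\<^sub>R x)) \<in> borel_measurable borel"
            "(\<lambda>t. V.tangential (t *\<^sub>R x)) \<in> borel_measurable borel"
            by measurable
        qed (use elim x in blast)+
      qed
    qed
  qed measurable
  then have frob_eq: "AE x in lebesgue_on unit_disk.
      frob_sq (weak_hessian unit_disk U x) = frob_sq (weak_hessian unit_disk V x)"
    unfolding AE_lebesgue_on_disk using U.det_frob_eigenvalues V.det_frob_eigenvalues
    by eventually_elim auto
  \<comment> \<open>For any k the two determinant conditions are equivalent, so the energies are
    infinite together or are both integrals of almost everywhere equal functions.\<close>
  have energy_eq: "W_energy k U = W_energy k V" for k
  proof -
    have "(AE x in lebesgue_on unit_disk. det (weak_hessian unit_disk U x) = k x)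
      \<longleftrightarrow> (AE x in lebesgue_on unit_disk. det (weak_hessian unit_disk V x) = k x)"
      using assms(5) by (intro eventually_cong) auto
    moreover have "(\<integral>\<^sup>+ x. ennreal (frob_sq (weak_hessian unit_disk U x)) \<partial>lebesgue_on unit_disk)
        = (\<integral>\<^sup>+ x. ennreal (frob_sq (weak_hessian unit_disk V x)) \<partial>lebesgue_on unit_disk)"
      by (rule nn_integral_cong_AE) (use frob_eq in eventually_elim, simp)
    ultimately show ?thesis by (simp add: W_energy_def)
  qed
  show ?thesis using frob_eq energy_eq by blast
qed

end
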